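(* Given any positive integer $m$ there exists a (nonempty) family $\mathcal{M}$ of $S^1$-invariant Riemannian metrics on the unit disc with positive Gaussian curvature and total area $\pi$, such that for every metric in $\mathcal{M}$ the first $m$ eigenvalues of the Laplace operator with both Neumann and Dirichlet boundary conditions are simple. In both cases, the eigenfunctions corresponding to the $j$-th eigenvalue ($j=2,\ldots,m$) are also invariant by $S^1$ and have $j-1$ nodal lines, which are closed disjoint circles dividing the disc into $j$ nodal domains. In the Neumann case the second eigenfunction may be chosen in such a way that its (strict) maximum is attained at the origin.
   Context: Let $D\subset\mathbb{R}^2$ be the unit disc centred at the origin, on which $S^1$ acts by rotations about the origin. A metric (or function) on $D$ is $S^1$-invariant if it is invariant under this action. For a Riemannian metric $g$ on $D$ with Laplace-Beltrami operator $\Delta_g$, the eigenvalues with Dirichlet (respectively Neumann) boundary conditions are the numbers $\gamma$ for which $\Delta_g u+\gamma u=0$ in $D$ has a nonzero solution with $u=0$ (respectively $\partial u/\partial\nu=0$, $\nu$ the conormal direction) on $\partial D$; they are numbered in increasing order starting from $j=1$, counted with multiplicity (in the Neumann case the first eigenvalue is $0$). The nodal set of an eigenfunction is the closure of the subset of the (open) disc where it vanishes; nodal lines are the components of the nodal set, and nodal domains are the connected components of the complement of the nodal set in the open disc. *)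

theory Defs
  imports "HOL-Analysis.Analysis" "HOL-Library.Function_Algebras"
begin

abbreviation disc :: "(real^2) set" where "disc \<equiv> ball 0 1"
abbreviation closed_disc :: "(real^2) set" where "closed_disc \<equiv> cball 0 1"
abbreviation boundary_circle :: "(real^2) set" where "boundary_circle \<equiv> sphere 0 1"

text \<open>Partial derivatives are taken within a set \<open>S\<close> (in practice the open or the closed disc).
  At interior points of \<open>S\<close> this is the ordinary partial derivative; at boundary points of the
  closed disc the derivative within the disc is unique, since the disc is convex with nonempty
  interior, and it is the continuous extension of the interior derivative for \<open>C\<^sup>1\<close> functions.\<close>

definition pderiv_within :: "(real^2) set \<Rightarrow> 2 \<Rightarrow> (real^2 \<Rightarrow> real) \<Rightarrow> real^2 \<Rightarrow> real" where
  "pderiv_within S i f x = frechet_derivative f (at x within S) (axis i 1)"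

fun Ck_on :: "nat \<Rightarrow> (real^2) set \<Rightarrow> (real^2 \<Rightarrow> real) \<Rightarrow> bool" where
  "Ck_on 0 S f \<longleftrightarrow> continuous_on S f"
| "Ck_on (Suc k) S f \<longleftrightarrow> f differentiable_on S \<and> (\<forall>i. Ck_on k S (pderiv_within S i f))"

definition S1_invariant_fun :: "(real^2 \<Rightarrow> real) \<Rightarrow> bool" where
  "S1_invariant_fun u \<longleftrightarrow>
     (\<forall>A :: real^2^2. rotation_matrix A \<longrightarrow> (\<forall>x\<in>closed_disc. u (A *v x) = u x))"

text \<open>A metric on the closed disc is given by its matrix in Cartesian coordinates and is smooth up to the boundary.
  The values of \<open>g\<close> outside the closed disc play no role.\<close>

definition riemannian_metric :: "(real^2 \<Rightarrow> real^2^2) \<Rightarrow> bool" where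
  "riemannian_metric g \<longleftrightarrow>
     (\<forall>i j k. Ck_on k closed_disc (\<lambda>x. g x $ i $ j)) \<and>
     (\<forall>x\<in>closed_disc. transpose (g x) = g x \<and> (\<forall>v. v \<noteq> 0 \<longrightarrow> v \<bullet> (g x *v v) > 0))"

definition S1_invariant_metric :: "(real^2 \<Rightarrow> real^2^2) \<Rightarrow> bool" where
  "S1_invariant_metric g \<longleftrightarrow>
     (\<forall>A :: real^2^2. rotation_matrix A \<longrightarrow>
        (\<forall>x\<in>closed_disc. transpose A ** g (A *v x) ** A = g x))"

definition total_area :: "(real^2 \<Rightarrow> real^2^2) \<Rightarrow> real" where
  "total_area g = integral disc (\<lambda>x. sqrt (det (g x)))"

text \<open>\<open>christoffel g k i j\<close> is \<open>\<Gamma>\<^sup>k\<^sub>i\<^sub>j\<close>, and \<open>riemann g l i j k\<close> is the \<open>l\<close>-th component of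
  \<open>R(\<partial>\<^sub>i,\<partial>\<^sub>j)\<partial>\<^sub>k\<close>, where \<open>R(X,Y) = \<nabla>\<^sub>X\<nabla>\<^sub>Y - \<nabla>\<^sub>Y\<nabla>\<^sub>X - \<nabla>\<^bsub>[X,Y]\<^esub>\<close>. With this sign the round sphere
  has positive curvature.\<close>

definition christoffel :: "(real^2 \<Rightarrow> real^2^2) \<Rightarrow> 2 \<Rightarrow> 2 \<Rightarrow> 2 \<Rightarrow> real^2 \<Rightarrow> real" where
  "christoffel g k i j x =
     (\<Sum>l\<in>UNIV. matrix_inv (g x) $ k $ l *
        (pderiv_within closed_disc i (\<lambda>y. g y $ j $ l) x +
         pderiv_within closed_disc j (\<lambda>y. g y $ i $ l) x -
         pderiv_within closed_disc l (\<lambda>y. g y $ i $ j) x)) / 2"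

definition riemann :: "(real^2 \<Rightarrow> real^2^2) \<Rightarrow> 2 \<Rightarrow> 2 \<Rightarrow> 2 \<Rightarrow> 2 \<Rightarrow> real^2 \<Rightarrow> real" where
  "riemann g l i j k x =
     pderiv_within closed_disc i (christoffel g l j k) x -
     pderiv_within closed_disc j (christoffel g l i k) x +
     (\<Sum>p\<in>UNIV. christoffel g l i p x * christoffel g p j k x -
                christoffel g l j p x * christoffel g p i k x)"

definition gauss_curvature :: "(real^2 \<Rightarrow> real^2^2) \<Rightarrow> real^2 \<Rightarrow> real" where
  "gauss_curvature g x = (\<Sum>l\<in>UNIV. riemann g l 1 2 2 x * g x $ l $ 1) / det (g x)"

definition laplace_beltrami :: "(real^2 \<Rightarrow> real^2^2) \<Rightarrow> (real^2 \<Rightarrow> real) \<Rightarrow> real^2 \<Rightarrow> real" where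
  "laplace_beltrami g u x =
     (\<Sum>i\<in>UNIV. pderiv_within disc i
        (\<lambda>y. sqrt (det (g y)) *
             (\<Sum>j\<in>UNIV. matrix_inv (g y) $ i $ j * pderiv_within disc j u y)) x) / sqrt (det (g x))"

text \<open>On the boundary circle the Euclidean outer normal at \<open>x\<close> is \<open>x\<close>, so the conormal direction is
  \<open>g\<inverse> x\<close>.\<close>

definition conormal_derivative :: "(real^2 \<Rightarrow> real^2^2) \<Rightarrow> (real^2 \<Rightarrow> real) \<Rightarrow> real^2 \<Rightarrow> real" where
  "conormal_derivative g u x =
     (\<Sum>i\<in>UNIV. (matrix_inv (g x) *v x) $ i * pderiv_within closed_disc i u x)"

datatype boundary_condition = Dirichlet | Neumann

fun satisfies_bc :: "boundary_condition \<Rightarrow> (real^2 \<Rightarrow> real^2^2) \<Rightarrow> (real^2 \<Rightarrow> real) \<Rightarrow> bool" where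
  "satisfies_bc Dirichlet g u \<longleftrightarrow>
     Ck_on 0 closed_disc u \<and> (\<forall>x\<in>boundary_circle. u x = 0)"
| "satisfies_bc Neumann g u \<longleftrightarrow>
     Ck_on 1 closed_disc u \<and> (\<forall>x\<in>boundary_circle. conormal_derivative g u x = 0)"

text \<open>Functions on the closed disc are represented by their extension by zero, so that two elements
  of an eigenspace are equal iff they agree on the closed disc.\<close>

definition eigenspace ::
    "boundary_condition \<Rightarrow> (real^2 \<Rightarrow> real^2^2) \<Rightarrow> real \<Rightarrow> (real^2 \<Rightarrow> real) set" where
  "eigenspace bc g \<gamma> =
     {u. (\<forall>x. x \<notin> closed_disc \<longrightarrow> u x = 0) \<and> Ck_on 2 disc u \<and>
         (\<forall>x\<in>disc. laplace_beltrami g u x + \<gamma> * u x = 0) \<and> satisfies_bc bc g u}"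

definition eigenfunction ::
    "boundary_condition \<Rightarrow> (real^2 \<Rightarrow> real^2^2) \<Rightarrow> real \<Rightarrow> (real^2 \<Rightarrow> real) \<Rightarrow> bool" where
  "eigenfunction bc g \<gamma> u \<longleftrightarrow> u \<in> eigenspace bc g \<gamma> \<and> u \<noteq> (\<lambda>x. 0)"

definition eigenvalue :: "boundary_condition \<Rightarrow> (real^2 \<Rightarrow> real^2^2) \<Rightarrow> real \<Rightarrow> bool" where
  "eigenvalue bc g \<gamma> \<longleftrightarrow> (\<exists>u. eigenfunction bc g \<gamma> u)"

interpretation real_fun: vector_space "\<lambda>(c::real) (f :: real^2 \<Rightarrow> real) x. c * f x"
  by unfold_locales (auto simp: fun_eq_iff algebra_simps)

definition finite_multiplicity :: "boundary_condition \<Rightarrow> (real^2 \<Rightarrow> real^2^2) \<Rightarrow> real \<Rightarrow> bool" where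
  "finite_multiplicity bc g \<gamma> \<longleftrightarrow> (\<exists>B. finite B \<and> eigenspace bc g \<gamma> \<subseteq> real_fun.span B)"

definition multiplicity :: "boundary_condition \<Rightarrow> (real^2 \<Rightarrow> real^2^2) \<Rightarrow> real \<Rightarrow> nat" where
  "multiplicity bc g \<gamma> = real_fun.dim (eigenspace bc g \<gamma>)"

definition simple_eigenvalue :: "boundary_condition \<Rightarrow> (real^2 \<Rightarrow> real^2^2) \<Rightarrow> real \<Rightarrow> bool" where
  "simple_eigenvalue bc g \<gamma> \<longleftrightarrow> multiplicity bc g \<gamma> = 1"

text \<open>\<open>\<gamma>\<close> is the \<open>j\<close>-th eigenvalue (\<open>j \<ge> 1\<close>) in increasing order, counted with multiplicity: fewer
  than \<open>j\<close> eigenvalues are \<open>< \<gamma>\<close> and at least \<open>j\<close> are \<open>\<le> \<gamma>\<close>. The finiteness conditions are needed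
  because \<open>sum\<close> and \<open>dim\<close> return \<open>0\<close> on infinite sets and infinite-dimensional spaces.\<close>

definition nth_eigenvalue ::
    "boundary_condition \<Rightarrow> (real^2 \<Rightarrow> real^2^2) \<Rightarrow> nat \<Rightarrow> real \<Rightarrow> bool" where
  "nth_eigenvalue bc g j \<gamma> \<longleftrightarrow>
     eigenvalue bc g \<gamma> \<and>
     finite {\<mu>. eigenvalue bc g \<mu> \<and> \<mu> \<le> \<gamma>} \<and>
     (\<forall>\<mu>\<le>\<gamma>. finite_multiplicity bc g \<mu>) \<and>
     (\<Sum>\<mu> | eigenvalue bc g \<mu> \<and> \<mu> < \<gamma>. multiplicity bc g \<mu>) < j \<and>
     j \<le> (\<Sum>\<mu> | eigenvalue bc g \<mu> \<and> \<mu> \<le> \<gamma>. multiplicity bc g \<mu>)"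

definition nodal_set :: "(real^2 \<Rightarrow> real) \<Rightarrow> (real^2) set" where
  "nodal_set u = closure {x \<in> disc. u x = 0}"

definition nodal_lines :: "(real^2 \<Rightarrow> real) \<Rightarrow> (real^2) set set" where
  "nodal_lines u = components (nodal_set u)"

definition nodal_domains :: "(real^2 \<Rightarrow> real) \<Rightarrow> (real^2) set set" where
  "nodal_domains u = components (disc - nodal_set u)"

definition is_circle :: "(real^2) set \<Rightarrow> bool" where
  "is_circle C \<longleftrightarrow> (\<exists>c r. r > 0 \<and> C = sphere c r)"

end

theory Submission
  imports Defs
begin

text \<open>
  In the coordinates \<open>t = |x|\<^sup>2 / 2\<close> and \<open>\<theta>\<close>, a metric \<open>dt\<^sup>2 / p + p d\<theta>\<^sup>2\<close> has area element \<open>dt d\<theta>\<close>,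
  curvature \<open>- p'' / 2\<close> and Laplacian \<open>(p u\<^sub>t)\<^sub>t + u\<^sub>\<theta>\<^sub>\<theta> / p\<close>. With \<open>s = |x|\<^sup>2\<close> and
  \<open>p = s / (1 + n s) < 1 / n\<close> the disc becomes a thin cigar when \<open>n\<close> is large: by an energy estimate
  for the difference of \<open>u\<close> and a rotation of \<open>u\<close>, which vanishes somewhere on every circle,
  all eigenfunctions with eigenvalue below \<open>n / (16 \<pi>\<^sup>2)\<close> are radial. The radial eigenvalue
  equation with \<open>\<gamma> = 4 \<nu>\<^sup>2 / n\<close> reads \<open>y'' + \<nu>\<^sup>2 (1 + 1 / (n s)) y = 0\<close>, \<open>y 0 = 0\<close>, \<open>u = y' (|x|\<^sup>2)\<close>.
  Its Pruefer angle \<open>\<phi>\<close> increases in \<open>s\<close> and in \<open>\<nu>\<close> and satisfies \<open>\<phi>(1) \<ge> \<nu>\<close>; the Dirichlet and Neumann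
  conditions say \<open>\<phi>(1) \<in> \<pi> / 2 + \<pi> \<nat>\<close> and \<open>\<phi>(1) \<in> \<pi> \<nat>\<close>, and the zeros of \<open>u\<close> are the radii with
  \<open>\<phi> \<in> \<pi> / 2 + \<pi> \<nat>\<close>. So the first \<open>K\<close> radial eigenvalues are at most \<open>4 (K \<pi>)\<^sup>2 / n\<close>, and
  \<open>n = 16 \<pi>\<^sup>2 K\<close> puts them below the threshold.
\<close>

section \<open>Derivatives within the disc\<close>

text \<open>The required nodal pattern is that of radial functions, so the task is to lift all
  angular variation above the first radial eigenvalues. In the equation the second angular
  derivative carries the factor \<open>1 / p\<close>, and \<open>1 / p > n\<close>. The function
  \<open>p = s / (1 + n s)\<close> is concave, which gives positive curvature, and saturates at
  \<open>1 / n\<close>, which makes the circles short; the area coordinate \<open>t\<close> gives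
  total area \<pi> for every \<open>n\<close> without any normalisation. Increasing \<open>n\<close>
  raises the angular threshold and lowers the bound on the radial eigenvalues, so the two
  requirements do not compete.

  The difference of \<open>u\<close> and its rotation replaces a Fourier expansion in the angle: it
  solves the same equation, it vanishes for all rotations exactly when \<open>u\<close> is radial,
  and its zero on every circle yields a crude Poincare inequality, from which the constant
  \<open>16 \<pi>\<^sup>2\<close> comes. A Dirichlet eigenfunction is only known to be continuous up
  to the boundary. The energies are therefore integrals over single circles, followed in
  \<open>r\<close>, and no Green formula on the whole disc is used.\<close>

lemma has_derivative_unique_within_convex:
  fixes f :: "'a::euclidean_space \<Rightarrow> 'b::real_normed_vector"
  assumes S: "convex S" "interior S \<noteq> {}" "x \<in> S"
    and d: "(f has_derivative f1) (at x within S)" "(f has_derivative f2) (at x within S)"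
  shows "f1 = f2"
proof
  fix v
  define L where "L = (\<lambda>h. f1 h - f2 h)"
  have dL: "((\<lambda>_. 0) has_derivative L) (at x within S)"
    using has_derivative_diff[OF d] by (simp add: L_def)
  have linL: "bounded_linear L" using dL has_derivative_bounded_linear by blast
  \<comment> \<open>Restriction to the segment from \<open>x\<close> to \<open>y\<close> gives a
    function of one variable, whose derivative at an endpoint of \<open>{0..1}\<close> is unique. So
    the two candidates agree in every direction from \<open>x\<close> into \<open>S\<close>.\<close>
  have zero: "L (y - x) = 0" if y: "y \<in> S" for y
  proof -
    have img: "(\<lambda>t. x + t *\<^sub>R (y - x)) ` {0..1} \<subseteq> S"
    proof
      fix z assume "z \<in> (\<lambda>t. x + t *\<^sub>R (y - x)) ` {0..1}"
      then obtain t where t: "t \<in> {0..1}" "z = x + t *\<^sub>R (y - x)" by auto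
      have "z = (1 - t) *\<^sub>R x + t *\<^sub>R y" using t by (simp add: algebra_simps)
      then show "z \<in> S" using S t y by (auto simp: convex_alt)
    qed
    have c: "((\<lambda>t. x + t *\<^sub>R (y - x)) has_derivative (\<lambda>t. t *\<^sub>R (y - x))) (at 0 within {0..1})"
      by (auto intro!: derivative_eq_intros)
    have "((\<lambda>_. 0) has_derivative L)
        (at (x + 0 *\<^sub>R (y - x)) within (\<lambda>t. x + t *\<^sub>R (y - x)) ` {0..1})"
      using has_derivative_subset[OF dL img] by simp
    from has_derivative_in_compose[OF c this]
    have "((\<lambda>t. 0::'b) has_derivative (\<lambda>t. L (t *\<^sub>R (y - x)))) (at 0 within {0..1::real})"
      by simp
    then have v1: "((\<lambda>t. 0::'b) has_vector_derivative L (y - x)) (at 0 within {0..1::real})"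
      unfolding has_vector_derivative_def using linL
      by (simp add: linear_simps(5))
    have v2: "((\<lambda>t. 0::'b) has_vector_derivative 0) (at 0 within {0..1::real})"
      by simp
    have "at (0::real) within {0..1} \<noteq> bot"
      by (simp add: trivial_limit_within islimpt_Icc)
    from vector_derivative_unique_within[OF this v1 v2] show ?thesis .
  qed
  obtain z e where e: "e > 0" "cball z e \<subseteq> S"
    using S(2) by (metis equals0I mem_interior_cball)
  show "f1 v = f2 v"
  proof (cases "v = 0")
    case True then show ?thesis
      using d has_derivative_bounded_linear linear_simps(3) by metis
  next
    case False
    \<comment> \<open>Since \<open>S\<close> contains a ball around \<open>z\<close>, every vector
      is a multiple of a difference of two directions from \<open>x\<close> into
      \<open>S\<close>.\<close>
    define w where "w = z + (e / norm v) *\<^sub>R v"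
    have "w \<in> S" "z \<in> S" using e False by (auto simp: w_def dist_norm subset_iff)
    then have "L (w - x) - L (z - x) = 0" using zero by simp
    moreover have "L (w - x) - L (z - x) = L ((e / norm v) *\<^sub>R v)"
      using linL by (simp add: w_def linear_simps(2)[OF linL, symmetric])
    moreover have "L ((e / norm v) *\<^sub>R v) = (e / norm v) *\<^sub>R L v"
      using linL by (simp add: linear_simps(5))
    ultimately have "L v = 0" using e False by auto
    then show ?thesis by (simp add: L_def)
  qed
qed

text \<open>\<open>frechet_derivative\<close> is a choice operator. On sets of this kind there is
  only one candidate, at boundary points too, so explicit derivatives can be substituted for
  \<open>pderiv_within\<close>.\<close>

definition fat :: "(real^2) set \<Rightarrow> bool" where
  "fat S \<longleftrightarrow> convex S \<and> interior S \<noteq> {}"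

lemma fat_disc [simp]: "fat disc" and fat_closed_disc [simp]: "fat closed_disc"
  by (auto simp: fat_def)

lemma pderiv_within_eq:
  assumes "fat S" "x \<in> S" "(f has_derivative f') (at x within S)"
  shows "pderiv_within S i f x = f' (axis i 1)"
proof -
  have "f differentiable (at x within S)" using assms(3) by (auto simp: differentiable_def)
  then have "(f has_derivative frechet_derivative f (at x within S)) (at x within S)"
    by (simp add: frechet_derivative_works)
  with has_derivative_unique_within_convex[OF _ _ assms(2) this assms(3)] assms(1) show ?thesis
    by (simp add: pderiv_within_def fat_def)
qed

lemma has_derivative_cong_on:
  assumes "x \<in> S" "\<And>y. y \<in> S \<Longrightarrow> f y = g y"
  shows "(f has_derivative f') (at x within S) \<longleftrightarrow> (g has_derivative f') (at x within S)"
  using assms by (metis has_derivative_transform)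

lemma pderiv_within_cong:
  assumes "x \<in> S" "\<And>y. y \<in> S \<Longrightarrow> f y = g y"
  shows "pderiv_within S i f x = pderiv_within S i g x"
  unfolding pderiv_within_def frechet_derivative_def
  using has_derivative_cong_on[OF assms] by simp

lemma Ck_on_cong:
  assumes "\<And>y. y \<in> S \<Longrightarrow> f y = g y"
  shows "Ck_on k S f \<longleftrightarrow> Ck_on k S g"
  using assms
proof (induction k arbitrary: f g)
  case 0
  then show ?case using continuous_on_cong by (metis Ck_on.simps(1))
next
  case (Suc k)
  have "f differentiable_on S \<longleftrightarrow> g differentiable_on S"
    unfolding differentiable_on_def differentiable_def
    using has_derivative_cong_on[of _ S f g] Suc.prems by blast
  moreover have "Ck_on k S (pderiv_within S i f) \<longleftrightarrow> Ck_on k S (pderiv_within S i g)" for i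
    by (rule Suc.IH) (use Suc.prems pderiv_within_cong in blast)
  ultimately show ?case by simp
qed

text \<open>Membership in this class, which is closed under partial derivatives when \<open>\<Psi>\<close> is closed under
  derivatives on \<open>[0,\<infinity>)\<close>, gives \<open>C\<^sup>k\<close> for all \<open>k\<close> at once.\<close>

inductive_set radalg :: "(real \<Rightarrow> real) set \<Rightarrow> (real^2 \<Rightarrow> real) set" for \<Psi> where
  const: "(\<lambda>_. c) \<in> radalg \<Psi>"
| coord: "(\<lambda>x. x $ i) \<in> radalg \<Psi>"
| plus: "f \<in> radalg \<Psi> \<Longrightarrow> g \<in> radalg \<Psi> \<Longrightarrow> (\<lambda>x. f x + g x) \<in> radalg \<Psi>"
| times: "f \<in> radalg \<Psi> \<Longrightarrow> g \<in> radalg \<Psi> \<Longrightarrow> (\<lambda>x. f x * g x) \<in> radalg \<Psi>"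
| rad: "\<psi> \<in> \<Psi> \<Longrightarrow> (\<lambda>x. \<psi> (x \<bullet> x)) \<in> radalg \<Psi>"

text \<open>The arguments that matter are the values of \<open>x \<bullet> x\<close>, hence
  \<open>s \<ge> 0\<close>; the inverse powers used for the metric are singular at a negative
  argument. At \<open>s = 0\<close> the derivative is still two-sided, so the chain rule applies at
  the origin.\<close>

definition deriv_closed :: "(real \<Rightarrow> real) set \<Rightarrow> bool" where
  "deriv_closed \<Psi> \<longleftrightarrow> (\<forall>\<psi>\<in>\<Psi>. \<exists>\<psi>'\<in>\<Psi>. \<forall>s\<ge>0. (\<psi> has_real_derivative \<psi>' s) (at s))"

lemma radial_has_derivative:
  fixes x :: "real^2"
  assumes "(\<psi> has_real_derivative \<psi>' (x \<bullet> x)) (at (x \<bullet> x))"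
  shows "((\<lambda>x. \<psi> (x \<bullet> x)) has_derivative (\<lambda>h. \<psi>' (x \<bullet> x) * (2 * (x \<bullet> h)))) (at x within S)"
proof -
  have *: "((\<lambda>x::real^2. x \<bullet> x) has_derivative (\<lambda>h. 2 * (x \<bullet> h))) (at x within S)"
    by (auto intro!: derivative_eq_intros simp: inner_commute)
  show ?thesis
    using has_derivative_compose[OF * assms[unfolded has_field_derivative_def]] by simp
qed

lemma coord_has_derivative:
  fixes x :: "real^2"
  shows "((\<lambda>x. x $ i) has_derivative (\<lambda>h. h $ i)) (at x within S)"
  by (simp add: bounded_linear_imp_has_derivative bounded_linear_vec_nth)

lemma radalg_deriv:
  assumes "deriv_closed \<Psi>" "f \<in> radalg \<Psi>"
  shows "\<exists>f'. (\<forall>x. (f has_derivative f' x) (at x)) \<and> (\<forall>i. (\<lambda>x. f' x (axis i 1)) \<in> radalg \<Psi>)"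
  using assms(2)
proof induction
  case (const c)
  show ?case by (rule exI[of _ "\<lambda>x h. 0"]) (auto intro: radalg.const)
next
  case (coord i)
  have "(\<lambda>x::real^2. axis j (1::real) $ i) \<in> radalg \<Psi>" for j by (rule radalg.const)
  then show ?case by (intro exI[of _ "\<lambda>x h. h $ i"]) (auto intro: coord_has_derivative)
next
  case (plus f g)
  then obtain f' g' where
    "\<forall>x. (f has_derivative f' x) (at x)" "\<forall>i. (\<lambda>x. f' x (axis i 1)) \<in> radalg \<Psi>"
    "\<forall>x. (g has_derivative g' x) (at x)" "\<forall>i. (\<lambda>x. g' x (axis i 1)) \<in> radalg \<Psi>" by blast
  then show ?case
    by (intro exI[of _ "\<lambda>x h. f' x h + g' x h"]) (auto intro: has_derivative_add radalg.plus)
next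
  case (times f g)
  then obtain f' g' where fg:
    "\<forall>x. (f has_derivative f' x) (at x)" "\<forall>i. (\<lambda>x. f' x (axis i 1)) \<in> radalg \<Psi>"
    "\<forall>x. (g has_derivative g' x) (at x)" "\<forall>i. (\<lambda>x. g' x (axis i 1)) \<in> radalg \<Psi>" by blast
  show ?case
    by (rule exI[of _ "\<lambda>x h. f x * g' x h + f' x h * g x"])
      (use fg times in \<open>auto intro!: has_derivative_mult radalg.plus radalg.times\<close>)
next
  case (rad \<psi>)
  then obtain \<psi>' where p: "\<psi>' \<in> \<Psi>" "\<forall>s\<ge>0. (\<psi> has_real_derivative \<psi>' s) (at s)"
    using assms(1) by (auto simp: deriv_closed_def)
  have "(\<lambda>x. \<psi>' (x \<bullet> x) * (2 * (x \<bullet> axis i 1))) \<in> radalg \<Psi>" for i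
    by (auto simp: inner_axis intro!: radalg.times radalg.rad radalg.const radalg.coord p)
  moreover have "((\<lambda>x. \<psi> (x \<bullet> x)) has_derivative (\<lambda>h. \<psi>' (x \<bullet> x) * (2 * (x \<bullet> h)))) (at x)" for x :: "real^2"
    by (rule radial_has_derivative[where \<psi> = \<psi> and \<psi>' = \<psi>']) (use p in simp)
  ultimately show ?case
    by (intro exI[of _ "\<lambda>x h. \<psi>' (x \<bullet> x) * (2 * (x \<bullet> h))"]) blast
qed

lemma radalg_Ck:
  assumes "deriv_closed \<Psi>" "fat S" "f \<in> radalg \<Psi>"
  shows "Ck_on k S f"
  using assms(3)
proof (induction k arbitrary: f)
  case 0
  then obtain f' where "\<forall>x. (f has_derivative f' x) (at x)"
    using radalg_deriv[OF assms(1)] by blast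
  then show ?case
    by (auto intro!: continuous_at_imp_continuous_on has_derivative_continuous)
next
  case (Suc k)
  then obtain f' where f': "\<forall>x. (f has_derivative f' x) (at x)" "\<forall>i. (\<lambda>x. f' x (axis i 1)) \<in> radalg \<Psi>"
    using radalg_deriv[OF assms(1)] by blast
  have w: "(f has_derivative f' x) (at x within S)" for x
    using f'(1) has_derivative_at_withinI by blast
  have "Ck_on k S (pderiv_within S i f)" for i
    using Ck_on_cong[of S "pderiv_within S i f" "\<lambda>x. f' x (axis i 1)" k] pderiv_within_eq[OF assms(2) _ w]
      Suc.IH[of "\<lambda>x. f' x (axis i 1)"] f'(2) by blast
  moreover have "f differentiable_on S"
    using w by (auto simp: differentiable_on_def differentiable_def)
  ultimately show ?case by simp
qed

section \<open>The cigar metric\<close>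

text \<open>With \<open>b = 1 / (1 + n * (x \<bullet> x))\<close> the matrix has eigenvalue
  \<open>1 / b\<close> along \<open>x\<close> and \<open>b\<close> orthogonally to \<open>x\<close>.
  A scalar matrix plus a multiple of the products \<open>x $ i * x $ j\<close> stays smooth at the
  origin, where polar coordinates degenerate.\<close>

definition cigar :: "real \<Rightarrow> real^2 \<Rightarrow> real^2^2" where
  "cigar n x = (\<chi> i j. (if i = j then 1 / (1 + n * (x \<bullet> x)) else 0)
     + (n + n / (1 + n * (x \<bullet> x))) * (x $ i * x $ j))"

definition cigar_inv :: "real \<Rightarrow> real^2 \<Rightarrow> real^2^2" where
  "cigar_inv n x = (\<chi> i j. (if i = j then 1 + n * (x \<bullet> x) else 0)
     - (n + n / (1 + n * (x \<bullet> x))) * (x $ i * x $ j))"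

lemma inner_2: "(x::real^2) \<bullet> y = x $ 1 * y $ 1 + x $ 2 * y $ 2"
  by (simp add: inner_vec_def sum_2)

lemma one_plus_pos: "n \<ge> 0 \<Longrightarrow> 1 + n * (x \<bullet> x) > 0" for x :: "real^2"
  by (meson add_pos_nonneg inner_ge_zero mult_nonneg_nonneg zero_less_one)

text \<open>This is \<open>b * (1 + n * (x \<bullet> x)) = 1\<close> in expanded form. Once every
  denominator is expressed through \<open>b\<close>, the tensor identities become polynomial
  identities modulo this single relation, which \<open>algebra\<close> can prove.\<close>

lemma radial_inverse:
  fixes x :: "real^2"
  assumes "n \<ge> 0"
  obtains b where "b > 0" "b = 1 / (1 + n * (x \<bullet> x))"
    "b + b * n * (x $ 1)\<^sup>2 + b * n * (x $ 2)\<^sup>2 = 1"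
proof
  let ?A = "1 + n * (x \<bullet> x)"
  have "?A > 0" by (rule one_plus_pos[OF assms])
  then show "1 / ?A > 0" "1 / ?A = 1 / ?A" by auto
  have "b + b * n * (x $ 1)\<^sup>2 + b * n * (x $ 2)\<^sup>2 = b * ?A" for b
    by (simp add: inner_2 algebra_simps power2_eq_square)
  from this[of "1 / ?A"] show "1 / ?A + 1 / ?A * n * (x $ 1)\<^sup>2 + 1 / ?A * n * (x $ 2)\<^sup>2 = 1"
    using \<open>?A > 0\<close> by simp
qed

lemma cigar_cigar_inv:
  assumes "n \<ge> 0"
  shows "cigar n x ** cigar_inv n x = mat 1" "cigar_inv n x ** cigar n x = mat 1" "det (cigar n x) = 1"
proof -
  obtain b where b: "b > 0" "b = 1 / (1 + n * (x \<bullet> x))"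
    "b + b * n * (x $ 1)\<^sup>2 + b * n * (x $ 2)\<^sup>2 = 1"
    by (rule radial_inverse[OF assms])
  have a: "n / (1 + n * (x \<bullet> x)) = n * b" using b by simp
  have s: "x \<bullet> x = (x $ 1)\<^sup>2 + (x $ 2)\<^sup>2" by (simp add: inner_2 power2_eq_square)
  show "cigar n x ** cigar_inv n x = mat 1"
    unfolding vec_eq_iff forall_2 matrix_matrix_mult_def cigar_def cigar_inv_def mat_def
    apply (simp add: sum_2 a flip: b(2))
    apply (simp add: s)
    using b(3) by (intro conjI; algebra)
  show "cigar_inv n x ** cigar n x = mat 1"
    unfolding vec_eq_iff forall_2 matrix_matrix_mult_def cigar_def cigar_inv_def mat_def
    apply (simp add: sum_2 a flip: b(2))
    apply (simp add: s)
    using b(3) by (intro conjI; algebra)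
  show "det (cigar n x) = 1"
    unfolding det_2 cigar_def
    apply (simp add: a flip: b(2))
    using b(3) by algebra
qed

lemma matrix_inv_cigar: "n \<ge> 0 \<Longrightarrow> matrix_inv (cigar n x) = cigar_inv n x"
  unfolding matrix_inv_def
  by (rule some_equality) (use cigar_cigar_inv in \<open>auto simp: \<close>, metis cigar_cigar_inv(1) matrix_mul_assoc matrix_mul_lid matrix_mul_rid)

lemma total_area_cigar:
  assumes "n \<ge> 0"
  shows "total_area (cigar n) = pi"
proof -
  have "total_area (cigar n) = integral disc (\<lambda>x. 1)"
    using assms by (simp add: total_area_def cigar_cigar_inv)
  also have "\<dots> = measure lebesgue disc"
    by (rule lmeasure_integral[symmetric]) simp
  also have "\<dots> = measure lborel disc" by (rule measure_completion) simp
  also have "\<dots> = pi" by (simp add: content_ball unit_ball_vol_2)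
  finally show ?thesis .
qed

definition inv_powers :: "real \<Rightarrow> (real \<Rightarrow> real) set" where
  "inv_powers n = {\<lambda>s. c * inverse (1 + n * s) ^ k | c k. True}"

lemma deriv_closed_inv_powers:
  assumes "n \<ge> 0"
  shows "deriv_closed (inv_powers n)"
  unfolding deriv_closed_def
proof
  fix \<psi> assume "\<psi> \<in> inv_powers n"
  then obtain c k where \<psi>: "\<psi> = (\<lambda>s. c * inverse (1 + n * s) ^ k)" by (auto simp: inv_powers_def)
  have "(\<psi> has_real_derivative (- c * real k * n) * inverse (1 + n * s) ^ (k + 1)) (at s)" if "s \<ge> 0" for s
  proof -
    have "1 + n * s > 0" using assms that by (simp add: add_pos_nonneg)
    then have "((\<lambda>s. inverse (1 + n * s)) has_real_derivative
        - (inverse (1 + n * s) * n * inverse (1 + n * s))) (at s)"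
      by (auto intro!: derivative_eq_intros)
    from DERIV_cmult[OF DERIV_power[OF this, of k], of c] show ?thesis
      unfolding \<psi> by (cases k) (simp_all add: algebra_simps)
  qed
  moreover have "(\<lambda>s. (- c * real k * n) * inverse (1 + n * s) ^ (k + 1)) \<in> inv_powers n"
    unfolding inv_powers_def by blast
  ultimately show "\<exists>\<psi>'\<in>inv_powers n. \<forall>s\<ge>0. (\<psi> has_real_derivative \<psi>' s) (at s)"
    by (intro bexI[of _ "\<lambda>s. (- c * real k * n) * inverse (1 + n * s) ^ (k + 1)"] allI impI)
qed

lemma cigar_radalg: "(\<lambda>x. cigar n x $ i $ j) \<in> radalg (inv_powers n)"
proof -
  have r: "(\<lambda>x. c / (1 + n * (x \<bullet> x))) \<in> radalg (inv_powers n)" for c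
  proof -
    have "(\<lambda>s. c * inverse (1 + n * s) ^ 1) \<in> inv_powers n" unfolding inv_powers_def by blast
    from radalg.rad[OF this] show ?thesis by (simp add: divide_inverse)
  qed
  have "(\<lambda>x. (if i = j then 1 else 0) * (1 / (1 + n * (x \<bullet> x)))
      + (n + n / (1 + n * (x \<bullet> x))) * (x $ i * x $ j)) \<in> radalg (inv_powers n)"
    by (intro radalg.plus radalg.times radalg.const radalg.coord r)
  moreover have "(\<lambda>x. cigar n x $ i $ j) = (\<lambda>x. (if i = j then 1 else 0) * (1 / (1 + n * (x \<bullet> x)))
      + (n + n / (1 + n * (x \<bullet> x))) * (x $ i * x $ j))"
    by (auto simp: cigar_def fun_eq_iff)
  ultimately show ?thesis by simp
qed

lemma cigar_mult: "cigar n x *v v = (1 / (1 + n * (x \<bullet> x))) *\<^sub>R v + ((n + n / (1 + n * (x \<bullet> x))) * (x \<bullet> v)) *\<^sub>R x"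
  by (simp add: vec_eq_iff forall_2 matrix_vector_mult_def cigar_def sum_2 inner_2 algebra_simps add_divide_distrib)

lemma riemannian_metric_cigar:
  assumes "n \<ge> 0"
  shows "riemannian_metric (cigar n)"
  unfolding riemannian_metric_def
proof (intro conjI allI ballI impI)
  show "Ck_on k closed_disc (\<lambda>x. cigar n x $ i $ j)" for i j k
    by (rule radalg_Ck[OF deriv_closed_inv_powers[OF assms] _ cigar_radalg]) simp
  show "transpose (cigar n x) = cigar n x" for x
    by (auto simp: cigar_def transpose_def vec_eq_iff mult.commute)
  fix x v :: "real^2" assume "v \<noteq> 0"
  have p: "1 + n * (x \<bullet> x) > 0" by (rule one_plus_pos[OF assms])
  have "v \<bullet> (cigar n x *v v) = (1 / (1 + n * (x \<bullet> x))) * (v \<bullet> v)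
      + (n + n / (1 + n * (x \<bullet> x))) * (x \<bullet> v)\<^sup>2"
    by (simp add: cigar_mult inner_add_right power2_eq_square inner_commute)
  moreover have "(1 / (1 + n * (x \<bullet> x))) * (v \<bullet> v) > 0"
    using p \<open>v \<noteq> 0\<close> by simp
  moreover have "(n + n / (1 + n * (x \<bullet> x))) * (x \<bullet> v)\<^sup>2 \<ge> 0"
    using p assms by simp
  ultimately show "v \<bullet> (cigar n x *v v) > 0" by linarith
qed

text \<open>By \<open>cigar_mult\<close> the matrix acts through inner products with
  \<open>x\<close> and the vectors \<open>v\<close> and \<open>x\<close> only, and an orthogonal
  matrix respects all of these.\<close>

lemma S1_invariant_metric_cigar: "S1_invariant_metric (cigar n)"
  unfolding S1_invariant_metric_def
proof (intro allI impI ballI)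
  fix A :: "real^2^2" and x :: "real^2"
  assume "rotation_matrix A"
  then have o: "transpose A ** A = mat 1"
    by (auto simp: rotation_matrix_def orthogonal_matrix_def)
  have ip: "(A *v x) \<bullet> (A *v y) = x \<bullet> y" for x y
  proof -
    have "(A *v x) \<bullet> (A *v y) = (transpose A *v (A *v x)) \<bullet> y"
      by (simp only: transpose_matrix_vector dot_lmul_matrix)
    then show ?thesis by (simp add: matrix_vector_mul_assoc o)
  qed
  have "(transpose A ** cigar n (A *v x) ** A) *v v = cigar n x *v v" for v
  proof -
    have "(transpose A ** cigar n (A *v x) ** A) *v v = transpose A *v (cigar n (A *v x) *v (A *v v))"
      by (simp only: matrix_vector_mul_assoc matrix_mul_assoc)
    also have "\<dots> = (1 / (1 + n * (x \<bullet> x))) *\<^sub>R (transpose A *v (A *v v))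
        + ((n + n / (1 + n * (x \<bullet> x))) * (x \<bullet> v)) *\<^sub>R (transpose A *v (A *v x))"
      by (simp add: cigar_mult ip matrix_vector_right_distrib matrix_vector_mult_scaleR)
    also have "\<dots> = cigar n x *v v"
      by (simp add: matrix_vector_mul_assoc o cigar_mult)
    finally show ?thesis .
  qed
  then show "transpose A ** cigar n (A *v x) ** A = cigar n x"
    by (simp add: matrix_eq)
qed

section \<open>Christoffel symbols and Gauss curvature of the cigar metric\<close>

definition dcigar :: "real \<Rightarrow> 2 \<Rightarrow> 2 \<Rightarrow> real^2 \<Rightarrow> real^2 \<Rightarrow> real" where
  "dcigar n i j x h = (let b = 1 / (1 + n * (x \<bullet> x)) in
     (if i = j then - n * b\<^sup>2 * (2 * (x \<bullet> h)) else 0)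
     - n\<^sup>2 * b\<^sup>2 * (2 * (x \<bullet> h)) * (x $ i * x $ j) + (n + n * b) * (h $ i * x $ j + x $ i * h $ j))"

lemma inv_has_derivative:
  fixes x :: "real^2"
  assumes "n \<ge> 0"
  shows "((\<lambda>x. 1 / (1 + n * (x \<bullet> x))) has_derivative
    (\<lambda>h. - n * (1 / (1 + n * (x \<bullet> x)))\<^sup>2 * (2 * (x \<bullet> h)))) (at x within S)"
proof (rule radial_has_derivative[where \<psi>' = "\<lambda>s. - n * (1 / (1 + n * s))\<^sup>2"])
  have "1 + n * (x \<bullet> x) > 0" by (rule one_plus_pos[OF assms])
  then show "((\<lambda>s. 1 / (1 + n * s)) has_real_derivative - n * (1 / (1 + n * (x \<bullet> x)))\<^sup>2) (at (x \<bullet> x))"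
    by (auto intro!: derivative_eq_intros simp: power2_eq_square)
qed

lemma cigar_has_derivative:
  assumes "n \<ge> 0"
  shows "((\<lambda>x. cigar n x $ i $ j) has_derivative dcigar n i j x) (at x within S)"
proof -
  have eq: "(\<lambda>x. cigar n x $ i $ j) = (\<lambda>x. (if i = j then 1 else 0) * (1 / (1 + n * (x \<bullet> x)))
      + (n + n * (1 / (1 + n * (x \<bullet> x)))) * (x $ i * x $ j))"
    by (auto simp: cigar_def fun_eq_iff)
  show ?thesis unfolding eq
    by (rule derivative_eq_intros inv_has_derivative[OF assms] coord_has_derivative refl)+
      (auto simp: dcigar_def Let_def fun_eq_iff algebra_simps power2_eq_square)
qed

text \<open>A closed form of the Christoffel symbols, polynomial in \<open>b\<close> and the
  coordinates: the factor \<open>1 + n * (x \<bullet> x)\<close> of the inverse matrix has cancelled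
  against \<open>b\<close>. In this form they can be differentiated once more.\<close>

definition gamma_sym :: "real \<Rightarrow> 2 \<Rightarrow> 2 \<Rightarrow> 2 \<Rightarrow> real^2 \<Rightarrow> real" where
  "gamma_sym n k i j x = (let b = 1 / (1 + n * (x \<bullet> x)) in
     - n * b * ((if j = k then x $ i else 0) + (if i = k then x $ j else 0))
     + n * (b + b\<^sup>2 + b ^ 3) * (if i = j then x $ k else 0)
     + n\<^sup>2 * (2 * b\<^sup>2 + b ^ 3) * (x $ i * x $ j * x $ k))"

lemma christoffel_cigar:
  assumes n: "n \<ge> 0" and x: "x \<in> closed_disc"
  shows "christoffel (cigar n) k i j x = gamma_sym n k i j x"
proof -
  obtain b where b: "b > 0" "b = 1 / (1 + n * (x \<bullet> x))"
    "b + b * n * (x $ 1)\<^sup>2 + b * n * (x $ 2)\<^sup>2 = 1"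
    by (rule radial_inverse[OF n])
  have a: "n / (1 + n * (x \<bullet> x)) = n * b" using b by simp
  have s: "x \<bullet> x = (x $ 1)\<^sup>2 + (x $ 2)\<^sup>2" by (simp add: inner_2 power2_eq_square)
  have pd: "pderiv_within closed_disc i (\<lambda>y. cigar n y $ j $ l) x = dcigar n j l x (axis i 1)" for i j l
    by (rule pderiv_within_eq[OF _ x cigar_has_derivative[OF n]]) simp
  have ax: "x \<bullet> axis i 1 = x $ i" for i by (simp add: inner_axis)
  have "\<forall>k i j. christoffel (cigar n) k i j x = gamma_sym n k i j x"
    unfolding forall_2 christoffel_def pd matrix_inv_cigar[OF n] cigar_inv_def dcigar_def gamma_sym_def Let_def ax
    apply (simp add: sum_2 a axis_def flip: b(2))
    apply (simp add: s)
    using b(3) by (intro conjI; algebra)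
  then show ?thesis by blast
qed

definition dgamma :: "real \<Rightarrow> 2 \<Rightarrow> 2 \<Rightarrow> 2 \<Rightarrow> real^2 \<Rightarrow> real^2 \<Rightarrow> real" where
  "dgamma n k i j x h = (let b = 1 / (1 + n * (x \<bullet> x)); b' = - n * b\<^sup>2 * (2 * (x \<bullet> h)) in
     - n * b' * ((if j = k then x $ i else 0) + (if i = k then x $ j else 0))
     - n * b * ((if j = k then h $ i else 0) + (if i = k then h $ j else 0))
     + n * (b' + 2 * b * b' + 3 * b\<^sup>2 * b') * (if i = j then x $ k else 0)
     + n * (b + b\<^sup>2 + b ^ 3) * (if i = j then h $ k else 0)
     + n\<^sup>2 * (4 * b * b' + 3 * b\<^sup>2 * b') * (x $ i * x $ j * x $ k)
     + n\<^sup>2 * (2 * b\<^sup>2 + b ^ 3) * (h $ i * x $ j * x $ k + x $ i * h $ j * x $ k + x $ i * x $ j * h $ k))"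

lemma gamma_sym_has_derivative:
  assumes "n \<ge> 0"
  shows "(gamma_sym n k i j has_derivative dgamma n k i j x) (at x within S)"
proof -
  define b :: "real^2 \<Rightarrow> real" where "b = (\<lambda>x. 1 / (1 + n * (x \<bullet> x)))"
  define b' where "b' = (\<lambda>h. - n * (b x)\<^sup>2 * (2 * (x \<bullet> h)))"
  have db: "(b has_derivative b') (at x within S)"
    using inv_has_derivative[OF assms] by (simp add: b_def b'_def)
  have eq: "gamma_sym n k i j = (\<lambda>x. - n * b x * ((if j = k then 1 else 0) * x $ i + (if i = k then 1 else 0) * x $ j)
     + n * (b x + b x * b x + b x * b x * b x) * ((if i = j then 1 else 0) * x $ k)
     + n\<^sup>2 * (2 * (b x * b x) + b x * b x * b x) * (x $ i * x $ j * x $ k))"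
    by (auto simp: gamma_sym_def Let_def b_def fun_eq_iff power2_eq_square power3_eq_cube)
  have eq2: "dgamma n k i j x = (\<lambda>h. - n * b' h * ((if j = k then x $ i else 0) + (if i = k then x $ j else 0))
     - n * b x * ((if j = k then h $ i else 0) + (if i = k then h $ j else 0))
     + n * (b' h + 2 * b x * b' h + 3 * (b x)\<^sup>2 * b' h) * (if i = j then x $ k else 0)
     + n * (b x + (b x)\<^sup>2 + b x ^ 3) * (if i = j then h $ k else 0)
     + n\<^sup>2 * (4 * b x * b' h + 3 * (b x)\<^sup>2 * b' h) * (x $ i * x $ j * x $ k)
     + n\<^sup>2 * (2 * (b x)\<^sup>2 + b x ^ 3) * (h $ i * x $ j * x $ k + x $ i * h $ j * x $ k + x $ i * x $ j * h $ k))"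
    by (simp add: dgamma_def Let_def b_def b'_def fun_eq_iff)
  show ?thesis unfolding eq eq2
    by (rule derivative_eq_intros db coord_has_derivative refl)+
      (simp add: fun_eq_iff algebra_simps power2_eq_square power3_eq_cube)
qed

text \<open>In dimension two, \<open>R(X,Y)Z = \<kappa> (g(Y,Z) X - g(X,Z) Y)\<close> with \<kappa>
  the Gauss curvature. The two components needed have this shape with
  \<open>\<kappa> = 4 n b ^ 3\<close>, and contraction with the metric leaves \<kappa> times the
  determinant.\<close>

lemma gauss_curvature_cigar:
  assumes n: "n \<ge> 0" and x: "x \<in> closed_disc"
  shows "gauss_curvature (cigar n) x = 4 * n / (1 + n * (x \<bullet> x)) ^ 3"
proof -
  obtain b where b: "b > 0" "b = 1 / (1 + n * (x \<bullet> x))"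
    "b + b * n * (x $ 1)\<^sup>2 + b * n * (x $ 2)\<^sup>2 = 1"
    by (rule radial_inverse[OF n])
  have a: "n / (1 + n * (x \<bullet> x)) = n * b" using b by simp
  have pd: "pderiv_within closed_disc i (christoffel (cigar n) k p q) x = dgamma n k p q x (axis i 1)" for i k p q
  proof -
    have "pderiv_within closed_disc i (christoffel (cigar n) k p q) x
        = pderiv_within closed_disc i (gamma_sym n k p q) x"
      by (rule pderiv_within_cong[OF x]) (rule christoffel_cigar[OF n])
    then show ?thesis
      using pderiv_within_eq[OF _ x gamma_sym_has_derivative[OF n]] by simp
  qed
  have ax: "x \<bullet> axis i 1 = x $ i" for i by (simp add: inner_axis)
  have R1: "riemann (cigar n) 1 1 2 2 x = 4 * n * b ^ 3 * cigar n x $ 2 $ 2"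
    unfolding riemann_def pd christoffel_cigar[OF n x] cigar_def dgamma_def gamma_sym_def Let_def ax
    apply (simp add: sum_2 a axis_def flip: b(2))
    using b(3) apply algebra
    done
  have R2: "riemann (cigar n) 2 1 2 2 x = - 4 * n * b ^ 3 * cigar n x $ 1 $ 2"
    unfolding riemann_def pd christoffel_cigar[OF n x] cigar_def dgamma_def gamma_sym_def Let_def ax
    apply (simp add: sum_2 a axis_def flip: b(2))
    using b(3) apply algebra
    done
  have "(\<Sum>l\<in>UNIV. riemann (cigar n) l 1 2 2 x * cigar n x $ l $ 1) = 4 * n * b ^ 3 * det (cigar n x)"
    by (simp add: sum_2 R1 R2 det_2 algebra_simps)
  then have "gauss_curvature (cigar n) x = 4 * n * b ^ 3"
    by (simp add: gauss_curvature_def cigar_cigar_inv(3)[OF n])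
  then show ?thesis using b by (simp add: power_inverse divide_inverse)
qed

section \<open>The radial equation and its Pruefer angle\<close>

text \<open>The Frobenius coefficients of the solution of \<open>s y'' = - \<nu>\<^sup>2 (s + 1 / n) y\<close>; below, \<open>vsol\<close> is
  \<open>y'\<close> and \<open>Ysol\<close> is \<open>y / s\<close>.\<close>

fun sol_coeff :: "real \<Rightarrow> real \<Rightarrow> nat \<Rightarrow> real" where
  "sol_coeff n \<nu> 0 = 0"
| "sol_coeff n \<nu> (Suc 0) = 1"
| "sol_coeff n \<nu> (Suc (Suc k)) = - \<nu>\<^sup>2 * (sol_coeff n \<nu> (Suc k) / n + sol_coeff n \<nu> k) / (real (k + 1) * real (k + 2))"

definition ysol :: "real \<Rightarrow> real \<Rightarrow> real \<Rightarrow> real" where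
  "ysol n \<nu> s = (\<Sum>k. sol_coeff n \<nu> k * s ^ k)"
definition Ysol :: "real \<Rightarrow> real \<Rightarrow> real \<Rightarrow> real" where
  "Ysol n \<nu> s = (\<Sum>k. sol_coeff n \<nu> (Suc k) * s ^ k)"
definition vsol :: "real \<Rightarrow> real \<Rightarrow> real \<Rightarrow> real" where
  "vsol n \<nu> s = (\<Sum>k. diffs (sol_coeff n \<nu>) k * s ^ k)"

text \<open>The base of the power depends on \<nu> only through its bound \<open>N\<close>. The
  factorial decay thus gives convergence for every \<open>s\<close>, and majorants that are uniform
  in \<nu>.\<close>

lemma sol_coeff_bound:
  assumes n: "n > 0" and N: "\<bar>\<nu>\<bar> \<le> N"
  shows "\<bar>sol_coeff n \<nu> k\<bar> \<le> (1 + N\<^sup>2 * (1 + 1 / n)) ^ k / fact k"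
proof -
  define K where "K = 1 + N\<^sup>2 * (1 + 1 / n)"
  have K1: "K \<ge> 1" using n by (simp add: K_def)
  \<comment> \<open>The base \<open>K\<close> is chosen to satisfy this inequality: in the recursion
    two terms, of sizes \<open>K ^ Suc k\<close> and \<open>K ^ k\<close>, have to fit under
    \<open>K ^ Suc (Suc k)\<close>.\<close>
  have KK: "N\<^sup>2 * (K / n + 1) \<le> K\<^sup>2"
  proof -
    have "K / n + 1 \<le> K * (1 + 1 / n)" using K1 by (simp add: algebra_simps)
    then have "N\<^sup>2 * (K / n + 1) \<le> N\<^sup>2 * (K * (1 + 1 / n))" by (simp add: mult_left_mono)
    also have "\<dots> = K * (N\<^sup>2 * (1 + 1 / n))" by simp
    also have "\<dots> = K * (K - 1)" by (simp add: K_def)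
    also have "\<dots> \<le> K\<^sup>2" using K1 by (simp add: power2_eq_square algebra_simps)
    finally show ?thesis .
  qed
  have nN: "\<nu>\<^sup>2 \<le> N\<^sup>2" using N by (metis abs_ge_zero power2_abs power_mono)
  have "\<bar>sol_coeff n \<nu> k\<bar> \<le> K ^ k / fact k"
  proof (induction k rule: induct_nat_012)
    case 0 show ?case by simp
  next
    case 1 show ?case using K1 by simp
  next
    case (ge2 k)
    have "\<bar>sol_coeff n \<nu> (Suc (Suc k))\<bar> = \<nu>\<^sup>2 * \<bar>sol_coeff n \<nu> (Suc k) / n + sol_coeff n \<nu> k\<bar> / (real (k + 1) * real (k + 2))"
      by (simp add: abs_mult)
    also have "\<dots> \<le> N\<^sup>2 * (K ^ Suc k / fact (Suc k) / n + K ^ k / fact k) / (real (k + 1) * real (k + 2))"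
    proof (intro divide_right_mono mult_mono nN)
      have "\<bar>sol_coeff n \<nu> (Suc k) / n + sol_coeff n \<nu> k\<bar> \<le> \<bar>sol_coeff n \<nu> (Suc k)\<bar> / n + \<bar>sol_coeff n \<nu> k\<bar>"
        using n by (metis abs_divide abs_of_pos abs_triangle_ineq)
      also have "\<dots> \<le> K ^ Suc k / fact (Suc k) / n + K ^ k / fact k"
        using ge2 n by (intro add_mono divide_right_mono) auto
      finally show "\<bar>sol_coeff n \<nu> (Suc k) / n + sol_coeff n \<nu> k\<bar> \<le> K ^ Suc k / fact (Suc k) / n + K ^ k / fact k" .
    qed auto
    also have "\<dots> = K ^ k * (N\<^sup>2 * (K / n / real (k + 1) + 1)) / (fact k * (real (k + 1) * real (k + 2)))"
      using n by (simp add: divide_simps) (simp add: algebra_simps)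
    also have "\<dots> \<le> K ^ k * K\<^sup>2 / (fact k * (real (k + 1) * real (k + 2)))"
    proof (intro divide_right_mono mult_left_mono)
      have "K / n / real (k + 1) \<le> K / n"
        using K1 n by (simp add: divide_le_eq) 
      then have "N\<^sup>2 * (K / n / real (k + 1) + 1) \<le> N\<^sup>2 * (K / n + 1)"
        by (intro mult_left_mono) auto
      with KK show "N\<^sup>2 * (K / n / real (k + 1) + 1) \<le> K\<^sup>2" by linarith
    qed (use K1 in auto)
    also have "\<dots> = K ^ Suc (Suc k) / fact (Suc (Suc k))"
      by (simp add: power2_eq_square algebra_simps)
    finally show ?case .
  qed
  then show ?thesis by (simp add: K_def)
qed

lemma sol_coeff_summable:
  assumes "n > 0"
  shows "summable (\<lambda>k. sol_coeff n \<nu> k * s ^ k)"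
proof (rule summable_comparison_test)
  let ?K = "1 + \<bar>\<nu>\<bar>\<^sup>2 * (1 + 1 / n)"
  have K: "?K \<ge> 0" using assms by simp
  have "norm (sol_coeff n \<nu> k * s ^ k) \<le> (?K * \<bar>s\<bar>) ^ k / fact k" for k
  proof -
    have "\<bar>sol_coeff n \<nu> k\<bar> * \<bar>s ^ k\<bar> \<le> ?K ^ k / fact k * \<bar>s ^ k\<bar>"
      by (intro mult_right_mono sol_coeff_bound[OF assms]) auto
    then show ?thesis by (simp add: abs_mult power_mult_distrib power_abs)
  qed
  then show "\<exists>N. \<forall>k\<ge>N. norm (sol_coeff n \<nu> k * s ^ k) \<le> (?K * \<bar>s\<bar>) ^ k / fact k" by blast
  show "summable (\<lambda>k. (?K * \<bar>s\<bar>) ^ k / fact k)"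
    using summable_exp_generic[of "?K * \<bar>s\<bar>"] by (simp add: divide_inverse mult.commute)
qed

lemma sol_coeff_Suc_summable:
  assumes "n > 0"
  shows "summable (\<lambda>k. sol_coeff n \<nu> (Suc k) * s ^ k)"
  using powser_split_head(3)[OF sol_coeff_summable[OF assms]] by blast

lemma diffs_summable:
  assumes "n > 0"
  shows "summable (\<lambda>k. (diffs ^^ m) (sol_coeff n \<nu>) k * s ^ k)"
proof (induction m arbitrary: s)
  case 0 then show ?case using sol_coeff_summable[OF assms] by simp
next
  case (Suc m) 
  show ?case using termdiff_converges_all[OF Suc.IH] by simp
qed

text \<open>The iterated derivatives of \<open>ysol\<close>, with \<open>vsol\<close> at index 1.
  Closure under differentiation gives smoothness of the radial eigenfunctions through
  \<open>radalg_Ck\<close>.\<close>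

definition sol_family :: "real \<Rightarrow> real \<Rightarrow> (real \<Rightarrow> real) set" where
  "sol_family n \<nu> = {\<lambda>s. \<Sum>k. (diffs ^^ m) (sol_coeff n \<nu>) k * s ^ k | m. True}"

lemma vsol_in_family: "vsol n \<nu> \<in> sol_family n \<nu>"
proof -
  have "vsol n \<nu> = (\<lambda>s. \<Sum>k. (diffs ^^ 1) (sol_coeff n \<nu>) k * s ^ k)"
    by (auto simp: vsol_def)
  then show ?thesis unfolding sol_family_def by blast
qed

lemma sol_family_deriv:
  assumes "n > 0"
  shows "((\<lambda>s. \<Sum>k. (diffs ^^ m) (sol_coeff n \<nu>) k * s ^ k) has_real_derivative
    (\<Sum>k. (diffs ^^ Suc m) (sol_coeff n \<nu>) k * s ^ k)) (at s)"
  using termdiffs_strong_converges_everywhere[OF diffs_summable[OF assms]] by simp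

lemma deriv_closed_sol_family:
  assumes "n > 0"
  shows "deriv_closed (sol_family n \<nu>)"
  unfolding deriv_closed_def
proof
  fix \<psi> assume "\<psi> \<in> sol_family n \<nu>"
  then obtain m where m: "\<psi> = (\<lambda>s. \<Sum>k. (diffs ^^ m) (sol_coeff n \<nu>) k * s ^ k)"
    by (auto simp: sol_family_def)
  have "(\<lambda>s. \<Sum>k. (diffs ^^ Suc m) (sol_coeff n \<nu>) k * s ^ k) \<in> sol_family n \<nu>"
    unfolding sol_family_def by blast
  then show "\<exists>\<psi>'\<in>sol_family n \<nu>. \<forall>s\<ge>0. (\<psi> has_real_derivative \<psi>' s) (at s)"
    unfolding m using sol_family_deriv[OF assms]
    by (intro bexI[of _ "\<lambda>s. \<Sum>k. (diffs ^^ Suc m) (sol_coeff n \<nu>) k * s ^ k"] allI impI)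
qed

lemma ysol_deriv:
  assumes "n > 0"
  shows "(ysol n \<nu> has_real_derivative vsol n \<nu> s) (at s)"
  using sol_family_deriv[OF assms, of 0 \<nu> s] by (simp add: ysol_def[abs_def] vsol_def)

lemma ysol_Ysol: "n > 0 \<Longrightarrow> ysol n \<nu> s = s * Ysol n \<nu> s"
  unfolding ysol_def Ysol_def
  using powser_split_head(1)[OF sol_coeff_summable] by simp

text \<open>The recursion of the coefficients is this equation read term by term. With
  \<open>Ysol\<close> in place of \<open>ysol\<close> divided by \<open>s\<close>, it also holds at
  the singular point \<open>s = 0\<close>.\<close>

lemma vsol_deriv:
  assumes "n > 0"
  shows "(vsol n \<nu> has_real_derivative - \<nu>\<^sup>2 * (ysol n \<nu> s + Ysol n \<nu> s / n)) (at s)"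
proof -
  have "(\<Sum>k. (diffs ^^ Suc 1) (sol_coeff n \<nu>) k * s ^ k)
      = (\<Sum>k. - \<nu>\<^sup>2 * (sol_coeff n \<nu> k * s ^ k + (sol_coeff n \<nu> (Suc k) * s ^ k) / n))"
  proof (rule suminf_cong)
    fix k
    have "(diffs ^^ Suc 1) (sol_coeff n \<nu>) k = - \<nu>\<^sup>2 * (sol_coeff n \<nu> (Suc k) / n + sol_coeff n \<nu> k)"
    proof -
      have "(diffs ^^ Suc 1) (sol_coeff n \<nu>) k = real (k + 1) * (real (k + 2) * sol_coeff n \<nu> (Suc (Suc k)))"
        by (simp add: diffs_def del: sol_coeff.simps)
      then show ?thesis by simp
    qed
    then show "(diffs ^^ Suc 1) (sol_coeff n \<nu>) k * s ^ k
        = - \<nu>\<^sup>2 * (sol_coeff n \<nu> k * s ^ k + (sol_coeff n \<nu> (Suc k) * s ^ k) / n)"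
      by (simp only:) (simp add: algebra_simps)
  qed
  also have "\<dots> = - \<nu>\<^sup>2 * (ysol n \<nu> s + Ysol n \<nu> s / n)"
    unfolding ysol_def Ysol_def
    by (intro sums_unique[symmetric] sums_mult sums_add sums_divide summable_sums
        sol_coeff_summable[OF assms] sol_coeff_Suc_summable[OF assms])
  finally show ?thesis
    using sol_family_deriv[OF assms, of 1 \<nu> s] by (simp add: vsol_def[abs_def])
qed

lemma sol_at_0 [simp]: "ysol n \<nu> 0 = 0" "Ysol n \<nu> 0 = 1" "vsol n \<nu> 0 = 1"
  by (simp_all add: ysol_def Ysol_def vsol_def powser_zero diffs_def)

lemma vsol_deriv_pos:
  assumes "n > 0" "s > 0"
  shows "(vsol n \<nu> has_real_derivative - \<nu>\<^sup>2 * (1 + 1 / (n * s)) * ysol n \<nu> s) (at s)"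
  using vsol_deriv[OF assms(1), of \<nu> s] assms(2) by (simp add: ysol_Ysol[OF assms(1)] field_simps)

text \<open>Weierstrass test with majorants independent of both variables. Joint continuity is what
  later makes an integral over \<open>s\<close> continuous in the parameter.\<close>

lemma powser_joint_continuous:
  fixes a :: "nat \<Rightarrow> real \<Rightarrow> real"
  assumes c: "\<And>k. continuous_on T (a k)" and M: "\<And>k t. t \<in> T \<Longrightarrow> \<bar>a k t\<bar> \<le> M k" "summable M"
  shows "continuous_on (T \<times> {0..1}) (\<lambda>(t, s). \<Sum>k. a k t * s ^ k)"
proof -
  have "uniform_limit (T \<times> {0..1}) (\<lambda>m p. \<Sum>k<m. a k (fst p) * snd p ^ k)
      (\<lambda>p. \<Sum>k. a k (fst p) * snd p ^ k) sequentially"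
  proof (rule Weierstrass_m_test[OF _ M(2)])
    fix k and p :: "real \<times> real" assume p: "p \<in> T \<times> {0..1}"
    have "\<bar>a k (fst p)\<bar> * \<bar>snd p ^ k\<bar> \<le> M k * 1"
      using p M(1)[of "fst p" k] by (intro mult_mono) (auto simp: power_le_one)
    then show "norm (a k (fst p) * snd p ^ k) \<le> M k" by (simp add: abs_mult)
  qed
  then have "continuous_on (T \<times> {0..1}) (\<lambda>p. \<Sum>k. a k (fst p) * snd p ^ k)"
  proof (rule uniform_limit_theorem[rotated])
    show "\<forall>\<^sub>F m in sequentially. continuous_on (T \<times> {0..1}) (\<lambda>p. \<Sum>k<m. a k (fst p) * snd p ^ k)"
      by (intro always_eventually allI continuous_intros continuous_on_compose2[OF c]) auto
  qed simp
  then show ?thesis by (simp add: case_prod_unfold)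
qed

lemma sol_coeff_continuous: "continuous_on T (\<lambda>\<nu>. sol_coeff n \<nu> k)"
proof (induction k rule: induct_nat_012)
  case (ge2 k)
  then show ?case unfolding sol_coeff.simps divide_inverse by (intro continuous_intros)
qed auto

lemma sol_joint_continuous:
  assumes "n > 0"
  shows "continuous_on ({0..B} \<times> {0..1}) (\<lambda>(\<nu>, s). Ysol n \<nu> s)"
    "continuous_on ({0..B} \<times> {0..1}) (\<lambda>(\<nu>, s). vsol n \<nu> s)"
proof -
  define K where "K = 1 + B\<^sup>2 * (1 + 1 / n)"
  have K1: "K \<ge> 1" using assms by (simp add: K_def)
  have bd: "\<bar>real (Suc k) * sol_coeff n \<nu> (Suc k)\<bar> \<le> K * (K ^ k / fact k)" if "\<nu> \<in> {0..B}" for k \<nu>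
  proof -
    have "\<bar>sol_coeff n \<nu> (Suc k)\<bar> \<le> K ^ Suc k / fact (Suc k)"
      using sol_coeff_bound[OF assms, of \<nu> B "Suc k"] that by (simp add: K_def)
    then have "real (Suc k) * \<bar>sol_coeff n \<nu> (Suc k)\<bar> \<le> real (Suc k) * (K ^ Suc k / fact (Suc k))"
      by (intro mult_left_mono) auto
    also have "\<dots> = K * (K ^ k / fact k)" by simp
    finally show ?thesis by (simp add: abs_mult)
  qed
  have bd2: "\<bar>sol_coeff n \<nu> (Suc k)\<bar> \<le> K * (K ^ k / fact k)" if "\<nu> \<in> {0..B}" for k \<nu>
  proof -
    have "\<bar>sol_coeff n \<nu> (Suc k)\<bar> \<le> real (Suc k) * \<bar>sol_coeff n \<nu> (Suc k)\<bar>"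
      by (simp add: mult_le_cancel_right1)
    then show ?thesis using bd[OF that, of k] by (simp add: abs_mult)
  qed
  have sm: "summable (\<lambda>k. K * (K ^ k / fact k))"
    using summable_exp_generic[of K] by (intro summable_mult) (simp add: divide_inverse mult.commute)
  show "continuous_on ({0..B} \<times> {0..1}) (\<lambda>(\<nu>, s). Ysol n \<nu> s)"
    unfolding Ysol_def by (rule powser_joint_continuous[OF sol_coeff_continuous bd2 sm])
  show "continuous_on ({0..B} \<times> {0..1}) (\<lambda>(\<nu>, s). vsol n \<nu> s)"
    unfolding vsol_def diffs_def of_nat_id
    by (rule powser_joint_continuous[OF _ _ sm])
      (use bd in \<open>auto intro!: continuous_intros sol_coeff_continuous simp: \<close>)
qed

section \<open>Pruefer radius and angle of the radial solution\<close>

definition R2 :: "real \<Rightarrow> real \<Rightarrow> real \<Rightarrow> real" where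
  "R2 n \<nu> s = (vsol n \<nu> s)\<^sup>2 + \<nu>\<^sup>2 * (ysol n \<nu> s)\<^sup>2"

lemma R2_deriv:
  assumes "n > 0"
  shows "(R2 n \<nu> has_real_derivative - 2 * \<nu>\<^sup>2 * vsol n \<nu> s * Ysol n \<nu> s / n) (at s)"
  unfolding R2_def[abs_def] 
  by (rule derivative_eq_intros vsol_deriv[OF assms] ysol_deriv[OF assms] refl)+
    (simp add: algebra_simps power2_eq_square)

text \<open>The equation is singular at 0, so there the positivity comes from
  \<open>R2 n \<nu> 0 = 1\<close> and continuity. Away from 0 the derivative of \<open>R2\<close> is
  at least \<open>- C\<close> times \<open>R2\<close>, so \<open>exp (C * t) * R2 n \<nu> t\<close>
  cannot decrease.\<close>

lemma R2_pos:
  assumes n: "n > 0" and s: "s \<ge> 0"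
  shows "R2 n \<nu> s > 0"
proof -
  have nn: "R2 n \<nu> t \<ge> 0" for t by (simp add: R2_def)
  have R0: "R2 n \<nu> 0 = 1" by (simp add: R2_def)
  have cont: "continuous_on A (R2 n \<nu>)" for A
    using DERIV_continuous[OF R2_deriv[OF n]] continuous_at_imp_continuous_on by blast
  then have "isCont (R2 n \<nu>) 0" using continuous_on_eq_continuous_at open_UNIV by blast
  then have "\<forall>\<^sub>F t in at 0. R2 n \<nu> t > 0"
    using R0 order_tendstoD(1)[of "R2 n \<nu>" 1 "at 0" 0] by (simp add: isCont_def)
  then obtain d where d: "d > 0" "\<And>t. t \<noteq> 0 \<Longrightarrow> \<bar>t\<bar> < d \<Longrightarrow> R2 n \<nu> t > 0"
    by (auto simp: eventually_at dist_real_def)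
  show ?thesis
  proof (cases "s < d")
    case True then show ?thesis using d s R0 by (cases "s = 0") auto
  next
    case False
    define a where "a = d / 2"
    have a: "a > 0" "a \<le> s" "R2 n \<nu> a > 0" using d False by (auto simp: a_def)
    \<comment> \<open>For \<open>t \<ge> a\<close> the quotient \<open>Ysol\<close> is
      \<open>ysol\<close> divided by \<open>t\<close>, and twice the absolute value of
      \<open>\<nu> * vsol * ysol\<close> is at most \<open>R2\<close>; this is the resulting
      bound.\<close>
    define C where "C = \<bar>\<nu>\<bar> / (n * a)"
    have "exp (C * a) * R2 n \<nu> a \<le> exp (C * s) * R2 n \<nu> s"
    proof (rule DERIV_nonneg_imp_nondecreasing[OF a(2)])
      fix t assume t: "a \<le> t" "t \<le> s"
      have "((\<lambda>t. exp (C * t) * R2 n \<nu> t) has_real_derivative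
        exp (C * t) * (C * R2 n \<nu> t - 2 * \<nu>\<^sup>2 * vsol n \<nu> t * Ysol n \<nu> t / n)) (at t)"
        by (rule derivative_eq_intros R2_deriv[OF n] refl)+ (simp add: algebra_simps)
      moreover have "2 * \<nu>\<^sup>2 * vsol n \<nu> t * Ysol n \<nu> t / n \<le> C * R2 n \<nu> t"
      proof -
        have Y: "Ysol n \<nu> t = ysol n \<nu> t / t" using a t by (simp add: ysol_Ysol[OF n])
        have "2 * (\<nu> * vsol n \<nu> t * ysol n \<nu> t) \<le> R2 n \<nu> t" "2 * (- \<nu> * vsol n \<nu> t * ysol n \<nu> t) \<le> R2 n \<nu> t"
          using sum_squares_ge_zero[of "vsol n \<nu> t - \<nu> * ysol n \<nu> t" 0]
            sum_squares_ge_zero[of "vsol n \<nu> t + \<nu> * ysol n \<nu> t" 0]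
          by (auto simp: R2_def power2_eq_square algebra_simps)
        then have "2 * \<nu> * vsol n \<nu> t * ysol n \<nu> t * sgn \<nu> \<le> R2 n \<nu> t"
          using nn[of t] by (auto simp: sgn_if algebra_simps)
        then have "\<bar>\<nu>\<bar> / (n * t) * (2 * \<nu> * vsol n \<nu> t * ysol n \<nu> t * sgn \<nu>) \<le> \<bar>\<nu>\<bar> / (n * t) * R2 n \<nu> t"
          using n a t by (intro mult_left_mono) auto
        also have "\<dots> \<le> C * R2 n \<nu> t"
          unfolding C_def using n a t nn by (intro mult_right_mono divide_left_mono) auto
        also have "\<bar>\<nu>\<bar> / (n * t) * (2 * \<nu> * vsol n \<nu> t * ysol n \<nu> t * sgn \<nu>)
            = (\<bar>\<nu>\<bar> * sgn \<nu>) * (2 * \<nu> * vsol n \<nu> t * ysol n \<nu> t) / (n * t)" by simp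
        also have "\<dots> = 2 * \<nu>\<^sup>2 * vsol n \<nu> t * Ysol n \<nu> t / n"
          unfolding Y by (simp add: abs_mult_sgn power2_eq_square ac_simps)
        finally show ?thesis .
      qed
      ultimately show "\<exists>y. ((\<lambda>t. exp (C * t) * R2 n \<nu> t) has_real_derivative y) (at t) \<and> 0 \<le> y"
        by (intro exI conjI) auto
    qed
    moreover have "exp (C * a) * R2 n \<nu> a > 0" using a by simp
    ultimately have "exp (C * s) * R2 n \<nu> s > 0" by linarith
    then show ?thesis by (simp add: zero_less_mult_iff)
  qed
qed

text \<open>The derivative that an angle of the vector \<open>(vsol, \<nu> * ysol)\<close> has to
  have. Written with \<open>Ysol\<close> it is continuous at \<open>s = 0\<close>, and integrating
  it gives the angle without following branches of the arctangent.\<close>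

definition phi_rate :: "real \<Rightarrow> real \<Rightarrow> real \<Rightarrow> real" where
  "phi_rate n \<nu> s = \<nu> + \<nu> ^ 3 * s * (Ysol n \<nu> s)\<^sup>2 / (n * R2 n \<nu> s)"

text \<open>A rescaled Pruefer angle of the solution: the scaling by \<open>\<nu>\<close> makes the rate at least \<open>\<nu>\<close>.\<close>

definition phi :: "real \<Rightarrow> real \<Rightarrow> real \<Rightarrow> real" where
  "phi n \<nu> s = integral {0..s} (phi_rate n \<nu>)"

lemma phi_rate_joint_continuous:
  assumes "n > 0"
  shows "continuous_on ({0..B} \<times> {0..1}) (\<lambda>(\<nu>, s). phi_rate n \<nu> s)"
proof -
  have Y: "continuous_on ({0..B} \<times> {0..1}) (\<lambda>p. Ysol n (fst p) (snd p))"
    and v: "continuous_on ({0..B} \<times> {0..1}) (\<lambda>p. vsol n (fst p) (snd p))"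
    using sol_joint_continuous[OF assms, of B] by (auto simp: case_prod_unfold)
  have R: "continuous_on ({0..B} \<times> {0..1}) (\<lambda>p. R2 n (fst p) (snd p))"
    unfolding R2_def ysol_Ysol[OF assms] by (intro continuous_intros Y v)
  have "R2 n (fst p) (snd p) \<noteq> 0" if "p \<in> {0..B} \<times> {0..1}" for p
    using R2_pos[OF assms, of "snd p" "fst p"] that by auto
  then show ?thesis
    unfolding phi_rate_def case_prod_unfold
    by (intro continuous_intros Y R) (use assms in auto)
qed

lemma phi_rate_continuous:
  assumes "n > 0" "\<nu> \<ge> 0"
  shows "continuous_on {0..1} (phi_rate n \<nu>)"
proof -
  have "continuous_on {0..1} ((\<lambda>(\<nu>, s). phi_rate n \<nu> s) \<circ> (\<lambda>s. (\<nu>, s)))"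
    by (intro continuous_on_compose continuous_intros
        continuous_on_subset[OF phi_rate_joint_continuous[OF assms(1), of \<nu>]]) (use assms in auto)
  then show ?thesis by (simp add: o_def)
qed

lemma phi_deriv:
  assumes "n > 0" "\<nu> \<ge> 0" "s \<in> {0..1}"
  shows "(phi n \<nu> has_real_derivative phi_rate n \<nu> s) (at s within {0..1})"
  unfolding phi_def[abs_def]
  by (rule integral_has_real_derivative[OF phi_rate_continuous[OF assms(1,2)] assms(3)])

lemma phi_0 [simp]: "phi n \<nu> 0 = 0"
  by (simp add: phi_def)

lemma phi_continuous_param:
  assumes "n > 0"
  shows "continuous_on {0..B} (\<lambda>\<nu>. phi n \<nu> 1)"
  using integral_continuous_on_param[of "{0..B}" 0 1 "phi_rate n"] phi_rate_joint_continuous[OF assms, of B]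
  by (simp add: phi_def)

text \<open>The upper bound \<open>K\<close> of the coefficient makes
  \<open>exp (- 2 * K * s) * (f s)\<^sup>2\<close> nonincreasing, and it starts at 0.\<close>

lemma linear_ode_zero:
  fixes f :: "real \<Rightarrow> real"
  assumes "a \<le> b" and d: "\<And>s. s \<in> {a..b} \<Longrightarrow> (f has_real_derivative k s * f s) (at s within {a..b})"
    and K: "\<And>s. s \<in> {a..b} \<Longrightarrow> k s \<le> K" and "f a = 0"
  shows "f b = 0"
proof -
  have cf: "continuous_on {a..b} f"
    using d by (meson DERIV_continuous continuous_on_eq_continuous_within)
  define g where "g = (\<lambda>s. - (exp (- 2 * K * s) * (f s)\<^sup>2))"
  have "g a \<le> g b"
  proof (rule DERIV_nonneg_imp_increasing_open[OF assms(1)])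
    fix s assume s: "a < s" "s < b"
    then have "(f has_real_derivative k s * f s) (at s)"
      using d[of s] at_within_Icc_at[of a s b] by auto
    then have "(g has_real_derivative exp (- 2 * K * s) * (2 * (K - k s) * (f s)\<^sup>2)) (at s)"
      unfolding g_def by (auto intro!: derivative_eq_intros simp: algebra_simps power2_eq_square)
    moreover have "exp (- 2 * K * s) * (2 * (K - k s) * (f s)\<^sup>2) \<ge> 0"
      using K[of s] s by simp
    ultimately show "\<exists>y. (g has_real_derivative y) (at s) \<and> 0 \<le> y" by blast
  next
    show "continuous_on {a..b} g" unfolding g_def by (intro continuous_intros cf)
  qed
  then have "exp (- 2 * K * b) * (f b)\<^sup>2 \<le> 0" using assms(4) by (simp add: g_def)
  then show ?thesis by (simp add: mult_le_0_iff)
qed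

text \<open>\<open>phi\<close> is defined as an integral, so it has to be shown to be an angle. The
  component \<open>S\<close> of \<open>(vsol, \<nu> * ysol)\<close> orthogonal to the direction
  \<open>phi\<close> solves a homogeneous linear equation with \<open>S 0 = 0\<close>. The component
  \<open>C\<close> along that direction then satisfies \<open>C\<^sup>2 = R2\<close>, so it never
  vanishes and keeps the sign of \<open>C 0 = 1\<close>.\<close>

lemma sol_polar:
  assumes n: "n > 0" and \<nu>: "\<nu> \<ge> 0" and s: "s \<in> {0..1}"
  obtains C where "C > 0" "vsol n \<nu> s = C * cos (phi n \<nu> s)" "\<nu> * ysol n \<nu> s = C * sin (phi n \<nu> s)"
    "R2 n \<nu> s = C\<^sup>2"
proof -
  define S where "S = (\<lambda>s. \<nu> * ysol n \<nu> s * cos (phi n \<nu> s) - vsol n \<nu> s * sin (phi n \<nu> s))"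
  define C where "C = (\<lambda>s. vsol n \<nu> s * cos (phi n \<nu> s) + \<nu> * ysol n \<nu> s * sin (phi n \<nu> s))"
  define D where "D = (\<lambda>s. \<nu>\<^sup>2 * Ysol n \<nu> s / (n * R2 n \<nu> s))"
  have dS: "(S has_real_derivative (- D t * vsol n \<nu> t) * S t) (at t within {0..1})" if t: "t \<in> {0..1}" for t
  proof -
    have R: "R2 n \<nu> t > 0" using R2_pos[OF n] t by simp
    have e1: "phi_rate n \<nu> t = \<nu> + \<nu> * ysol n \<nu> t * D t"
      by (simp add: phi_rate_def D_def ysol_Ysol[OF n] power2_eq_square power3_eq_cube)
    have e2: "- \<nu>\<^sup>2 * (ysol n \<nu> t + Ysol n \<nu> t / n) = - \<nu>\<^sup>2 * ysol n \<nu> t - D t * ((vsol n \<nu> t)\<^sup>2 + \<nu>\<^sup>2 * (ysol n \<nu> t)\<^sup>2)"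
      unfolding R2_def[symmetric] using n R by (simp add: D_def field_simps)
    have dy: "(ysol n \<nu> has_real_derivative vsol n \<nu> t) (at t within {0..1})"
      by (rule has_field_derivative_at_within[OF ysol_deriv[OF n]])
    have dv: "(vsol n \<nu> has_real_derivative - \<nu>\<^sup>2 * ysol n \<nu> t - D t * ((vsol n \<nu> t)\<^sup>2 + \<nu>\<^sup>2 * (ysol n \<nu> t)\<^sup>2)) (at t within {0..1})"
      using has_field_derivative_at_within[OF vsol_deriv[OF n, of \<nu> t], of "{0..1}"] by (simp only: e2)
    have dp: "(phi n \<nu> has_real_derivative \<nu> + \<nu> * ysol n \<nu> t * D t) (at t within {0..1})"
      using phi_deriv[OF n \<nu> t] unfolding e1 .
    show ?thesis unfolding S_def
      by (rule derivative_eq_intros dy dv dp refl)+ (simp add: algebra_simps power2_eq_square)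
  qed
  have cont: "continuous_on {0..1} (vsol n \<nu>)" "continuous_on {0..1} (ysol n \<nu>)" "continuous_on {0..1} (phi n \<nu>)"
    using DERIV_continuous[OF vsol_deriv[OF n, of \<nu>]] DERIV_continuous[OF ysol_deriv[OF n, of \<nu>]]
    by (auto intro!: continuous_at_imp_continuous_on[of _ "vsol n \<nu>"] continuous_at_imp_continuous_on[of _ "ysol n \<nu>"])
      (auto simp: continuous_on_eq_continuous_within intro!: DERIV_continuous[OF phi_deriv[OF n \<nu>]])
  have contY: "continuous_on {0..1} (Ysol n \<nu>)"
  proof -
    have "continuous_on {0..1} ((\<lambda>(\<nu>, s). Ysol n \<nu> s) \<circ> (\<lambda>s. (\<nu>, s)))"
      by (intro continuous_on_compose continuous_intros
          continuous_on_subset[OF sol_joint_continuous(1)[OF n, of \<nu>]]) (use \<nu> in auto)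
    then show ?thesis by (simp add: o_def)
  qed
  have contR: "continuous_on {0..1} (R2 n \<nu>)"
    unfolding R2_def[abs_def] by (intro continuous_intros cont)
  have Rnz: "R2 n \<nu> t \<noteq> 0" if "t \<in> {0..1}" for t using R2_pos[OF n, of t \<nu>] that by simp
  have "continuous_on {0..1} (\<lambda>t. - D t * vsol n \<nu> t)"
    unfolding D_def by (intro continuous_intros cont contR contY) (use n Rnz in auto)
  then have "\<exists>r\<in>{0..1}. \<forall>t\<in>{0..1}. - D t * vsol n \<nu> t \<le> - D r * vsol n \<nu> r"
    by (intro continuous_attains_sup) auto
  then obtain K where K: "\<And>t. t \<in> {0..1} \<Longrightarrow> - D t * vsol n \<nu> t \<le> K" by blast
  have S0: "S t = 0" if t: "t \<in> {0..1}" for t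
  proof (rule linear_ode_zero[of 0 t S "\<lambda>t. - D t * vsol n \<nu> t" K])
    show "(S has_real_derivative - D r * vsol n \<nu> r * S r) (at r within {0..t})" if "r \<in> {0..t}" for r
      by (rule DERIV_subset[OF dS]) (use that t in auto)
    show "S 0 = 0" by (simp add: S_def)
  qed (use t K in auto)
  have CS: "(C t)\<^sup>2 + (S t)\<^sup>2 = R2 n \<nu> t" for t
    unfolding C_def S_def R2_def using sin_cos_squared_add[of "phi n \<nu> t"] by algebra
  have Cnz: "C t \<noteq> 0" if "t \<in> {0..1}" for t
    using CS[of t] S0[OF that] Rnz[OF that] by auto
  have contC: "continuous_on {0..1} C"
    unfolding C_def by (intro continuous_intros cont)
  have "C s > 0"
  proof (rule ccontr)
    assume "\<not> C s > 0"
    moreover have "C 0 = 1" by (simp add: C_def)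
    ultimately obtain t where "0 \<le> t" "t \<le> s" "C t = 0"
      using IVT2'[of C s 0 0] continuous_on_subset[OF contC, of "{0..s}"] s by auto
    then show False using Cnz[of t] s by auto
  qed
  moreover have "vsol n \<nu> s = C s * cos (phi n \<nu> s) - S s * sin (phi n \<nu> s)"
    "\<nu> * ysol n \<nu> s = C s * sin (phi n \<nu> s) + S s * cos (phi n \<nu> s)"
    unfolding C_def S_def using sin_cos_squared_add[of "phi n \<nu> s"] by algebra+
  ultimately show ?thesis
    using that[of "C s"] S0[OF s] CS[of s] by simp
qed

lemma phi_rate_ge: "n > 0 \<Longrightarrow> \<nu> \<ge> 0 \<Longrightarrow> s \<ge> 0 \<Longrightarrow> phi_rate n \<nu> s \<ge> \<nu>"
  using R2_pos[of n s \<nu>] by (simp add: phi_rate_def)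

lemma phi_rate_0: "phi_rate n \<nu> 0 = \<nu>"
  by (simp add: phi_rate_def)

text \<open>This is the Pruefer equation: the rate depends on the solution only through the angle,
  which permits the comparison of two parameters.\<close>

lemma phi_rate_sin:
  assumes n: "n > 0" and \<nu>: "\<nu> \<ge> 0" and s: "0 < s" "s \<le> 1"
  shows "phi_rate n \<nu> s = \<nu> * (1 + (sin (phi n \<nu> s))\<^sup>2 / (n * s))"
proof -
  obtain C where C: "C > 0" "\<nu> * ysol n \<nu> s = C * sin (phi n \<nu> s)" "R2 n \<nu> s = C\<^sup>2"
    using sol_polar[OF n \<nu>, of s] s by auto
  have "phi_rate n \<nu> s = \<nu> + \<nu> * (\<nu> * ysol n \<nu> s)\<^sup>2 / (n * s * R2 n \<nu> s)"
    using s by (simp add: phi_rate_def ysol_Ysol[OF n] power2_eq_square power3_eq_cube)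
  also have "\<dots> = \<nu> * (1 + (sin (phi n \<nu> s))\<^sup>2 / (n * s))"
    using C by (simp add: power_mult_distrib algebra_simps)
  finally show ?thesis .
qed

text \<open>At a first return to zero \<open>d\<close> would arrive from positive values, against a
  positive derivative there. A crossing argument suits the Pruefer equation, whose coefficient
  \<open>1 / (n * s)\<close> is unbounded near the common starting point
  \<open>s = 0\<close>.\<close>

lemma positive_at_zeros:
  fixes d :: "real \<Rightarrow> real"
  assumes der: "\<And>s. s \<in> {0..1} \<Longrightarrow> (d has_real_derivative d' s) (at s within {0..1})"
    and zero: "d 0 = 0" and pos: "\<And>s. s \<in> {0..1} \<Longrightarrow> d s = 0 \<Longrightarrow> d' s > 0"
  shows "d 1 > 0"
proof (rule ccontr)
  assume neg: "\<not> d 1 > 0"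
  have cont: "continuous_on {0..1} d"
    using der by (meson DERIV_continuous continuous_on_eq_continuous_within)
  obtain e where e: "e > 0" "\<And>h. h > 0 \<Longrightarrow> h \<in> {0..1} \<Longrightarrow> h < e \<Longrightarrow> d h > 0"
    using has_real_derivative_pos_inc_right[OF der[of 0] pos[of 0]] zero by auto
  define c where "c = min e 1 / 2"
  have c: "0 < c" "c < 1" "c < e" using e by (auto simp: c_def)
  \<comment> \<open>Starting at \<open>c\<close>, where \<open>d\<close> is already positive, leaves
    out the zero at 0, so the least element of \<open>T\<close> is the first return.\<close>
  define T where "T = {s \<in> {c..1}. d s \<le> 0}"
  have "T = {c..1} \<inter> d -` {..0}" by (auto simp: T_def)
  then have "closed T"
    using continuous_on_closed_vimage[of "{c..1}" d] continuous_on_subset[OF cont, of "{c..1}"] c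
    by (metis atLeastatMost_subset_iff closed_atLeastAtMost closed_atMost less_imp_le order_refl inf_commute)
  moreover have "T \<subseteq> {c..1}" by (auto simp: T_def)
  ultimately have "compact T"
    by (meson bounded_closed_interval bounded_subset compact_eq_bounded_closed)
 moreover have "1 \<in> T" using neg c by (auto simp: T_def)
  ultimately obtain t where t: "t \<in> T" "\<And>s. s \<in> T \<Longrightarrow> t \<le> s"
    using compact_attains_inf[of T] by auto
  have "c \<le> t" "d t \<le> 0" "d c > 0" using t(1) e(2)[of c] c by (auto simp: T_def)
  then have tc: "t > c" by (cases "t = c") auto
  have below: "d s > 0" if "0 < s" "s < t" for s
  proof (cases "s < c")
    case True then show ?thesis using e(2)[of s] that c by auto
  next
    case False
    then have "s \<notin> T" using t(2)[of s] that by auto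
    then show ?thesis using False that t(1) by (auto simp: T_def)
  qed
  have "d t \<ge> 0"
  proof (rule ccontr)
    assume "\<not> d t \<ge> 0"
    moreover have "d c > 0" using e(2)[of c] c by auto
    ultimately obtain s where "c \<le> s" "s \<le> t" "d s = 0"
      using IVT2'[of d t 0 c] tc continuous_on_subset[OF cont, of "{c..t}"] c t(1) by (auto simp: T_def)
    then show False using below[of s] \<open>\<not> d t \<ge> 0\<close> c by (cases "s = t") auto
  qed
  then have dt: "d t = 0" using t(1) by (auto simp: T_def)
  have ti: "t \<in> {0..1}" using t(1) c by (auto simp: T_def)
  obtain r where r: "r > 0" "\<And>h. h > 0 \<Longrightarrow> t - h \<in> {0..1} \<Longrightarrow> h < r \<Longrightarrow> d (t - h) < d t"
    using has_real_derivative_pos_inc_left[OF der[OF ti] pos[OF ti dt]] by auto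
  define h where "h = min r t / 2"
  have "h > 0" "h < r" "h < t" using r tc c by (auto simp: h_def)
  then have "d (t - h) < 0" using r(2)[of h] dt ti by auto
  moreover have "d (t - h) > 0" by (rule below) (use \<open>h > 0\<close> \<open>h < t\<close> in auto)
  ultimately show False by simp
qed

text \<open>Sturm comparison: where the two angles coincide, the rates are \<open>\<nu>1\<close> and
  \<open>\<nu>2\<close> times the same positive factor, and at \<open>s = 0\<close> they are the
  parameters themselves.\<close>

lemma phi_strict_mono_param:
  assumes n: "n > 0" and \<nu>: "0 \<le> \<nu>1" "\<nu>1 < \<nu>2"
  shows "phi n \<nu>1 1 < phi n \<nu>2 1"
proof -
  have \<nu>2: "\<nu>2 \<ge> 0" using \<nu> by simp
  have "(\<lambda>s. phi n \<nu>2 s - phi n \<nu>1 s) 1 > 0"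
  proof (rule positive_at_zeros[where d' = "\<lambda>s. phi_rate n \<nu>2 s - phi_rate n \<nu>1 s"])
    fix s :: real assume s: "s \<in> {0..1}"
    show "((\<lambda>s. phi n \<nu>2 s - phi n \<nu>1 s) has_real_derivative phi_rate n \<nu>2 s - phi_rate n \<nu>1 s) (at s within {0..1})"
      by (intro derivative_intros phi_deriv n \<nu> \<nu>2 s)
    assume "phi n \<nu>2 s - phi n \<nu>1 s = 0"
    then have eq: "phi n \<nu>2 s = phi n \<nu>1 s" by simp
    show "phi_rate n \<nu>2 s - phi_rate n \<nu>1 s > 0"
    proof (cases "s = 0")
      case True then show ?thesis using \<nu> by (simp add: phi_rate_0)
    next
      case False
      then have s': "0 < s" "s \<le> 1" using s by auto
      have "\<nu>1 * (1 + (sin (phi n \<nu>1 s))\<^sup>2 / (n * s)) < \<nu>2 * (1 + (sin (phi n \<nu>1 s))\<^sup>2 / (n * s))"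
        using n s' \<nu> by (intro mult_strict_right_mono) (auto intro: add_pos_nonneg)
      then show ?thesis
        by (simp add: phi_rate_sin[OF n \<nu>(1) s'] phi_rate_sin[OF n \<nu>2 s'] eq)
    qed
  qed simp
  then show ?thesis by simp
qed

text \<open>Two uses: from 0 to 1 it shows that the final angle is at least \<nu>, so that any
  prescribed angle is eventually reached; for \<open>\<nu> > 0\<close> it makes the angle strictly
  increasing in \<open>s\<close>.\<close>

lemma phi_increment:
  assumes n: "n > 0" and \<nu>: "\<nu> \<ge> 0" and s: "0 \<le> s" "s \<le> t" "t \<le> 1"
  shows "phi n \<nu> t - phi n \<nu> s \<ge> \<nu> * (t - s)"
proof -
  have "phi n \<nu> s - \<nu> * s \<le> phi n \<nu> t - \<nu> * t"
  proof (rule DERIV_nonneg_imp_increasing_open[OF s(2)])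
    fix r assume r: "s < r" "r < t"
    have "(phi n \<nu> has_real_derivative phi_rate n \<nu> r) (at r)"
      using phi_deriv[OF n \<nu>, of r] at_within_Icc_at[of 0 r 1] r s by auto
    then have "((\<lambda>s. phi n \<nu> s - \<nu> * s) has_real_derivative phi_rate n \<nu> r - \<nu>) (at r)"
      by (auto intro!: derivative_eq_intros)
    then show "\<exists>y. ((\<lambda>s. phi n \<nu> s - \<nu> * s) has_real_derivative y) (at r) \<and> 0 \<le> y"
      using phi_rate_ge[OF n \<nu>, of r] r s by auto
  next
    have "continuous_on {0..1} (phi n \<nu>)"
      by (auto simp: continuous_on_eq_continuous_within intro!: DERIV_continuous[OF phi_deriv[OF n \<nu>]])
    then show "continuous_on {s..t} (\<lambda>s. phi n \<nu> s - \<nu> * s)"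
      by (intro continuous_intros) (use s continuous_on_subset in fastforce)
  qed
  then show ?thesis by (simp add: algebra_simps)
qed

lemma phi_continuous: "n > 0 \<Longrightarrow> \<nu> \<ge> 0 \<Longrightarrow> continuous_on {0..1} (phi n \<nu>)"
  by (auto simp: continuous_on_eq_continuous_within intro!: DERIV_continuous[OF phi_deriv])

section \<open>Polar coordinates and the energy estimate\<close>

definition pt :: "real \<Rightarrow> real \<Rightarrow> real^2" where
  "pt r t = (\<chi> i. if i = 1 then r * cos t else r * sin t)"

lemma pt_nth [simp]: "pt r t $ 1 = r * cos t" "pt r t $ 2 = r * sin t"
  by (auto simp: pt_def)

lemma pt_inner [simp]: "pt r t \<bullet> pt r t = r\<^sup>2"
proof -
  have "pt r t \<bullet> pt r t = r * cos t * (r * cos t) + r * sin t * (r * sin t)"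
    by (simp add: inner_2)
  then show ?thesis using sin_cos_squared_add[of t] by algebra
qed

lemma norm_pt [simp]: "norm (pt r t) = \<bar>r\<bar>"
  by (simp add: norm_eq_sqrt_inner)

lemma pt_eq_iff: "x = y \<longleftrightarrow> x $ 1 = y $ 1 \<and> x $ 2 = y $ 2" for x y :: "real^2"
  by (simp add: vec_eq_iff forall_2)

lemma pt_periodic [simp]: "pt r (t + 2 * pi) = pt r t"
  by (simp add: pt_eq_iff)

lemma pt_surj: obtains t where "0 \<le> t" "t < 2 * pi" "x = pt (norm x) t"
proof (cases "x = 0")
  case True
  then show ?thesis using that[of 0] by (simp add: pt_eq_iff)
next
  case False
  then have n: "norm x > 0" by simp
  have "(norm x)\<^sup>2 = (x $ 1)\<^sup>2 + (x $ 2)\<^sup>2"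
    by (simp only: power2_norm_eq_inner inner_2) (simp add: power2_eq_square)
  moreover have "(x $ 1 / norm x)\<^sup>2 + (x $ 2 / norm x)\<^sup>2 = ((x $ 1)\<^sup>2 + (x $ 2)\<^sup>2) / (norm x)\<^sup>2"
    by (simp add: power_divide add_divide_distrib)
  moreover have "(norm x)\<^sup>2 \<noteq> 0" using n by simp
  ultimately have "(x $ 1 / norm x)\<^sup>2 + (x $ 2 / norm x)\<^sup>2 = 1"
    by (metis divide_self)
  then obtain t where "0 \<le> t" "t < 2 * pi" "x $ 1 / norm x = cos t" "x $ 2 / norm x = sin t"
    using sincos_total_2pi[of "x $ 1 / norm x" "x $ 2 / norm x"] by blast
  then have "x $ 1 = norm x * cos t" "x $ 2 = norm x * sin t"
    using n by (metis nonzero_mult_div_cancel_left norm_eq_zero times_divide_eq_right False)+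
  then have "x = pt (norm x) t" by (simp only: pt_eq_iff[of x] pt_nth)
  then show ?thesis using that \<open>0 \<le> t\<close> \<open>t < 2 * pi\<close> by blast
qed

lemma pt_continuous: "continuous_on S (\<lambda>p. pt (fst p) (snd p))"
  unfolding pt_def by (rule continuous_on_vec_lambda, case_tac "i = 1") (auto intro!: continuous_intros)

lemma polar_continuous:
  assumes "continuous_on D f" "\<And>r t. (r, t) \<in> S \<Longrightarrow> pt r t \<in> D"
  shows "continuous_on S (\<lambda>(r, t). f (pt r t))"
  unfolding case_prod_unfold
  by (rule continuous_on_compose2[OF assms(1) pt_continuous]) (use assms(2) in auto)

lemma pt_axis: "pt r t = (r * cos t) *\<^sub>R axis 1 1 + (r * sin t) *\<^sub>R axis 2 1"
  by (simp add: pt_eq_iff axis_def)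

lemma polar_chain_rule:
  assumes f: "(f has_derivative (\<lambda>h. h $ 1 * a + h $ 2 * b)) (at (pt r t))"
  shows "((\<lambda>r. f (pt r t)) has_real_derivative cos t * a + sin t * b) (at r)"
    and "((\<lambda>t. f (pt r t)) has_real_derivative r * (cos t * b - sin t * a)) (at t)"
proof -
  have 1: "((\<lambda>r. pt r t) has_derivative (\<lambda>h. (h * cos t) *\<^sub>R axis 1 1 + (h * sin t) *\<^sub>R axis 2 1)) (at r)"
    unfolding pt_axis by (auto intro!: derivative_eq_intros)
  show "((\<lambda>r. f (pt r t)) has_real_derivative cos t * a + sin t * b) (at r)"
    unfolding has_field_derivative_def
    by (rule has_derivative_eq_rhs[OF has_derivative_compose[OF 1 f]]) (simp add: axis_def algebra_simps fun_eq_iff)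
  have 2: "((\<lambda>t. pt r t) has_derivative (\<lambda>h. (h * (- r * sin t)) *\<^sub>R axis 1 1 + (h * (r * cos t)) *\<^sub>R axis 2 1)) (at t)"
    unfolding pt_axis by (auto intro!: derivative_eq_intros simp: algebra_simps)
  show "((\<lambda>t. f (pt r t)) has_real_derivative r * (cos t * b - sin t * a)) (at t)"
    unfolding has_field_derivative_def
    by (rule has_derivative_eq_rhs[OF has_derivative_compose[OF 2 f]]) (simp add: axis_def algebra_simps fun_eq_iff)
qed

section \<open>Cartesian derivatives, the Laplacian, and the polar form of the eigenvalue
  equation\<close>

abbreviation pd :: "2 \<Rightarrow> (real^2 \<Rightarrow> real) \<Rightarrow> real^2 \<Rightarrow> real" where
  "pd \<equiv> pderiv_within closed_disc"

lemma at_within_disc: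
  assumes "x \<in> disc"
  shows "at x within disc = at x" "at x within closed_disc = at x"
  using assms by (auto intro!: at_within_open at_within_interior)

lemma pderiv_within_disc: "x \<in> disc \<Longrightarrow> pderiv_within disc i f x = pd i f x"
  by (simp only: pderiv_within_def at_within_disc)

lemma differentiable_has_pd:
  assumes "fat S" "f differentiable_on S" "x \<in> S"
  shows "(f has_derivative (\<lambda>h. h $ 1 * pderiv_within S 1 f x + h $ 2 * pderiv_within S 2 f x)) (at x within S)"
proof -
  let ?f' = "frechet_derivative f (at x within S)"
  have d: "(f has_derivative ?f') (at x within S)"
    using assms by (simp add: differentiable_on_def frechet_derivative_works)
  then interpret bounded_linear ?f' by (rule has_derivative_bounded_linear)
  have "?f' h = h $ 1 * ?f' (axis 1 1) + h $ 2 * ?f' (axis 2 1)" for h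
  proof -
    have "h = (h $ 1) *\<^sub>R axis 1 1 + (h $ 2) *\<^sub>R axis 2 1" by (simp add: pt_eq_iff axis_def)
    then have "?f' h = ?f' ((h $ 1) *\<^sub>R axis 1 1 + (h $ 2) *\<^sub>R axis 2 1)" by simp
    then show ?thesis by (simp add: add scaleR)
  qed
  then have "?f' = (\<lambda>h. h $ 1 * pderiv_within S 1 f x + h $ 2 * pderiv_within S 2 f x)"
    unfolding pderiv_within_def by (rule ext)
  then show ?thesis using d by simp
qed

text \<open>The Laplacian is built from derivatives within the open disc, the Neumann condition from
  derivatives within the closed disc. They agree at interior points, and from here on
  \<open>pd\<close> stands for both.\<close>

lemma C2_disc:
  assumes "Ck_on 2 disc u"
  shows "\<And>x. x \<in> disc \<Longrightarrow> (u has_derivative (\<lambda>h. h $ 1 * pd 1 u x + h $ 2 * pd 2 u x)) (at x)"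
    "\<And>i x. x \<in> disc \<Longrightarrow> (pd i u has_derivative (\<lambda>h. h $ 1 * pd 1 (pd i u) x + h $ 2 * pd 2 (pd i u) x)) (at x)"
    "continuous_on disc u" "\<And>i. continuous_on disc (pd i u)" "\<And>i j. continuous_on disc (pd j (pd i u))"
proof -
  have u: "u differentiable_on disc" "\<And>i. pderiv_within disc i u differentiable_on disc"
    "\<And>i j. continuous_on disc (pderiv_within disc j (pderiv_within disc i u))"
    using assms by (auto simp: numeral_2_eq_2)
  show d1: "(u has_derivative (\<lambda>h. h $ 1 * pd 1 u x + h $ 2 * pd 2 u x)) (at x)" if "x \<in> disc" for x
    using differentiable_has_pd[OF _ u(1) that] that
    by (simp add: pderiv_within_disc at_within_disc)
  have c: "pd j (pd i u) x = pderiv_within disc j (pderiv_within disc i u) x" if "x \<in> disc" for i j x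
    unfolding pderiv_within_disc[OF that, symmetric]
    by (rule pderiv_within_cong[OF that]) (simp add: pderiv_within_disc)
  show d2: "(pd i u has_derivative (\<lambda>h. h $ 1 * pd 1 (pd i u) x + h $ 2 * pd 2 (pd i u) x)) (at x)"
    if "x \<in> disc" for i x
  proof -
    have "(pderiv_within disc i u has_derivative (\<lambda>h. h $ 1 * pd 1 (pd i u) x + h $ 2 * pd 2 (pd i u) x)) (at x within disc)"
      using differentiable_has_pd[OF _ u(2) that, of i] by (simp add: c[OF that])
    then have "(pd i u has_derivative (\<lambda>h. h $ 1 * pd 1 (pd i u) x + h $ 2 * pd 2 (pd i u) x)) (at x within disc)"
      using has_derivative_cong_on[OF that, of "pderiv_within disc i u" "pd i u"] pderiv_within_disc by blast
    then show ?thesis using that by (simp add: at_within_disc)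
  qed
  show "continuous_on disc u" "continuous_on disc (pd i u)" for i
    by (auto intro!: continuous_at_imp_continuous_on has_derivative_continuous[OF d1] has_derivative_continuous[OF d2])
  show "continuous_on disc (pd j (pd i u))" for i j
    using u(3) by (subst continuous_on_cong[OF refl c]) auto
qed

definition dcigar_inv :: "real \<Rightarrow> 2 \<Rightarrow> 2 \<Rightarrow> real^2 \<Rightarrow> real^2 \<Rightarrow> real" where
  "dcigar_inv n i j x h = (let b = 1 / (1 + n * (x \<bullet> x)) in
     (if i = j then n * (2 * (x \<bullet> h)) else 0)
     + n\<^sup>2 * b\<^sup>2 * (2 * (x \<bullet> h)) * (x $ i * x $ j) - (n + n * b) * (h $ i * x $ j + x $ i * h $ j))"

lemma cigar_inv_has_derivative:
  assumes "n \<ge> 0"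
  shows "((\<lambda>x. cigar_inv n x $ i $ j) has_derivative dcigar_inv n i j x) (at x)"
proof -
  have eq: "(\<lambda>x. cigar_inv n x $ i $ j) = (\<lambda>x. (if i = j then 1 else 0) * (1 + n * (x \<bullet> x))
      - (n + n * (1 / (1 + n * (x \<bullet> x)))) * (x $ i * x $ j))"
    by (auto simp: cigar_inv_def fun_eq_iff)
  show ?thesis unfolding eq
    by (rule derivative_eq_intros inv_has_derivative[OF assms] coord_has_derivative refl)+
      (auto simp: dcigar_inv_def Let_def fun_eq_iff algebra_simps power2_eq_square inner_commute)
qed

text \<open>The determinant is 1, so this is the divergence of \<open>cigar_inv n x\<close> applied
  to the gradient; the last line is the divergence of that matrix. Only the sum of the two mixed
  derivatives enters, so their symmetry is not invoked.\<close>

lemma laplace_beltrami_cigar: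
  assumes n: "n \<ge> 0" and u: "Ck_on 2 disc u" and x: "x \<in> disc" and b: "b = 1 / (1 + n * (x \<bullet> x))"
  shows "laplace_beltrami (cigar n) u x =
    (1 + n * (x \<bullet> x)) * (pd 1 (pd 1 u) x + pd 2 (pd 2 u) x)
    - (n + n * b) * ((x $ 1)\<^sup>2 * pd 1 (pd 1 u) x + x $ 1 * x $ 2 * (pd 1 (pd 2 u) x + pd 2 (pd 1 u) x)
        + (x $ 2)\<^sup>2 * pd 2 (pd 2 u) x)
    - n * (1 + b + 2 * b\<^sup>2) * (x $ 1 * pd 1 u x + x $ 2 * pd 2 u x)"
proof -
  have b3: "b + b * n * (x $ 1)\<^sup>2 + b * n * (x $ 2)\<^sup>2 = 1"
    using radial_inverse[OF n, of x] b by metis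
  have term_eq: "pderiv_within disc i (\<lambda>y. sqrt (det (cigar n y)) *
        (\<Sum>j\<in>UNIV. matrix_inv (cigar n y) $ i $ j * pderiv_within disc j u y)) x
      = (\<Sum>j\<in>UNIV. cigar_inv n x $ i $ j * pd i (pd j u) x + dcigar_inv n i j x (axis i 1) * pd j u x)" for i
  proof -
    have "pderiv_within disc i (\<lambda>y. sqrt (det (cigar n y)) *
        (\<Sum>j\<in>UNIV. matrix_inv (cigar n y) $ i $ j * pderiv_within disc j u y)) x
      = pderiv_within disc i (\<lambda>y. \<Sum>j\<in>UNIV. cigar_inv n y $ i $ j * pd j u y) x"
      by (rule pderiv_within_cong[OF x])
        (simp add: cigar_cigar_inv(3)[OF n] matrix_inv_cigar[OF n] pderiv_within_disc)
    also have "\<dots> = (\<lambda>h. \<Sum>j\<in>UNIV. cigar_inv n x $ i $ j * (h $ 1 * pd 1 (pd j u) x + h $ 2 * pd 2 (pd j u) x)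
        + dcigar_inv n i j x h * pd j u x) (axis i 1)"
      by (rule pderiv_within_eq[OF _ x])
        (auto intro!: has_derivative_sum has_derivative_mult has_derivative_at_withinI[OF cigar_inv_has_derivative[OF n]]
            has_derivative_at_withinI[OF C2_disc(2)[OF u x]])
    also have "\<dots> = (\<Sum>j\<in>UNIV. cigar_inv n x $ i $ j * pd i (pd j u) x + dcigar_inv n i j x (axis i 1) * pd j u x)"
      using exhaust_2[of i] by (auto simp: axis_def sum_2)
    finally show ?thesis .
  qed
  have ax: "x \<bullet> axis i 1 = x $ i" for i by (simp add: inner_axis)
  have s: "x \<bullet> x = (x $ 1)\<^sup>2 + (x $ 2)\<^sup>2" by (simp add: inner_2 power2_eq_square)
  have nb: "n / (1 + n * (x \<bullet> x)) = n * b" using b by simp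
  show ?thesis
    unfolding laplace_beltrami_def term_eq
    unfolding cigar_cigar_inv(3)[OF n] dcigar_inv_def cigar_inv_def Let_def ax b[symmetric]
    apply (simp add: sum_2 axis_def nb)
    apply (simp add: s)
    using b3 by algebra
qed

text \<open>In polar coordinates, with \<open>G = r W\<^sub>r / (1 + n r\<^sup>2)\<close>, the eigenvalue equation becomes a
  first-order system in \<open>r\<close>.\<close>

definition polar_sol where
  "polar_sol n \<gamma> W G Wt Wtt \<longleftrightarrow>
    (\<forall>r\<in>{0<..<1}. \<forall>t::real.
      ((\<lambda>r. W r t) has_real_derivative (1 + n * r\<^sup>2) / r * G r t) (at r) \<and>
      ((\<lambda>r. G r t) has_real_derivative - r * ((n + 1 / r\<^sup>2) * Wtt r t + \<gamma> * W r t)) (at r) \<and>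
      (W r has_real_derivative Wt r t) (at t) \<and>
      (Wt r has_real_derivative Wtt r t) (at t) \<and>
      W r (t + 2 * pi) = W r t \<and> Wt r (t + 2 * pi) = Wt r t) \<and>
    continuous_on ({0..<1} \<times> UNIV) (\<lambda>(r, t). W r t) \<and>
    continuous_on ({0..<1} \<times> UNIV) (\<lambda>(r, t). G r t) \<and>
    continuous_on ({0..<1} \<times> UNIV) (\<lambda>(r, t). Wt r t) \<and>
    continuous_on ({0..<1} \<times> UNIV) (\<lambda>(r, t). Wtt r t) \<and> (\<forall>t. G 0 t = 0)"

text \<open>In the area coordinate \<open>t\<close> this is the flux \<open>p u\<^sub>t\<close>. The
  Cartesian form makes sense at the origin, where it vanishes, and on the boundary circle, where it
  is the conormal derivative.\<close>

definition polG :: "real \<Rightarrow> (real^2 \<Rightarrow> real) \<Rightarrow> real \<Rightarrow> real \<Rightarrow> real" where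
  "polG n u r t = (\<lambda>x. (x $ 1 * pd 1 u x + x $ 2 * pd 2 u x) / (1 + n * (x \<bullet> x))) (pt r t)"

lemma polar_sol_of_eigen:
  assumes n: "n \<ge> 0" and u: "Ck_on 2 disc u"
    and eq: "\<And>x. x \<in> disc \<Longrightarrow> laplace_beltrami (cigar n) u x + \<gamma> * u x = 0"
  shows "\<exists>Wt Wtt. polar_sol n \<gamma> (\<lambda>r t. u (pt r t)) (polG n u) Wt Wtt"
proof -
  \<comment> \<open>The rotation field applied once and twice to \<open>u\<close>; the first-order
    part of \<open>?TT\<close> comes from differentiating the coefficients of the field.\<close>
  let ?T = "\<lambda>x. x $ 1 * pd 2 u x - x $ 2 * pd 1 u x"
  let ?TT = "\<lambda>x. (x $ 1)\<^sup>2 * pd 2 (pd 2 u) x - x $ 1 * x $ 2 * (pd 1 (pd 2 u) x + pd 2 (pd 1 u) x)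
    + (x $ 2)\<^sup>2 * pd 1 (pd 1 u) x - (x $ 1 * pd 1 u x + x $ 2 * pd 2 u x)"
  note d1 = C2_disc(1)[OF u] and d2 = C2_disc(2)[OF u] and cont = C2_disc(3-5)[OF u]
  have disc: "pt r t \<in> disc" if "r \<in> {0..<1}" for r t using that by simp
  have pos: "1 + n * (x \<bullet> x) > 0" for x :: "real^2" by (rule one_plus_pos[OF n])
  have "polar_sol n \<gamma> (\<lambda>r t. u (pt r t)) (polG n u) (\<lambda>r t. ?T (pt r t)) (\<lambda>r t. ?TT (pt r t))"
    unfolding polar_sol_def
  proof (intro conjI ballI allI)
    fix r t :: real assume r: "r \<in> {0<..<1}"
    then have x: "pt r t \<in> disc" by simp
    have rn: "r \<noteq> 0" using r by simp
    have q: "1 + n * r\<^sup>2 > 0" using pos[of "pt r t"] by simp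
    have sc: "(sin t)\<^sup>2 + (cos t)\<^sup>2 = 1" by simp
    let ?x = "pt r t"
    have "polG n u r t = r * (cos t * pd 1 u ?x + sin t * pd 2 u ?x) / (1 + n * r\<^sup>2)"
      by (simp add: polG_def algebra_simps)
    then have "(1 + n * r\<^sup>2) / r * polG n u r t = cos t * pd 1 u ?x + sin t * pd 2 u ?x"
      using q rn by simp
    then show "((\<lambda>r. u (pt r t)) has_real_derivative (1 + n * r\<^sup>2) / r * polG n u r t) (at r)"
      using polar_chain_rule(1)[OF d1[OF x]] by simp
    show "((\<lambda>t. u (pt r t)) has_real_derivative ?T (pt r t)) (at t)"
      using polar_chain_rule(2)[OF d1[OF x]] by (simp add: algebra_simps)
    have cd: "((\<lambda>x. x $ i) has_derivative (\<lambda>h. h $ i)) (at ?x)" for i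
      by (rule coord_has_derivative)
    have dT: "(?T has_derivative (\<lambda>h. h $ 1 * (pd 2 u ?x + ?x $ 1 * pd 1 (pd 2 u) ?x - ?x $ 2 * pd 1 (pd 1 u) ?x)
        + h $ 2 * (?x $ 1 * pd 2 (pd 2 u) ?x - pd 1 u ?x - ?x $ 2 * pd 2 (pd 1 u) ?x))) (at ?x)"
      by (rule derivative_eq_intros cd d2[OF x] refl)+ (simp add: algebra_simps fun_eq_iff)
    show "((\<lambda>t. ?T (pt r t)) has_real_derivative ?TT (pt r t)) (at t)"
      using polar_chain_rule(2)[OF dT] by (simp add: algebra_simps power2_eq_square)
    have dD: "((\<lambda>x. x $ 1 * pd 1 u x + x $ 2 * pd 2 u x) has_derivative
        (\<lambda>h. h $ 1 * (pd 1 u ?x + ?x $ 1 * pd 1 (pd 1 u) ?x + ?x $ 2 * pd 1 (pd 2 u) ?x)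
        + h $ 2 * (pd 2 u ?x + ?x $ 1 * pd 2 (pd 1 u) ?x + ?x $ 2 * pd 2 (pd 2 u) ?x))) (at ?x)"
      by (rule derivative_eq_intros cd d2[OF x] refl)+ (simp add: algebra_simps fun_eq_iff)
    define b where "b = 1 / (1 + n * r\<^sup>2)"
    have bb: "b + b * n * r\<^sup>2 = 1" using q by (simp add: b_def field_simps)
    have db: "((\<lambda>r. 1 / (1 + n * r\<^sup>2)) has_real_derivative - 2 * n * r * b\<^sup>2) (at r)"
      using q by (auto intro!: derivative_eq_intros simp: b_def power2_eq_square)
    define D where "D = ?x $ 1 * pd 1 u ?x + ?x $ 2 * pd 2 u ?x"
    define DD where "DD = cos t * (pd 1 u ?x + ?x $ 1 * pd 1 (pd 1 u) ?x + ?x $ 2 * pd 1 (pd 2 u) ?x)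
        + sin t * (pd 2 u ?x + ?x $ 1 * pd 2 (pd 1 u) ?x + ?x $ 2 * pd 2 (pd 2 u) ?x)"
    have dG: "(\<lambda>r. polG n u r t) = (\<lambda>r. 1 / (1 + n * r\<^sup>2) * (\<lambda>x. x $ 1 * pd 1 u x + x $ 2 * pd 2 u x) (pt r t))"
      by (simp add: polG_def)
    have "((\<lambda>r. polG n u r t) has_real_derivative - 2 * n * r * b\<^sup>2 * D + DD * b) (at r)"
      unfolding dG using DERIV_mult[OF db polar_chain_rule(1)[OF dD]]
      by (simp add: D_def DD_def b_def)
    moreover have "- 2 * n * r * b\<^sup>2 * D + DD * b = - r * ((n + 1 / r\<^sup>2) * ?TT ?x + \<gamma> * u ?x)"
    proof -
      have L: "\<gamma> * u ?x = - laplace_beltrami (cigar n) u ?x" using eq[OF x] by linarith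
      have "r * (- 2 * n * r * b\<^sup>2 * D + DD * b) = - ((n * r\<^sup>2 + 1) * ?TT ?x - r\<^sup>2 * laplace_beltrami (cigar n) u ?x)"
        unfolding laplace_beltrami_cigar[OF n u x refl] pt_inner b_def[symmetric] D_def DD_def pt_nth
        using bb sc by algebra
      also have "\<dots> = r * (- r * ((n + 1 / r\<^sup>2) * ?TT ?x + \<gamma> * u ?x))"
        unfolding L using rn by (simp add: field_simps power2_eq_square)
      finally show ?thesis using rn by (simp only: mult_cancel_left) simp
    qed
    ultimately show "((\<lambda>r. polG n u r t) has_real_derivative - r * ((n + 1 / r\<^sup>2) * ?TT ?x + \<gamma> * u ?x)) (at r)"
      by simp
  next
    show "continuous_on ({0..<1} \<times> UNIV) (\<lambda>(r, t). u (pt r t))"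
      by (rule polar_continuous[OF cont(1)]) auto
    show "continuous_on ({0..<1} \<times> UNIV) (\<lambda>(r, t). polG n u r t)"
      unfolding polG_def
      by (rule polar_continuous[of disc], intro continuous_intros cont)
        (use pos in \<open>auto simp: less_imp_neq[symmetric] intro!: less_imp_neq[symmetric]\<close>)
    show "continuous_on ({0..<1} \<times> UNIV) (\<lambda>(r, t). ?T (pt r t))"
      by (rule polar_continuous[of disc], intro continuous_intros cont) auto
    show "continuous_on ({0..<1} \<times> UNIV) (\<lambda>(r, t). ?TT (pt r t))"
      by (rule polar_continuous[of disc], intro continuous_intros cont) auto
  qed (auto simp: polG_def)
  then show ?thesis by blast
qed

text \<open>The system is linear with coefficients independent of the angle. Stating
  \<open>polar_sol\<close> for arbitrary functions of \<open>r\<close> and \<open>t\<close> lets it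
  apply to such differences directly.\<close>

lemma polar_sol_shift_diff:
  assumes "polar_sol n \<gamma> W G Wt Wtt"
  shows "polar_sol n \<gamma> (\<lambda>r t. W r t - W r (t + \<alpha>)) (\<lambda>r t. G r t - G r (t + \<alpha>))
    (\<lambda>r t. Wt r t - Wt r (t + \<alpha>)) (\<lambda>r t. Wtt r t - Wtt r (t + \<alpha>))"
proof -
  have c: "continuous_on ({0..<1} \<times> UNIV) (\<lambda>(r, t). f r t - f r (t + \<alpha>))"
    if "continuous_on ({0..<1::real} \<times> (UNIV::real set)) (\<lambda>(r, t). f r t)" for f :: "real \<Rightarrow> real \<Rightarrow> real"
  proof -
    have "continuous_on ({0..<1} \<times> UNIV) ((\<lambda>(r, t). f r t) \<circ> (\<lambda>p. (fst p, snd p + \<alpha>)))"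
      by (intro continuous_on_compose continuous_intros continuous_on_subset[OF that]) auto
    then show ?thesis using continuous_on_diff[OF that] by (simp add: o_def case_prod_unfold)
  qed
  have sh: "((\<lambda>t. f (t + \<alpha>)) has_real_derivative d) (at t)"
    if "(f has_real_derivative d) (at (t + \<alpha>))" for f :: "real \<Rightarrow> real" and d t
    using DERIV_shift[of f d t \<alpha>] that by simp
  show ?thesis
    unfolding polar_sol_def
  proof (intro conjI ballI allI)
    fix r t :: real assume "r \<in> {0<..<1}"
    note H = assms[unfolded polar_sol_def, THEN conjunct1, rule_format, OF this]
    show "((\<lambda>r. W r t - W r (t + \<alpha>)) has_real_derivative (1 + n * r\<^sup>2) / r * (G r t - G r (t + \<alpha>))) (at r)"
      using DERIV_diff[OF H[THEN conjunct1, of t] H[THEN conjunct1, of "t + \<alpha>"]]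
      by (simp only: right_diff_distrib)
    have "((\<lambda>r. G r t) has_real_derivative - r * ((n + 1 / r\<^sup>2) * Wtt r t + \<gamma> * W r t)) (at r)" for t
      using H by blast
    from DERIV_diff[OF this[of t] this[of "t + \<alpha>"]]
    show "((\<lambda>r. G r t - G r (t + \<alpha>)) has_real_derivative
        - r * ((n + 1 / r\<^sup>2) * (Wtt r t - Wtt r (t + \<alpha>)) + \<gamma> * (W r t - W r (t + \<alpha>)))) (at r)"
      by (simp add: algebra_simps)
    show "((\<lambda>t. W r t - W r (t + \<alpha>)) has_real_derivative Wt r t - Wt r (t + \<alpha>)) (at t)"
      "((\<lambda>t. Wt r t - Wt r (t + \<alpha>)) has_real_derivative Wtt r t - Wtt r (t + \<alpha>)) (at t)"
      using H by (auto intro!: DERIV_diff sh)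
    have "W r (t + 2 * pi) = W r t" "Wt r (t + 2 * pi) = Wt r t" for t
      using H by blast+
    from this[of t] this[of "t + \<alpha>"]
    show "W r (t + 2 * pi) - W r (t + 2 * pi + \<alpha>) = W r t - W r (t + \<alpha>)"
      "Wt r (t + 2 * pi) - Wt r (t + 2 * pi + \<alpha>) = Wt r t - Wt r (t + \<alpha>)"
      by (simp_all add: ac_simps)
  qed (use assms c in \<open>auto simp: polar_sol_def\<close>)
qed

text \<open>Integrating from a zero of \<open>f\<close> bounds \<open>f\<^sup>2\<close> pointwise by
  the integral of the absolute value of \<open>2 f f'\<close>. The weight \<open>4 * pi\<close> in
  \<open>q\<close> is chosen so that integration over a length \<open>2 * pi\<close> puts exactly
  half of the left side on the right, where it is absorbed.\<close>

lemma circle_poincare: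
  fixes f f' :: "real \<Rightarrow> real"
  assumes d: "\<And>t. (f has_real_derivative f' t) (at t)" and c: "continuous_on UNIV f'"
    and z: "z \<in> {0..2*pi}" "f z = 0"
  shows "integral {0..2*pi} (\<lambda>t. (f t)\<^sup>2) \<le> 16 * pi\<^sup>2 * integral {0..2*pi} (\<lambda>t. (f' t)\<^sup>2)"
proof -
  have cf: "continuous_on A f" for A
    using d by (auto intro!: continuous_at_imp_continuous_on DERIV_continuous)
  have cf': "continuous_on A f'" for A using c continuous_on_subset by blast
  define I where "I = integral {0..2*pi} (\<lambda>t. (f t)\<^sup>2)"
  define J where "J = integral {0..2*pi} (\<lambda>t. (f' t)\<^sup>2)"
  define q where "q = (\<lambda>t. (f t)\<^sup>2 / (4 * pi) + 4 * pi * (f' t)\<^sup>2)"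
  have cq: "continuous_on A q" for A unfolding q_def by (intro continuous_intros cf cf') auto
  have ii: "g integrable_on {a..b}" if "continuous_on UNIV g" for g :: "real \<Rightarrow> real" and a b
    using that by (intro integrable_continuous_real) (rule continuous_on_subset[OF that], simp)
  have q_int: "integral {0..2*pi} q = I / (4 * pi) + 4 * pi * J"
  proof -
    have "(\<lambda>t. (f t)\<^sup>2) integrable_on {0..2*pi}" "(\<lambda>t. (f' t)\<^sup>2) integrable_on {0..2*pi}"
      by (auto intro!: ii continuous_intros cf cf')
    then show ?thesis unfolding q_def I_def J_def
      by (subst integral_add) (auto simp: integrable_on_divide integrable_on_mult_right)
  qed
  have AM: "\<bar>2 * f t * f' t\<bar> \<le> q t" for t
  proof -
    have "0 \<le> (f t - 4 * pi * f' t)\<^sup>2 / (4 * pi)" "0 \<le> (f t + 4 * pi * f' t)\<^sup>2 / (4 * pi)" by auto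
    then show ?thesis unfolding q_def by (auto simp: abs_le_iff power2_eq_square field_simps)
  qed
  have q0: "q t \<ge> 0" for t using AM[of t] by linarith
  have ftc: "((\<lambda>t. 2 * f t * f' t) has_integral ((f b)\<^sup>2 - (f a)\<^sup>2)) {a..b}" if "a \<le> b" for a b
    by (rule fundamental_theorem_of_calculus[OF that])
      (auto intro!: derivative_eq_intros has_field_derivative_at_within[OF d]
        simp flip: has_real_derivative_iff_has_vector_derivative)
  have sub: "\<bar>(f b)\<^sup>2 - (f a)\<^sup>2\<bar> \<le> integral {0..2*pi} q" if "0 \<le> a" "a \<le> b" "b \<le> 2*pi" for a b
  proof -
    have "norm (integral {a..b} (\<lambda>t. 2 * f t * f' t)) \<le> integral {a..b} q"
      by (rule integral_norm_bound_integral) (use ftc[OF that(2)] AM in \<open>auto intro!: ii cq continuous_intros cf cf'\<close>)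
    also have "\<dots> \<le> integral {0..2*pi} q"
      by (rule integral_subset_le) (use that q0 in \<open>auto intro!: ii cq\<close>)
    finally show ?thesis using integral_unique[OF ftc[OF that(2)]] by simp
  qed
  have pt: "(f t)\<^sup>2 \<le> integral {0..2*pi} q" if "t \<in> {0..2*pi}" for t
    using sub[of z t] sub[of t z] z that by (cases "z \<le> t") auto
  have "I \<le> integral {0..2*pi} (\<lambda>t. integral {0..2*pi} q)"
    unfolding I_def by (rule integral_le) (auto intro!: ii continuous_intros cf pt)
  then have "I \<le> 2 * pi * (I / (4 * pi) + 4 * pi * J)" by (simp add: q_int)
  also have "\<dots> = I / 2 + 8 * pi\<^sup>2 * J" by (simp add: field_simps power2_eq_square)
  finally have "I \<le> 16 * pi\<^sup>2 * J" by linarith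
  then show ?thesis by (simp add: I_def J_def)
qed

lemma nondecreasing_from_deriv:
  fixes f :: "real \<Rightarrow> real"
  assumes "a \<le> b" "continuous_on {a..b} f"
    and "\<And>x. a < x \<Longrightarrow> x < b \<Longrightarrow> (f has_real_derivative f' x) (at x)"
    and "\<And>x. a < x \<Longrightarrow> x < b \<Longrightarrow> f' x \<ge> 0"
  shows "f a \<le> f b"
  by (rule DERIV_nonneg_imp_increasing_open[OF assms(1) _ assms(2)]) (use assms in blast)

text \<open>With \<open>E(r) = \<integral> W\<^sup>2 dt\<close> and \<open>F(r) = \<integral> W G dt\<close> one has \<open>E' = 2 (1 + n r\<^sup>2) / r F\<close> and
  \<open>F' \<ge> r c E\<close>, so \<open>F\<close> and \<open>E\<close> are nondecreasing, while either boundary condition makes one of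
  them vanish at \<open>r = 1\<close>.\<close>

lemma polar_energy_zero:
  assumes n: "n \<ge> 0" and P: "polar_sol n \<gamma> W G Wt Wtt" and c: "c > 0"
    and coercive: "\<And>r. r \<in> {0<..<1} \<Longrightarrow>
      c * integral {0..2*pi} (\<lambda>t. (W r t)\<^sup>2) \<le> integral {0..2*pi} (\<lambda>t. n * (Wt r t)\<^sup>2 - \<gamma> * (W r t)\<^sup>2)"
    and bc: "(continuous_on ({0..1} \<times> {0..2*pi}) (\<lambda>(r, t). W r t) \<and> (\<forall>t\<in>{0..2*pi}. W 1 t = 0)) \<or>
      (continuous_on ({0..1} \<times> {0..2*pi}) (\<lambda>(r, t). W r t * G r t) \<and> (\<forall>t\<in>{0..2*pi}. G 1 t = 0))"
    and r0: "r0 \<in> {0<..<1}" and t0: "t0 \<in> {0..2*pi}"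
  shows "W r0 t0 = 0"
proof -
  have D: "((\<lambda>r. W r t) has_real_derivative (1 + n * r\<^sup>2) / r * G r t) (at r)"
    "((\<lambda>r. G r t) has_real_derivative - r * ((n + 1 / r\<^sup>2) * Wtt r t + \<gamma> * W r t)) (at r)"
    "(W r has_real_derivative Wt r t) (at t)" "(Wt r has_real_derivative Wtt r t) (at t)"
    "W r (t + 2 * pi) = W r t" "Wt r (t + 2 * pi) = Wt r t" if "r \<in> {0<..<1}" for r t
    using P[unfolded polar_sol_def, THEN conjunct1, rule_format, OF that, of t] by auto
  have cont: "continuous_on ({0..<1} \<times> UNIV) (\<lambda>(r, t). W r t)"
    "continuous_on ({0..<1} \<times> UNIV) (\<lambda>(r, t). G r t)"
    "continuous_on ({0..<1} \<times> UNIV) (\<lambda>(r, t). Wt r t)"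
    "continuous_on ({0..<1} \<times> UNIV) (\<lambda>(r, t). Wtt r t)" and G0: "\<And>t. G 0 t = 0"
    using P unfolding polar_sol_def by auto
  have sect: "continuous_on A (f r)" if "continuous_on ({0..<1} \<times> UNIV) (\<lambda>(r, t). f r t)" "r \<in> {0..<1}"
    for f :: "real \<Rightarrow> real \<Rightarrow> real" and r A
  proof -
    have "continuous_on A ((\<lambda>(r, t). f r t) \<circ> (\<lambda>t. (r, t)))"
      by (intro continuous_on_compose continuous_intros continuous_on_subset[OF that(1)]) (use that in auto)
    then show ?thesis by (simp add: o_def)
  qed
  note sW = sect[OF cont(1)] and sG = sect[OF cont(2)] and sWt = sect[OF cont(3)] and sWtt = sect[OF cont(4)]
  have pc: "continuous_on S (\<lambda>p. f (fst p) (snd p))" if "continuous_on ({0..<1} \<times> UNIV) (\<lambda>(r, t). f r t)" "S \<subseteq> {0..<1} \<times> UNIV"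
    for f :: "real \<Rightarrow> real \<Rightarrow> real" and S
    using continuous_on_subset[OF that] by (simp add: case_prod_unfold)
  note pW = pc[OF cont(1)] and pG = pc[OF cont(2)] and pWtt = pc[OF cont(4)]
  let ?I = "cbox 0 (2*pi)"
  define E where "E = (\<lambda>r. integral ?I (\<lambda>t. (W r t)\<^sup>2))"
  define F where "F = (\<lambda>r. integral ?I (\<lambda>t. W r t * G r t))"
  have cE: "continuous_on {0..<1} E" unfolding E_def
    by (rule integral_continuous_on_param) (auto simp: case_prod_unfold intro!: continuous_intros pW)
  have cF: "continuous_on {0..<1} F" unfolding F_def
    by (rule integral_continuous_on_param) (auto simp: case_prod_unfold intro!: continuous_intros pW pG)
  have F0: "F 0 = 0" by (simp add: F_def G0)
  have E0: "E r \<ge> 0" for r unfolding E_def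
    by (cases "(\<lambda>t. (W r t)\<^sup>2) integrable_on ?I") (auto intro: integral_nonneg simp: not_integrable_integral)
  have dE: "(E has_real_derivative 2 * (1 + n * r\<^sup>2) / r * F r) (at r)" if r: "r \<in> {0<..<1}" for r
  proof -
    have "(E has_real_derivative integral ?I (\<lambda>t. 2 * (1 + n * r\<^sup>2) / r * (W r t * G r t))) (at r within {0<..<1})"
      unfolding E_def
    proof (rule leibniz_rule_field_derivative[where U = "{0<..<1}" and fx = "\<lambda>r t. 2 * (1 + n * r\<^sup>2) / r * (W r t * G r t)"])
      show "((\<lambda>r. (W r t)\<^sup>2) has_real_derivative 2 * (1 + n * r\<^sup>2) / r * (W r t * G r t)) (at r within {0<..<1})"
        if "r \<in> {0<..<1}" for r t
        by (rule has_field_derivative_at_within) (auto intro!: derivative_eq_intros D(1)[OF that])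
      show "(\<lambda>t. (W r t)\<^sup>2) integrable_on ?I" if "r \<in> {0<..<1}" for r
        using that by (intro integrable_continuous continuous_intros sW) auto
      show "continuous_on ({0<..<1} \<times> ?I) (\<lambda>(r, t). 2 * (1 + n * r\<^sup>2) / r * (W r t * G r t))"
        unfolding case_prod_unfold by (intro continuous_intros pW pG) auto
    qed (use r in auto)
    then show ?thesis using r by (simp add: F_def at_within_open[of r "{0<..<1}"])
  qed
  define F' where "F' = (\<lambda>r. integral ?I (\<lambda>t. (1 + n * r\<^sup>2) / r * (G r t)\<^sup>2
      - r * ((n + 1 / r\<^sup>2) * (W r t * Wtt r t) + \<gamma> * (W r t)\<^sup>2)))"
  have dF: "(F has_real_derivative F' r) (at r)" if r: "r \<in> {0<..<1}" for r
  proof -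
    let ?f = "\<lambda>r t. (1 + n * r\<^sup>2) / r * (G r t)\<^sup>2 - r * ((n + 1 / r\<^sup>2) * (W r t * Wtt r t) + \<gamma> * (W r t)\<^sup>2)"
    have "(F has_real_derivative integral ?I (?f r)) (at r within {0<..<1})"
      unfolding F_def
    proof (rule leibniz_rule_field_derivative[where U = "{0<..<1}" and fx = ?f])
      show "((\<lambda>r. W r t * G r t) has_real_derivative ?f r t) (at r within {0<..<1})"
        if "r \<in> {0<..<1}" for r t
        by (rule has_field_derivative_at_within, rule DERIV_cong, rule DERIV_mult[OF D(1)[OF that] D(2)[OF that]])
          (simp add: algebra_simps power2_eq_square)
      show "(\<lambda>t. W r t * G r t) integrable_on ?I" if "r \<in> {0<..<1}" for r
        using that by (intro integrable_continuous continuous_intros sW sG) auto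
      show "continuous_on ({0<..<1} \<times> ?I) (\<lambda>(r, t). ?f r t)"
        unfolding case_prod_unfold by (intro continuous_intros pW pG pWtt) auto
    qed (use r in auto)
    then show ?thesis using r by (simp add: F'_def at_within_open[of r "{0<..<1}"])
  qed
  have F'_ge: "F' r \<ge> r * (c * E r)" if r: "r \<in> {0<..<1}" for r
  proof -
    have r': "r \<in> {0..<1}" using r by simp
    have ibp: "((\<lambda>t. (Wt r t)\<^sup>2 + W r t * Wtt r t) has_integral (W r (2*pi) * Wt r (2*pi) - W r 0 * Wt r 0)) {0..2*pi}"
      by (rule fundamental_theorem_of_calculus)
        (auto intro!: derivative_eq_intros has_field_derivative_at_within[OF D(3)[OF r]]
          has_field_derivative_at_within[OF D(4)[OF r]]
          simp: power2_eq_square simp flip: has_real_derivative_iff_has_vector_derivative)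
    have "W r (2*pi) = W r 0" "Wt r (2*pi) = Wt r 0" using D(5,6)[OF r, of 0] by auto
    with ibp have ibp0: "((\<lambda>t. (Wt r t)\<^sup>2 + W r t * Wtt r t) has_integral 0) ?I" by simp
    have int: "(\<lambda>t. (1 + n * r\<^sup>2) / r * (G r t)\<^sup>2
      - r * ((n + 1 / r\<^sup>2) * (W r t * Wtt r t) + \<gamma> * (W r t)\<^sup>2)) integrable_on ?I"
      "(\<lambda>t. r * (n * (Wt r t)\<^sup>2 - \<gamma> * (W r t)\<^sup>2)) integrable_on ?I"
      "(\<lambda>t. n * (Wt r t)\<^sup>2 - \<gamma> * (W r t)\<^sup>2) integrable_on ?I"
      by (rule integrable_continuous, intro continuous_intros sW[OF r'] sG[OF r'] sWt[OF r'] sWtt[OF r'])+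
    \<comment> \<open>Integration by parts over the period: a multiple of the integral of the
      derivative of \<open>W * Wt\<close>, which is 0, is added to turn \<open>- W * Wtt\<close>
      into \<open>Wt\<^sup>2\<close>. Next, the nonnegative terms with \<open>G\<^sup>2\<close> and
      with \<open>1 / r\<^sup>2\<close> are dropped.\<close>
    have "F' r = integral ?I (\<lambda>t. ((1 + n * r\<^sup>2) / r * (G r t)\<^sup>2
      - r * ((n + 1 / r\<^sup>2) * (W r t * Wtt r t) + \<gamma> * (W r t)\<^sup>2))
      + r * (n + 1 / r\<^sup>2) * ((Wt r t)\<^sup>2 + W r t * Wtt r t))"
      unfolding F'_def
      using integral_unique[OF has_integral_add[OF integrable_integral[OF int(1)]
          has_integral_mult_right[OF ibp0, of "r * (n + 1 / r\<^sup>2)"]]] by simp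
    also have "\<dots> \<ge> integral ?I (\<lambda>t. r * (n * (Wt r t)\<^sup>2 - \<gamma> * (W r t)\<^sup>2))"
    proof (rule integral_le[OF int(2)])
      show "(\<lambda>t. ((1 + n * r\<^sup>2) / r * (G r t)\<^sup>2
      - r * ((n + 1 / r\<^sup>2) * (W r t * Wtt r t) + \<gamma> * (W r t)\<^sup>2))
      + r * (n + 1 / r\<^sup>2) * ((Wt r t)\<^sup>2 + W r t * Wtt r t)) integrable_on ?I"
        using has_integral_add[OF integrable_integral[OF int(1)]
          has_integral_mult_right[OF ibp0, of "r * (n + 1 / r\<^sup>2)"]] by blast
      fix t
      have "(1 + n * r\<^sup>2) / r * (G r t)\<^sup>2 \<ge> 0" "r * (1 / r\<^sup>2) * (Wt r t)\<^sup>2 \<ge> 0"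
        using r n by auto
      then show "r * (n * (Wt r t)\<^sup>2 - \<gamma> * (W r t)\<^sup>2) \<le> ((1 + n * r\<^sup>2) / r * (G r t)\<^sup>2
      - r * ((n + 1 / r\<^sup>2) * (W r t * Wtt r t) + \<gamma> * (W r t)\<^sup>2))
      + r * (n + 1 / r\<^sup>2) * ((Wt r t)\<^sup>2 + W r t * Wtt r t)"
        by (simp add: ring_distribs)
    qed
    also have "integral ?I (\<lambda>t. r * (n * (Wt r t)\<^sup>2 - \<gamma> * (W r t)\<^sup>2))
        = r * integral ?I (\<lambda>t. n * (Wt r t)\<^sup>2 - \<gamma> * (W r t)\<^sup>2)" by simp
    also have "\<dots> \<ge> r * (c * E r)"
      using coercive[OF r] r by (intro mult_left_mono) (auto simp: E_def)
    finally show ?thesis .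
  qed
  have F'0: "F' r \<ge> 0" if "r \<in> {0<..<1}" for r
  proof -
    have "0 \<le> r * (c * E r)" using that c E0[of r] by simp
    then show ?thesis using F'_ge[OF that] by linarith
  qed
  have mono: "F a \<le> F b" if "0 \<le> a" "a \<le> b" "b < 1" for a b
    by (rule nondecreasing_from_deriv[of a b F F'])
      (use that dF F'0 in \<open>auto intro: continuous_on_subset[OF cF]\<close>)
  have Fpos: "F r \<ge> 0" if "r \<in> {0..<1}" for r
    using mono[of 0 r] that F0 by auto
  have E_zero: "E r0 = 0"
    using bc
  proof
    assume B: "continuous_on ({0..1} \<times> {0..2*pi}) (\<lambda>(r, t). W r t) \<and> (\<forall>t\<in>{0..2*pi}. W 1 t = 0)"
    have pW1: "continuous_on ({0..1} \<times> {0..2*pi}) (\<lambda>p. W (fst p) (snd p))"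
      using B by (simp add: case_prod_unfold)
    have cE1: "continuous_on {0..1} E" unfolding E_def
      by (rule integral_continuous_on_param) (use pW1 in \<open>auto simp: case_prod_unfold intro!: continuous_intros\<close>)
    have "E r0 \<le> E 1"
    proof (rule nondecreasing_from_deriv[of r0 1 E "\<lambda>r. 2 * (1 + n * r\<^sup>2) / r * F r"])
      show "continuous_on {r0..1} E" using r0 by (auto intro: continuous_on_subset[OF cE1])
      show "(E has_real_derivative 2 * (1 + n * r\<^sup>2) / r * F r) (at r)" if "r0 < r" "r < 1" for r
        using dE[of r] that r0 by simp
      show "0 \<le> 2 * (1 + n * r\<^sup>2) / r * F r" if "r0 < r" "r < 1" for r
        using Fpos[of r] that r0 n by simp
    qed (use r0 in auto)
    also have "E 1 = integral ?I (\<lambda>t. 0)"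
      unfolding E_def by (rule integral_cong) (use B in auto)
    finally show ?thesis using E0[of r0] by simp
  next
    assume B: "continuous_on ({0..1} \<times> {0..2*pi}) (\<lambda>(r, t). W r t * G r t) \<and> (\<forall>t\<in>{0..2*pi}. G 1 t = 0)"
    have cF1: "continuous_on {0..1} F" unfolding F_def
      by (rule integral_continuous_on_param) (use B in \<open>auto simp: case_prod_unfold\<close>)
    have "F 1 = integral ?I (\<lambda>t. 0)"
      unfolding F_def by (rule integral_cong) (use B in auto)
    then have F1: "F 1 = 0" by simp
    have "F r = 0" if "r \<in> {0<..<1}" for r
    proof -
      have "F r \<le> F 1"
      proof (rule nondecreasing_from_deriv[of r 1 F F'])
        show "continuous_on {r..1} F" using that by (auto intro: continuous_on_subset[OF cF1])
      qed (use that dF F'0 in auto)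
      then show ?thesis using F1 Fpos[of r] that by simp
    qed
    \<comment> \<open>Here the vanishing of \<open>F\<close> on the whole interval is passed to its
      derivative, which dominates \<open>r0 * (c * E r0)\<close>.\<close>
    then have "(F has_real_derivative 0) (at r0)"
      using has_field_derivative_transform_within_open[of "\<lambda>_. 0" 0 r0 "{0<..<1}" F] r0 by auto
    then have "F' r0 = 0" using dF[OF r0] DERIV_unique by blast
    then have "r0 * (c * E r0) \<le> 0" using F'_ge[OF r0] by simp
    then show ?thesis using r0 c E0[of r0] by (simp add: mult_le_0_iff)
  qed
  have "continuous_on {0..2*pi} (\<lambda>t. (W r0 t)\<^sup>2)"
    by (intro continuous_intros sW) (use r0 in auto)
  from integral_eq_0_iff[OF this] E_zero t0 show ?thesis
    by (simp add: E_def)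
qed

section \<open>Eigenspaces\<close>

lemma conormal_cigar:
  assumes n: "n \<ge> 0" and x: "norm x = 1"
  shows "conormal_derivative (cigar n) u x = (x $ 1 * pd 1 u x + x $ 2 * pd 2 u x) / (1 + n)"
proof -
  have s: "x \<bullet> x = 1" using x by (simp add: norm_eq_1)
  then have s2: "x $ 1 * x $ 1 + x $ 2 * x $ 2 = 1" by (simp add: inner_2)
  have q: "1 + n \<noteq> 0" using n by simp
  have "(cigar_inv n x *v x) $ i = ((1 + n) - (n + n / (1 + n)) * (x $ 1 * x $ 1 + x $ 2 * x $ 2)) * x $ i" for i
    using exhaust_2[of i] by (auto simp: matrix_vector_mult_def cigar_inv_def sum_2 s algebra_simps)
  then have "(cigar_inv n x *v x) $ i = x $ i / (1 + n)" for i
    using q by (simp add: s2 field_simps)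
  then show ?thesis
    by (simp add: conormal_derivative_def matrix_inv_cigar[OF n] sum_2 add_divide_distrib)
qed

text \<open>The last conclusion is what the energy estimate needs from the boundary. A Dirichlet
  eigenfunction may have no derivative there, so its flux need not extend; a Neumann eigenfunction
  has a continuous flux up to the boundary, vanishing on it.\<close>

lemma eigenspace_polar:
  assumes n: "n \<ge> 0" and u: "u \<in> eigenspace bc (cigar n) \<gamma>"
  shows "\<exists>Wt Wtt. polar_sol n \<gamma> (\<lambda>r t. u (pt r t)) (polG n u) Wt Wtt"
    and "continuous_on closed_disc u"
    and "(\<forall>t. u (pt 1 t) = 0) \<or> (continuous_on ({0..1} \<times> UNIV) (\<lambda>(r, t). polG n u r t) \<and> (\<forall>t. polG n u 1 t = 0))"
proof -
  have u': "Ck_on 2 disc u" "\<And>x. x \<in> disc \<Longrightarrow> laplace_beltrami (cigar n) u x + \<gamma> * u x = 0" "satisfies_bc bc (cigar n) u"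
    using u by (auto simp: eigenspace_def)
  show "\<exists>Wt Wtt. polar_sol n \<gamma> (\<lambda>r t. u (pt r t)) (polG n u) Wt Wtt"
    by (rule polar_sol_of_eigen[OF n u'(1,2)])
  have "continuous_on closed_disc u \<and> ((\<forall>t. u (pt 1 t) = 0) \<or>
    (continuous_on ({0..1} \<times> UNIV) (\<lambda>(r, t). polG n u r t) \<and> (\<forall>t. polG n u 1 t = 0)))"
  proof (cases bc)
    case Dirichlet
    then show ?thesis using u'(3) by simp
  next
    case Neumann
    then have N: "u differentiable_on closed_disc" "\<And>i. continuous_on closed_disc (pd i u)"
      "\<And>x. norm x = 1 \<Longrightarrow> conormal_derivative (cigar n) u x = 0"
      using u'(3) by auto
    have "continuous_on ({0..1} \<times> UNIV) (\<lambda>(r, t). polG n u r t)"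
      unfolding polG_def
      by (rule polar_continuous[of closed_disc], intro continuous_intros N)
        (use one_plus_pos[OF n] in \<open>auto simp: less_imp_neq[symmetric] intro!: less_imp_neq[symmetric]\<close>)
    moreover have "polG n u 1 t = 0" for t
      using N(3)[of "pt 1 t"] n by (simp add: conormal_cigar[OF n] polG_def)
    ultimately show ?thesis using N(1) differentiable_imp_continuous_on by blast
  qed
  then show "continuous_on closed_disc u"
    "(\<forall>t. u (pt 1 t) = 0) \<or> (continuous_on ({0..1} \<times> UNIV) (\<lambda>(r, t). polG n u r t) \<and> (\<forall>t. polG n u 1 t = 0))"
    by auto
qed

text \<open>The difference is nonnegative where \<open>f\<close> is maximal and nonpositive where
  \<open>f\<close> is minimal, so it vanishes in between. Periodicity enters only as the statement
  that every value is attained on \<open>{0..2*pi}\<close>.\<close>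

lemma shift_coincidence:
  fixes f :: "real \<Rightarrow> real"
  assumes c: "continuous_on UNIV f" and per: "\<And>t. \<exists>t'\<in>{0..2*pi}. f t = f t'"
  shows "\<exists>z\<in>{0..2*pi}. f z - f (z + \<alpha>) = 0"
proof -
  define d where "d = (\<lambda>z. f z - f (z + \<alpha>))"
  have cd: "continuous_on A d" for A
    unfolding d_def by (intro continuous_intros continuous_on_compose2[OF c]) auto
  have cf: "continuous_on {0..2*pi} f" using c continuous_on_subset by blast
  obtain a where a: "a \<in> {0..2*pi}" "\<And>t. t \<in> {0..2*pi} \<Longrightarrow> f t \<le> f a"
    using continuous_attains_sup[OF _ _ cf] by auto
  obtain b where b: "b \<in> {0..2*pi}" "\<And>t. t \<in> {0..2*pi} \<Longrightarrow> f b \<le> f t"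
    using continuous_attains_inf[OF _ _ cf] by auto
  have ab: "d a \<ge> 0" "d b \<le> 0"
    using a(2) b(2) per[of "a + \<alpha>"] per[of "b + \<alpha>"] by (auto simp: d_def)
  have "\<exists>z. z \<in> {0..2*pi} \<and> d z = 0"
  proof (cases "a \<le> b")
    case True
    then obtain z where "a \<le> z" "z \<le> b" "d z = 0"
      using IVT2'[of d b 0 a] ab cd by blast
    then show ?thesis using a(1) b(1) by (intro exI[of _ z]) auto
  next
    case False
    then obtain z where "b \<le> z" "z \<le> a" "d z = 0"
      using IVT'[of d b 0 a] ab cd by (metis linear)
    then show ?thesis using a(1) b(1) by (intro exI[of _ z]) auto
  qed
  then show ?thesis by (auto simp: d_def)
qed

lemma eigenfunction_radial:
  assumes n: "n > 0" and \<gamma>: "\<gamma> < n / (16 * pi\<^sup>2)" and u: "u \<in> eigenspace bc (cigar n) \<gamma>"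
    and r: "r \<in> {0<..<1}"
  shows "u (pt r t) = u (pt r 0)"
proof -
  have n0: "n \<ge> 0" using n by simp
  obtain Wt Wtt where P: "polar_sol n \<gamma> (\<lambda>r t. u (pt r t)) (polG n u) Wt Wtt"
    using eigenspace_polar(1)[OF n0 u] by blast
  let ?W = "\<lambda>r s. u (pt r s) - u (pt r (s + t))"
  let ?G = "\<lambda>r s. polG n u r s - polG n u r (s + t)"
  let ?Wt = "\<lambda>r s. Wt r s - Wt r (s + t)"
  note P' = polar_sol_shift_diff[OF P, of t]
  have cu: "continuous_on S (\<lambda>p. u (pt (fst p) (snd p)))" if "S \<subseteq> {0..1} \<times> UNIV" for S
    by (rule continuous_on_compose2[OF eigenspace_polar(2)[OF n0 u] pt_continuous]) (use that in auto)
  have cu2: "continuous_on S (\<lambda>p. u (pt (fst p) (snd p + t)))" if "S \<subseteq> {0..1} \<times> UNIV" for S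
  proof -
    have "continuous_on S (\<lambda>p. (fst p, snd p + t))" by (intro continuous_intros)
    moreover have "(\<lambda>p. (fst p, snd p + t)) ` S \<subseteq> {0..1} \<times> UNIV" using that by force
    ultimately show ?thesis using continuous_on_compose2[OF cu[OF order_refl]] by fastforce
  qed
  \<comment> \<open>The coercivity constant is the distance of \<gamma> from the threshold: the
    Poincare inequality bounds \<open>n\<close> times the integral of \<open>Wt\<^sup>2\<close> from
    below by \<open>n / (16 * pi\<^sup>2)\<close> times that of \<open>W\<^sup>2\<close>.\<close>
  have "?W r 0 = 0"
  proof (rule polar_energy_zero[OF n0 P', of "n / (16 * pi\<^sup>2) - \<gamma>"])
    show "0 < n / (16 * pi\<^sup>2) - \<gamma>" using \<gamma> by simp
    show "(continuous_on ({0..1} \<times> {0..2*pi}) (\<lambda>(r, t). ?W r t) \<and> (\<forall>t\<in>{0..2*pi}. ?W 1 t = 0)) \<or>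
      (continuous_on ({0..1} \<times> {0..2*pi}) (\<lambda>(r, t). ?W r t * ?G r t) \<and> (\<forall>t\<in>{0..2*pi}. ?G 1 t = 0))"
      using eigenspace_polar(3)[OF n0 u]
    proof
      assume "\<forall>t. u (pt 1 t) = 0"
      then show ?thesis
        unfolding case_prod_unfold by (intro disjI1 conjI continuous_intros cu cu2) auto
    next
      assume N: "continuous_on ({0..1} \<times> UNIV) (\<lambda>(r, t). polG n u r t) \<and> (\<forall>t. polG n u 1 t = 0)"
      then have c: "continuous_on S (\<lambda>p. polG n u (fst p) (snd p))" if "S \<subseteq> {0..1} \<times> UNIV" for S
        using continuous_on_subset[OF _ that] by (auto simp: case_prod_unfold)
      have c2: "continuous_on S (\<lambda>p. polG n u (fst p) (snd p + t))" if "S \<subseteq> {0..1} \<times> UNIV" for S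
      proof -
        have "continuous_on S (\<lambda>p. (fst p, snd p + t))" by (intro continuous_intros)
        moreover have "(\<lambda>p. (fst p, snd p + t)) ` S \<subseteq> {0..1} \<times> UNIV" using that by force
        ultimately show ?thesis using continuous_on_compose2[OF c[OF order_refl]] by fastforce
      qed
      show ?thesis
        unfolding case_prod_unfold by (intro disjI2 conjI continuous_intros cu cu2 c c2) (use N in auto)
    qed
    fix r :: real assume r: "r \<in> {0<..<1}"
    have D: "((\<lambda>s. ?W r s) has_real_derivative ?Wt r s) (at s)" for s
      using P'[unfolded polar_sol_def, THEN conjunct1, rule_format, OF r, of s] by blast
    have cWt: "continuous_on UNIV (?Wt r)"
    proof -
      have "continuous_on UNIV ((\<lambda>(r, s). ?Wt r s) \<circ> (\<lambda>s. (r, s)))"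
        using P' r unfolding polar_sol_def
        by (intro continuous_on_compose continuous_intros) (auto elim!: continuous_on_subset)
      then show ?thesis by (simp add: o_def)
    qed
    have cU: "continuous_on UNIV (\<lambda>s. u (pt r s))"
    proof -
      have "continuous_on UNIV ((\<lambda>p. u (pt (fst p) (snd p))) \<circ> (\<lambda>s. (r, s)))"
        using r by (intro continuous_on_compose continuous_intros cu) auto
      then show ?thesis by (simp add: o_def)
    qed
    have "\<exists>s'\<in>{0..2*pi}. u (pt r s) = u (pt r s')" for s
    proof -
      obtain s' where "0 \<le> s'" "s' < 2 * pi" "pt r s = pt (norm (pt r s)) s'" using pt_surj .
      then show ?thesis using r by (intro bexI[of _ s']) auto
    qed
    from shift_coincidence[OF cU this, of t] obtain z where "z \<in> {0..2*pi}" "?W r z = 0" by blast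
    from circle_poincare[OF D cWt this]
    have "n / (16 * pi\<^sup>2) * integral {0..2*pi} (\<lambda>s. (?W r s)\<^sup>2)
        \<le> n / (16 * pi\<^sup>2) * (16 * pi\<^sup>2 * integral {0..2*pi} (\<lambda>s. (?Wt r s)\<^sup>2))"
      using n by (intro mult_left_mono) auto
    then have "n / (16 * pi\<^sup>2) * integral {0..2*pi} (\<lambda>s. (?W r s)\<^sup>2) \<le> n * integral {0..2*pi} (\<lambda>s. (?Wt r s)\<^sup>2)"
      by simp
    moreover have "integral {0..2*pi} (\<lambda>s. n * (?Wt r s)\<^sup>2 - \<gamma> * (?W r s)\<^sup>2)
      = n * integral {0..2*pi} (\<lambda>s. (?Wt r s)\<^sup>2) - \<gamma> * integral {0..2*pi} (\<lambda>s. (?W r s)\<^sup>2)"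
    proof -
      have "(\<lambda>s. (?Wt r s)\<^sup>2) integrable_on {0..2*pi}" 
        by (intro integrable_continuous_real continuous_intros continuous_on_subset[OF cWt]) auto
      moreover have "continuous_on UNIV (?W r)"
        using D by (auto intro!: continuous_at_imp_continuous_on DERIV_continuous)
      then have "(\<lambda>s. (?W r s)\<^sup>2) integrable_on {0..2*pi}" 
        by (intro integrable_continuous_real continuous_on_power) (rule continuous_on_subset, auto)
      ultimately show ?thesis
        by (subst integral_diff) (auto intro: integrable_on_mult_right)
    qed
    ultimately show "(n / (16 * pi\<^sup>2) - \<gamma>) * integral {0..2*pi} (\<lambda>s. (?W r s)\<^sup>2)
      \<le> integral {0..2*pi} (\<lambda>s. n * (?Wt r s)\<^sup>2 - \<gamma> * (?W r s)\<^sup>2)"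
      by (simp add: left_diff_distrib)
  qed (use r in auto)
  then show ?thesis by simp
qed

text \<open>For negative \<gamma> the term \<open>- \<gamma> * u\<^sup>2\<close> is itself coercive,
  so no rotation has to be subtracted. Negative values must be excluded because the counts in
  \<open>nth_eigenvalue\<close> range over all real numbers below the given one.\<close>

lemma eigenfunction_neg_zero:
  assumes n: "n > 0" and \<gamma>: "\<gamma> < 0" and u: "u \<in> eigenspace bc (cigar n) \<gamma>"
    and r: "r \<in> {0<..<1}" and t: "t \<in> {0..2*pi}"
  shows "u (pt r t) = 0"
proof -
  have n0: "n \<ge> 0" using n by simp
  obtain Wt Wtt where P: "polar_sol n \<gamma> (\<lambda>r t. u (pt r t)) (polG n u) Wt Wtt"
    using eigenspace_polar(1)[OF n0 u] by blast
  have cu: "continuous_on S (\<lambda>p. u (pt (fst p) (snd p)))" if "S \<subseteq> {0..1} \<times> UNIV" for S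
    by (rule continuous_on_compose2[OF eigenspace_polar(2)[OF n0 u] pt_continuous]) (use that in auto)
  show ?thesis
  proof (rule polar_energy_zero[OF n0 P, of "- \<gamma>"])
    show "(continuous_on ({0..1} \<times> {0..2*pi}) (\<lambda>(r, t). u (pt r t)) \<and> (\<forall>t\<in>{0..2*pi}. u (pt 1 t) = 0)) \<or>
      (continuous_on ({0..1} \<times> {0..2*pi}) (\<lambda>(r, t). u (pt r t) * polG n u r t) \<and> (\<forall>t\<in>{0..2*pi}. polG n u 1 t = 0))"
      using eigenspace_polar(3)[OF n0 u]
    proof
      assume "\<forall>t. u (pt 1 t) = 0"
      then show ?thesis
        unfolding case_prod_unfold by (intro disjI1 conjI continuous_intros cu) auto
    next
      assume N: "continuous_on ({0..1} \<times> UNIV) (\<lambda>(r, t). polG n u r t) \<and> (\<forall>t. polG n u 1 t = 0)"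
      then have c: "continuous_on S (\<lambda>p. polG n u (fst p) (snd p))" if "S \<subseteq> {0..1} \<times> UNIV" for S
        using continuous_on_subset[OF _ that] by (auto simp: case_prod_unfold)
      show ?thesis
        unfolding case_prod_unfold by (intro disjI2 conjI continuous_intros cu c) (use N in auto)
    qed
    fix r :: real assume r: "r \<in> {0<..<1}"
    have cWt: "continuous_on UNIV (Wt r)"
    proof -
      have "continuous_on UNIV ((\<lambda>(r, s). Wt r s) \<circ> (\<lambda>s. (r, s)))"
        using P r unfolding polar_sol_def
        by (intro continuous_on_compose continuous_intros) (auto elim!: continuous_on_subset)
      then show ?thesis by (simp add: o_def)
    qed
    have cU: "continuous_on UNIV (\<lambda>s. u (pt r s))"
    proof -
      have "continuous_on UNIV ((\<lambda>p. u (pt (fst p) (snd p))) \<circ> (\<lambda>s. (r, s)))"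
        using r by (intro continuous_on_compose continuous_intros cu) auto
      then show ?thesis by (simp add: o_def)
    qed
    have "integral {0..2*pi} (\<lambda>s. - \<gamma> * (u (pt r s))\<^sup>2)
      \<le> integral {0..2*pi} (\<lambda>s. n * (Wt r s)\<^sup>2 - \<gamma> * (u (pt r s))\<^sup>2)"
      by (rule integral_le; (intro integrable_continuous_real continuous_intros continuous_on_subset[OF cWt]
            continuous_on_subset[OF cU])?) (use n in auto)
    then show "- \<gamma> * integral {0..2*pi} (\<lambda>s. (u (pt r s))\<^sup>2)
      \<le> integral {0..2*pi} (\<lambda>s. n * (Wt r s)\<^sup>2 - \<gamma> * (u (pt r s))\<^sup>2)"
      by simp
  qed (use \<gamma> r t in auto)
qed

text \<open>Uniqueness across the singular point \<open>r = 0\<close>, by a Gronwall estimate for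
  \<open>Z\<^sup>2 + (H / r)\<^sup>2\<close>.\<close>

lemma radial_ode_unique:
  fixes Z H :: "real \<Rightarrow> real"
  assumes n: "n \<ge> 0"
    and c: "continuous_on {0..<1} Z" "continuous_on {0..<1} H" and z: "Z 0 = 0" "H 0 = 0"
    and dZ: "\<And>r. r \<in> {0<..<1} \<Longrightarrow> (Z has_real_derivative (1 + n * r\<^sup>2) / r * H r) (at r)"
    and dH: "\<And>r. r \<in> {0<..<1} \<Longrightarrow> (H has_real_derivative - r * (\<gamma> * Z r)) (at r)"
    and r1: "r1 \<in> {0<..<1}"
  shows "Z r1 = 0"
proof -
  have cZ: "continuous_on {0..r1} Z" and cH: "continuous_on {0..r1} H"
    using c r1 by (auto elim!: continuous_on_subset)
  obtain B where B: "\<And>r. r \<in> {0..r1} \<Longrightarrow> \<bar>Z r\<bar> \<le> B"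
  proof -
    have "\<exists>x\<in>{0..r1}. \<forall>y\<in>{0..r1}. \<bar>Z y\<bar> \<le> \<bar>Z x\<bar>"
      using r1 by (intro continuous_attains_sup continuous_intros cZ) auto
    then show thesis using that by blast
  qed
  have B0: "B \<ge> 0" using B[of 0] r1 by simp
  define C where "C = 1 + n + \<bar>\<gamma>\<bar>"
  define e where "e = (\<lambda>r. (Z r)\<^sup>2 + (H r / r)\<^sup>2)"
  have step: "e r1 \<le> exp C * ((Z \<epsilon>)\<^sup>2 + (\<epsilon> * \<bar>\<gamma>\<bar> * B)\<^sup>2)" if \<epsilon>: "\<epsilon> \<in> {0<..<r1}" for \<epsilon>
  proof -
    \<comment> \<open>The singular term \<open>- 2 * (H r / r)\<^sup>2 / r\<close> in the derivative
      of \<open>e\<close> has the favourable sign; the remaining term is at most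
      \<open>C * e r\<close>.\<close>
    let ?g = "\<lambda>r. - (exp (- C * r) * e r)"
    let ?g' = "\<lambda>r. exp (- C * r) * (C * e r - (2 * (1 + n * r\<^sup>2 - \<gamma>) * (Z r * (H r / r)) - 2 * (H r / r)\<^sup>2 / r))"
    have dg: "(?g has_real_derivative ?g' r) (at r)" if r: "r \<in> {0<..<1}" for r
    proof -
      have "((\<lambda>r. H r / r) has_real_derivative (- r * (\<gamma> * Z r) * r - H r * 1) / (r * r)) (at r)"
        by (rule DERIV_divide[OF dH[OF r] DERIV_ident]) (use r in auto)
      then have dk: "((\<lambda>r. H r / r) has_real_derivative - \<gamma> * Z r - (H r / r) / r) (at r)"
        using r by (simp add: field_simps)
      have dZ': "(Z has_real_derivative (1 + n * r\<^sup>2) * (H r / r)) (at r)"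
        using dZ[OF r] by simp
      define k where "k = (\<lambda>r. H r / r)"
      have dk': "(k has_real_derivative - \<gamma> * Z r - k r / r) (at r)"
        and dZk: "(Z has_real_derivative (1 + n * r\<^sup>2) * k r) (at r)"
        using dk dZ' by (simp_all add: k_def)
      have "((\<lambda>r. - (exp (- C * r) * ((Z r)\<^sup>2 + (k r)\<^sup>2))) has_real_derivative
        exp (- C * r) * (C * ((Z r)\<^sup>2 + (k r)\<^sup>2) - (2 * (1 + n * r\<^sup>2 - \<gamma>) * (Z r * k r) - 2 * (k r)\<^sup>2 / r))) (at r)"
        by (rule derivative_eq_intros dk' dZk refl)+ (simp add: algebra_simps power2_eq_square)
      then show ?thesis by (simp add: e_def k_def)
    qed
    have g'0: "?g' r \<ge> 0" if r: "r \<in> {0<..<1}" for r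
    proof -
      let ?k = "H r / r"
      have "n * r\<^sup>2 \<le> n * 1" using r n by (intro mult_left_mono) (auto simp: power_le_one)
      moreover have "0 \<le> n * r\<^sup>2" using n by simp
      ultimately have "\<bar>1 + n * r\<^sup>2 - \<gamma>\<bar> \<le> C" unfolding C_def by linarith
      moreover have "2 * \<bar>Z r * ?k\<bar> \<le> e r"
      proof -
        have "0 \<le> (Z r - ?k)\<^sup>2" "0 \<le> (Z r + ?k)\<^sup>2" by auto
        then show ?thesis unfolding e_def abs_if by (simp add: power2_eq_square algebra_simps split: if_splits)
      qed
      ultimately have "\<bar>1 + n * r\<^sup>2 - \<gamma>\<bar> * (2 * \<bar>Z r * ?k\<bar>) \<le> C * e r"
        by (intro mult_mono) auto
      moreover have "2 * p * q \<le> \<bar>p\<bar> * (2 * \<bar>q\<bar>)" for p q :: real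
        using abs_ge_self[of "p * q"] by (simp add: abs_mult)
      ultimately have "2 * (1 + n * r\<^sup>2 - \<gamma>) * (Z r * ?k) \<le> C * e r"
        using order_trans by blast
      moreover have "2 * ?k\<^sup>2 / r \<ge> 0" using r by simp
      ultimately show ?thesis by simp
    qed
    have "?g \<epsilon> \<le> ?g r1"
    proof (rule DERIV_nonneg_imp_nondecreasing[where f = ?g and a = \<epsilon> and b = r1])
      show "\<epsilon> \<le> r1" using \<epsilon> by simp
      show "\<exists>y. (?g has_real_derivative y) (at x) \<and> 0 \<le> y" if "\<epsilon> \<le> x" "x \<le> r1" for x
        using dg[of x] g'0[of x] that \<epsilon> r1 by (intro exI[of _ "?g' x"]) auto
    qed
    then have "exp (- C * r1) * e r1 \<le> exp (- C * \<epsilon>) * e \<epsilon>" by simp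
    also have "\<dots> \<le> 1 * e \<epsilon>"
    proof (rule mult_right_mono)
      have "C \<ge> 0" using n by (simp add: C_def)
      then show "exp (- C * \<epsilon>) \<le> 1" using \<epsilon> by simp
    qed (simp add: e_def)
    finally have "exp (C * r1) * (exp (- C * r1) * e r1) \<le> exp (C * r1) * e \<epsilon>" by simp
    then have "e r1 \<le> exp (C * r1) * e \<epsilon>" by (simp add: mult.assoc[symmetric] exp_add[symmetric])
    also have "\<dots> \<le> exp C * e \<epsilon>"
    proof (rule mult_right_mono)
      have "C \<ge> 0" using n by (simp add: C_def)
      then have "C * r1 \<le> C * 1" using r1 by (intro mult_left_mono) auto
      then show "exp (C * r1) \<le> exp C" by simp
    qed (simp add: e_def)
    \<comment> \<open>By the mean value theorem \<open>H \<epsilon> / \<epsilon>\<close> is of order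
      \<epsilon>, so the starting value of the estimate tends to 0 with \<epsilon>.\<close>
    also have "\<dots> \<le> exp C * ((Z \<epsilon>)\<^sup>2 + (\<epsilon> * \<bar>\<gamma>\<bar> * B)\<^sup>2)"
    proof -
      have "continuous_on {0..\<epsilon>} H" by (rule continuous_on_subset[OF cH]) (use \<epsilon> in auto)
      moreover have "(H has_derivative (*) (- x * (\<gamma> * Z x))) (at x)" if "0 < x" "x < \<epsilon>" for x
        using dH[of x] that \<epsilon> r1 by (simp add: has_field_derivative_def)
      ultimately obtain y where y: "0 < y" "y < \<epsilon>" "H \<epsilon> - H 0 = - y * (\<gamma> * Z y) * (\<epsilon> - 0)"
        using mvt[of 0 \<epsilon> H "\<lambda>r. (*) (- r * (\<gamma> * Z r))"] \<epsilon> by auto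
      have "\<bar>H \<epsilon> / \<epsilon>\<bar> = y * \<bar>\<gamma>\<bar> * \<bar>Z y\<bar>" using y z \<epsilon> by (simp add: abs_mult)
      also have "\<dots> \<le> \<epsilon> * \<bar>\<gamma>\<bar> * B"
        using y \<epsilon> B[of y] B0 by (intro mult_mono) auto
      finally have "(H \<epsilon> / \<epsilon>)\<^sup>2 \<le> (\<epsilon> * \<bar>\<gamma>\<bar> * B)\<^sup>2"
        by (metis abs_ge_zero power2_abs power_mono)
      then show ?thesis unfolding e_def by (intro mult_left_mono) auto
    qed
    finally show ?thesis .
  qed
  have "((\<lambda>\<epsilon>. exp C * ((Z \<epsilon>)\<^sup>2 + (\<epsilon> * \<bar>\<gamma>\<bar> * B)\<^sup>2)) \<longlongrightarrow> exp C * ((Z 0)\<^sup>2 + (0 * \<bar>\<gamma>\<bar> * B)\<^sup>2)) (at 0 within {0..r1})"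
    using cZ r1 by (intro tendsto_intros) (auto simp: continuous_on_def)
  then have lim: "((\<lambda>\<epsilon>. exp C * ((Z \<epsilon>)\<^sup>2 + (\<epsilon> * \<bar>\<gamma>\<bar> * B)\<^sup>2)) \<longlongrightarrow> 0) (at 0 within {0..r1})"
    using z by simp
  have "e r1 \<le> 0"
  proof (rule tendsto_lowerbound[OF lim])
    show "\<forall>\<^sub>F \<epsilon> in at 0 within {0..r1}. e r1 \<le> exp C * ((Z \<epsilon>)\<^sup>2 + (\<epsilon> * \<bar>\<gamma>\<bar> * B)\<^sup>2)"
      using step r1 unfolding eventually_at
      by (intro exI[of _ r1]) (auto simp: dist_real_def)
    show "at 0 within {0..r1} \<noteq> bot"
      using r1 by (simp add: trivial_limit_within islimpt_Icc)
  qed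
  then show ?thesis unfolding e_def
    by (metis add_nonneg_eq_0_iff antisym zero_eq_power2 zero_le_power2 add_nonneg_nonneg)
qed

section \<open>Radial eigenfunctions and the eigenspaces below the threshold\<close>

definition dvs :: "real \<Rightarrow> real \<Rightarrow> real \<Rightarrow> real" where
  "dvs n \<nu> s = - \<nu>\<^sup>2 * (ysol n \<nu> s + Ysol n \<nu> s / n)"

definition ddvs :: "real \<Rightarrow> real \<Rightarrow> real \<Rightarrow> real" where
  "ddvs n \<nu> s = (\<Sum>k. (diffs ^^ 3) (sol_coeff n \<nu>) k * s ^ k)"

lemma vsol_dvs: "n > 0 \<Longrightarrow> (vsol n \<nu> has_real_derivative dvs n \<nu> s) (at s)"
  unfolding dvs_def by (rule vsol_deriv)

lemma dvs_ddvs: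
  assumes "n > 0"
  shows "(dvs n \<nu> has_real_derivative ddvs n \<nu> s) (at s)"
proof -
  have "dvs n \<nu> = (\<lambda>s. \<Sum>k. (diffs ^^ Suc 1) (sol_coeff n \<nu>) k * s ^ k)"
  proof
    fix s
    have "(vsol n \<nu> has_real_derivative (\<Sum>k. (diffs ^^ Suc 1) (sol_coeff n \<nu>) k * s ^ k)) (at s)"
      using sol_family_deriv[OF assms, of 1 \<nu> s] by (simp add: vsol_def[abs_def])
    then show "dvs n \<nu> s = (\<Sum>k. (diffs ^^ Suc 1) (sol_coeff n \<nu>) k * s ^ k)"
      using vsol_dvs[OF assms] DERIV_unique by blast
  qed
  then show ?thesis
    using sol_family_deriv[OF assms, of "Suc 1" \<nu> s] by (simp add: ddvs_def numeral_3_eq_3)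
qed

lemma dvs_rel: "n > 0 \<Longrightarrow> n * s * dvs n \<nu> s = - \<nu>\<^sup>2 * (n * s + 1) * ysol n \<nu> s"
  by (simp add: dvs_def ysol_Ysol field_simps)

text \<open>The derivative of the identity \<open>dvs_rel\<close>. Both are free of denominators, so
  the eigenvalue equation can be verified from them algebraically, at the origin as well.\<close>

lemma ddvs_rel:
  assumes n: "n > 0"
  shows "n * dvs n \<nu> s + n * s * ddvs n \<nu> s = - \<nu>\<^sup>2 * (n * ysol n \<nu> s + (n * s + 1) * vsol n \<nu> s)"
proof -
  have "((\<lambda>s. n * s * dvs n \<nu> s) has_real_derivative n * dvs n \<nu> s + n * s * ddvs n \<nu> s) (at s)"
    by (auto intro!: derivative_eq_intros dvs_ddvs[OF n])
  moreover have "((\<lambda>s. - \<nu>\<^sup>2 * (n * s + 1) * ysol n \<nu> s) has_real_derivative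
      - \<nu>\<^sup>2 * (n * ysol n \<nu> s + (n * s + 1) * vsol n \<nu> s)) (at s)"
    by (rule derivative_eq_intros ysol_deriv[OF n] refl)+ (simp add: algebra_simps)
  ultimately show ?thesis
    using DERIV_unique by (simp only: dvs_rel[OF n])
qed

text \<open>The extension by zero matches the convention in \<open>eigenspace\<close>. Since
  \<open>vsol n \<nu> 0 = 1\<close>, the factor \<open>c\<close> is the value at the origin.\<close>

definition usol :: "real \<Rightarrow> real \<Rightarrow> real \<Rightarrow> real^2 \<Rightarrow> real" where
  "usol n \<nu> c x = (if x \<in> closed_disc then c * vsol n \<nu> (x \<bullet> x) else 0)"

text \<open>The normal derivative of a radial solution is proportional to
  \<open>\<nu>\<^sup>2 * ysol n \<nu> 1\<close>. The factor \<nu> keeps the constant Neumann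
  eigenfunction at \<open>\<nu> = 0\<close>, where \<open>ysol n 0 1\<close> is 1.\<close>

definition radial_bc :: "boundary_condition \<Rightarrow> real \<Rightarrow> real \<Rightarrow> bool" where
  "radial_bc bc n \<nu> \<longleftrightarrow> (case bc of Dirichlet \<Rightarrow> vsol n \<nu> 1 = 0 | Neumann \<Rightarrow> \<nu> * ysol n \<nu> 1 = 0)"

lemma usol_Ck:
  assumes n: "n > 0" and S: "fat S" "S \<subseteq> closed_disc"
  shows "Ck_on k S (usol n \<nu> c)"
proof -
  have "(\<lambda>x. c * vsol n \<nu> (x \<bullet> x)) \<in> radalg (sol_family n \<nu>)"
    by (intro radalg.times radalg.const radalg.rad vsol_in_family)
  then have "Ck_on k S (\<lambda>x. c * vsol n \<nu> (x \<bullet> x))"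
    by (rule radalg_Ck[OF deriv_closed_sol_family[OF n] S(1)])
  moreover have "Ck_on k S (usol n \<nu> c) \<longleftrightarrow> Ck_on k S (\<lambda>x. c * vsol n \<nu> (x \<bullet> x))"
    by (rule Ck_on_cong) (use S(2) in \<open>auto simp: usol_def subset_iff\<close>)
  ultimately show ?thesis by simp
qed

lemma pd_usol:
  assumes n: "n > 0" and x: "x \<in> closed_disc"
  shows "pd i (usol n \<nu> c) x = c * (dvs n \<nu> (x \<bullet> x) * (2 * x $ i))"
proof -
  have "((\<lambda>x. vsol n \<nu> (x \<bullet> x)) has_derivative (\<lambda>h. dvs n \<nu> (x \<bullet> x) * (2 * (x \<bullet> h)))) (at x within closed_disc)"
    by (rule radial_has_derivative[where \<psi> = "vsol n \<nu>" and \<psi>' = "dvs n \<nu>", OF vsol_dvs[OF n]])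
  then have "((\<lambda>x. c * vsol n \<nu> (x \<bullet> x)) has_derivative (\<lambda>h. c * (dvs n \<nu> (x \<bullet> x) * (2 * (x \<bullet> h))))) (at x within closed_disc)"
    by (intro has_derivative_mult_right)
  from pderiv_within_eq[OF fat_closed_disc x this, of i]
  have "pd i (\<lambda>x. c * vsol n \<nu> (x \<bullet> x)) x = c * (dvs n \<nu> (x \<bullet> x) * (2 * x $ i))"
    by (simp add: inner_axis)
  moreover have "pd i (usol n \<nu> c) x = pd i (\<lambda>x. c * vsol n \<nu> (x \<bullet> x)) x"
    by (rule pderiv_within_cong[OF x]) (simp add: usol_def)
  ultimately show ?thesis by simp
qed

lemma pd_pd_usol:
  assumes n: "n > 0" and x: "x \<in> closed_disc"
  shows "pd j (pd i (usol n \<nu> c)) x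
    = c * (4 * ddvs n \<nu> (x \<bullet> x) * x $ i * x $ j + (if i = j then 2 * dvs n \<nu> (x \<bullet> x) else 0))"
proof -
  have d: "((\<lambda>x. dvs n \<nu> (x \<bullet> x)) has_derivative (\<lambda>h. ddvs n \<nu> (x \<bullet> x) * (2 * (x \<bullet> h)))) (at x within closed_disc)"
    by (rule radial_has_derivative[where \<psi> = "dvs n \<nu>" and \<psi>' = "ddvs n \<nu>", OF dvs_ddvs[OF n]])
  have "((\<lambda>x. c * (dvs n \<nu> (x \<bullet> x) * (2 * x $ i))) has_derivative
      (\<lambda>h. c * (dvs n \<nu> (x \<bullet> x) * (2 * h $ i) + ddvs n \<nu> (x \<bullet> x) * (2 * (x \<bullet> h)) * (2 * x $ i)))) (at x within closed_disc)"
    by (intro has_derivative_mult_right has_derivative_mult d coord_has_derivative)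
  from pderiv_within_eq[OF fat_closed_disc x this, of j]
  have "pd j (\<lambda>x. c * (dvs n \<nu> (x \<bullet> x) * (2 * x $ i))) x
    = c * (4 * ddvs n \<nu> (x \<bullet> x) * x $ i * x $ j + (if i = j then 2 * dvs n \<nu> (x \<bullet> x) else 0))"
    using inner_axis[of x j 1] by (cases "i = j") (auto simp: axis_nth algebra_simps, auto simp: axis_def)
  moreover have "pd j (pd i (usol n \<nu> c)) x = pd j (\<lambda>x. c * (dvs n \<nu> (x \<bullet> x) * (2 * x $ i))) x"
    by (rule pderiv_within_cong[OF x]) (rule pd_usol[OF n])
  ultimately show ?thesis by simp
qed

lemma usol_laplace:
  assumes n: "n > 0" and x: "x \<in> disc"
  shows "laplace_beltrami (cigar n) (usol n \<nu> c) x + 4 * \<nu>\<^sup>2 / n * usol n \<nu> c x = 0"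
proof -
  have n0: "n \<ge> 0" using n by simp
  have xc: "x \<in> closed_disc" using x by simp
  obtain b where b: "b = 1 / (1 + n * (x \<bullet> x))"
    "b + b * n * (x $ 1)\<^sup>2 + b * n * (x $ 2)\<^sup>2 = 1"
    using radial_inverse[OF n0] by metis
  have s: "x \<bullet> x = (x $ 1)\<^sup>2 + (x $ 2)\<^sup>2" by (simp add: inner_2 power2_eq_square)
  have "usol n \<nu> c x = c * vsol n \<nu> (x \<bullet> x)" using xc by (simp add: usol_def)
  moreover have "Ck_on 2 disc (usol n \<nu> c)" by (rule usol_Ck[OF n]) auto
  ultimately have "n * (laplace_beltrami (cigar n) (usol n \<nu> c) x + 4 * \<nu>\<^sup>2 / n * usol n \<nu> c x)
    = n * laplace_beltrami (cigar n) (usol n \<nu> c) x + 4 * \<nu>\<^sup>2 * (c * vsol n \<nu> (x \<bullet> x))"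
    using n by (simp add: distrib_left)
  \<comment> \<open>With \<open>p = s b\<close> and \<open>v = vsol\<close>, the bracket is
    \<open>4 (p v')'\<close> with derivatives in \<open>s\<close>; the derivative of
    \<open>p\<close> is \<open>b\<^sup>2\<close>.\<close>
  also have "n * laplace_beltrami (cigar n) (usol n \<nu> c) x = n * c * (4 * b * (x \<bullet> x) * ddvs n \<nu> (x \<bullet> x) + 4 * b\<^sup>2 * dvs n \<nu> (x \<bullet> x))"
    unfolding laplace_beltrami_cigar[OF n0 \<open>Ck_on 2 disc (usol n \<nu> c)\<close> x b(1)]
      pd_usol[OF n xc] pd_pd_usol[OF n xc]
    using b(2) unfolding s by simp algebra
  also have "\<dots> + 4 * \<nu>\<^sup>2 * (c * vsol n \<nu> (x \<bullet> x)) = 0"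
    using b(2) dvs_rel[OF n, of "x \<bullet> x" \<nu>] ddvs_rel[OF n, of \<nu> "x \<bullet> x"] s by algebra
  finally show ?thesis using n by simp
qed

lemma usol_eigenspace:
  assumes n: "n > 0"
  shows "usol n \<nu> c \<in> eigenspace bc (cigar n) (4 * \<nu>\<^sup>2 / n) \<longleftrightarrow> c = 0 \<or> radial_bc bc n \<nu>"
proof -
  have n0: "n \<ge> 0" using n by simp
  have Ck: "Ck_on k closed_disc (usol n \<nu> c)" "Ck_on k disc (usol n \<nu> c)" for k
    by (auto intro!: usol_Ck n)
  have "usol n \<nu> c \<in> eigenspace bc (cigar n) (4 * \<nu>\<^sup>2 / n) \<longleftrightarrow> satisfies_bc bc (cigar n) (usol n \<nu> c)"
    using Ck(2)[of 2] usol_laplace[OF n] by (auto simp: eigenspace_def usol_def)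
  also have "\<dots> \<longleftrightarrow> c = 0 \<or> radial_bc bc n \<nu>"
  proof (cases bc)
    case Dirichlet
    have "x \<bullet> x = 1" if "x \<in> boundary_circle" for x :: "real^2"
      using that by (simp add: norm_eq_1)
    then have "usol n \<nu> c x = c * vsol n \<nu> 1" if "x \<in> boundary_circle" for x
      using that by (simp add: usol_def)
    moreover have "pt 1 0 \<in> boundary_circle" by simp
    ultimately have "(\<forall>x\<in>boundary_circle. usol n \<nu> c x = 0) \<longleftrightarrow> c * vsol n \<nu> 1 = 0"
      by metis
    then show ?thesis
      using Ck(1)[of 0] Dirichlet by (simp add: radial_bc_def)
  next
    case Neumann
    have co: "conormal_derivative (cigar n) (usol n \<nu> c) x = 2 * c * dvs n \<nu> 1 / (1 + n)" if "norm x = 1" for x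
    proof -
      have s: "x \<bullet> x = 1" using that by (simp add: norm_eq_1)
      then have s2: "x $ 1 * x $ 1 + x $ 2 * x $ 2 = 1" by (simp add: inner_2)
      have "x $ 1 * pd 1 (usol n \<nu> c) x + x $ 2 * pd 2 (usol n \<nu> c) x
        = 2 * c * dvs n \<nu> 1 * (x $ 1 * x $ 1 + x $ 2 * x $ 2)"
        using that by (simp add: pd_usol[OF n] s algebra_simps)
      then show ?thesis by (simp add: conormal_cigar[OF n0 that] s2)
    qed
    have "dvs n \<nu> 1 = 0 \<longleftrightarrow> \<nu> * ysol n \<nu> 1 = 0"
      using dvs_rel[OF n, of 1 \<nu>] n by auto
    moreover have "pt 1 0 \<in> boundary_circle" by simp
    then have "(\<forall>x\<in>boundary_circle. conormal_derivative (cigar n) (usol n \<nu> c) x = 0)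
        \<longleftrightarrow> 2 * c * dvs n \<nu> 1 / (1 + n) = 0"
      using co by (metis mem_sphere_0)
    moreover have "\<dots> \<longleftrightarrow> c = 0 \<or> dvs n \<nu> 1 = 0" using n by auto
    ultimately show ?thesis
      using Ck(1)[of 1] Neumann by (simp add: radial_bc_def)
  qed
  finally show ?thesis .
qed

text \<open>Below the threshold \<open>u\<close> is radial, so \<open>Wtt\<close> vanishes and the
  polar system becomes an ordinary one along a ray. It is also solved by \<open>vsol\<close> with
  flux \<open>- 2 * \<nu>\<^sup>2 / n * ysol\<close>, both taken at \<open>r\<^sup>2\<close>;
  subtracting \<open>u 0\<close> times this pair leaves zero data at the centre.\<close>

lemma eigenspace_subset_usol:
  assumes n: "n > 0" and \<nu>: "4 * \<nu>\<^sup>2 / n < n / (16 * pi\<^sup>2)"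
    and u: "u \<in> eigenspace bc (cigar n) (4 * \<nu>\<^sup>2 / n)"
  shows "u = usol n \<nu> (u 0)"
proof -
  have n0: "n \<ge> 0" using n by simp
  let ?\<gamma> = "4 * \<nu>\<^sup>2 / n"
  obtain Wt Wtt where P: "polar_sol n ?\<gamma> (\<lambda>r t. u (pt r t)) (polG n u) Wt Wtt"
    using eigenspace_polar(1)[OF n0 u] by blast
  note rad = eigenfunction_radial[OF n \<nu> u]
  have Wtt0: "Wtt r 0 = 0" if r: "r \<in> {0<..<1}" for r
  proof -
    note Q = P[unfolded polar_sol_def, THEN conjunct1, rule_format, OF r]
    have "((\<lambda>t. u (pt r t)) has_real_derivative Wt r t) (at t)" for t using Q by blast
    moreover have "((\<lambda>t. u (pt r t)) has_real_derivative 0) (at t)" for t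
      by (subst rad[OF r]) simp
    ultimately have "Wt r = (\<lambda>t. 0)" using DERIV_unique by blast
    moreover have "(Wt r has_real_derivative Wtt r 0) (at 0)" using Q by blast
    ultimately show ?thesis using DERIV_unique DERIV_const by metis
  qed
  have contf: "continuous_on {0..<1} (\<lambda>r. f r 0)" if "continuous_on ({0..<1} \<times> UNIV) (\<lambda>(r, t). f r t)"
    for f :: "real \<Rightarrow> real \<Rightarrow> real"
  proof -
    have "continuous_on {0..<1} ((\<lambda>(r, t). f r t) \<circ> (\<lambda>r. (r, 0)))"
      by (intro continuous_on_compose continuous_intros continuous_on_subset[OF that]) auto
    then show ?thesis by (simp add: o_def)
  qed
  have p0: "pt 0 t = 0" for t by (simp add: pt_eq_iff)
  define Z where "Z = (\<lambda>r. u (pt r 0) - u 0 * vsol n \<nu> (r\<^sup>2))"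
  define H where "H = (\<lambda>r. polG n u r 0 - u 0 * (- 2 * \<nu>\<^sup>2 / n * ysol n \<nu> (r\<^sup>2)))"
  have cv: "continuous_on A (vsol n \<nu>)" "continuous_on A (ysol n \<nu>)" for A
    by (auto intro!: continuous_at_imp_continuous_on DERIV_continuous[OF vsol_deriv[OF n]]
        DERIV_continuous[OF ysol_deriv[OF n]])
  have Z0: "Z r = 0" if r: "r \<in> {0<..<1}" for r
  proof (rule radial_ode_unique[OF n0 _ _ _ _ _ _ r, where H = H and \<gamma> = ?\<gamma>])
    show "continuous_on {0..<1} Z" unfolding Z_def
      by (intro continuous_intros continuous_on_compose2[OF cv(1)] contf[of "\<lambda>r t. u (pt r t)"])
        (use P in \<open>auto simp: polar_sol_def\<close>)
    show "continuous_on {0..<1} H" unfolding H_def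
      by (intro continuous_intros continuous_on_compose2[OF cv(2)] contf[of "polG n u"])
        (use P n in \<open>auto simp: polar_sol_def\<close>)
    show "Z 0 = 0" "H 0 = 0" using P by (auto simp: Z_def H_def p0 polar_sol_def)
    fix r :: real assume r: "r \<in> {0<..<1}"
    note Q = P[unfolded polar_sol_def, THEN conjunct1, rule_format, OF r, of 0]
    have rp: "r > 0" using r by simp
    have sq: "((\<lambda>r. r\<^sup>2) has_real_derivative 2 * r) (at r)" by (auto intro!: derivative_eq_intros)
    have dv: "((\<lambda>r. vsol n \<nu> (r\<^sup>2)) has_real_derivative (1 + n * r\<^sup>2) / r * (- 2 * \<nu>\<^sup>2 / n * ysol n \<nu> (r\<^sup>2))) (at r)"
    proof (rule DERIV_cong[OF DERIV_chain2[OF vsol_deriv_pos[OF n] sq]])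
      show "- \<nu>\<^sup>2 * (1 + 1 / (n * r\<^sup>2)) * ysol n \<nu> (r\<^sup>2) * (2 * r)
        = (1 + n * r\<^sup>2) / r * (- 2 * \<nu>\<^sup>2 / n * ysol n \<nu> (r\<^sup>2))"
        using rp n by (simp add: divide_simps) (simp add: algebra_simps power2_eq_square)
    qed (use rp in simp)
    have dy: "((\<lambda>r. - 2 * \<nu>\<^sup>2 / n * ysol n \<nu> (r\<^sup>2)) has_real_derivative - r * (?\<gamma> * vsol n \<nu> (r\<^sup>2))) (at r)"
      by (rule DERIV_cong[OF DERIV_cmult[OF DERIV_chain2[OF ysol_deriv[OF n] sq]]]) simp
    have dU: "((\<lambda>r. u (pt r 0)) has_real_derivative (1 + n * r\<^sup>2) / r * polG n u r 0) (at r)"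
      and dG: "((\<lambda>r. polG n u r 0) has_real_derivative - r * (?\<gamma> * u (pt r 0))) (at r)"
      using Q Wtt0[OF r] by auto
    show "(Z has_real_derivative (1 + n * r\<^sup>2) / r * H r) (at r)"
      unfolding Z_def H_def
      by (rule DERIV_cong[OF DERIV_diff[OF dU DERIV_cmult[OF dv]]]) (simp only: right_diff_distrib mult.left_commute)
    show "(H has_real_derivative - r * (?\<gamma> * Z r)) (at r)"
      unfolding Z_def H_def
      by (rule DERIV_cong[OF DERIV_diff[OF dG DERIV_cmult[OF dy]]]) (simp only: right_diff_distrib mult.left_commute)
  qed
  have ball: "u x - u 0 * vsol n \<nu> (x \<bullet> x) = 0" if "x \<in> disc" for x
  proof (cases "x = 0")
    case False
    then have r: "norm x \<in> {0<..<1}" using that by simp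
    obtain t where "x = pt (norm x) t" using pt_surj by metis
    then have "u x = u (pt (norm x) 0)" using rad[OF r, of t] by simp
    then show ?thesis using Z0[OF r] by (simp add: Z_def power2_norm_eq_inner)
  qed simp
  have "u x - u 0 * vsol n \<nu> (x \<bullet> x) = 0" if "x \<in> closed_disc" for x
  proof (rule continuous_constant_on_closure[of disc _ 0 x])
    show "continuous_on (closure disc) (\<lambda>x. u x - u 0 * vsol n \<nu> (x \<bullet> x))"
      using eigenspace_polar(2)[OF n0 u]
      by (intro continuous_intros continuous_on_compose2[OF cv(1)]) auto
    show "x \<in> closure disc" using that by simp
  qed (rule ball)
  moreover have "u x = 0" if "x \<notin> closed_disc" for x
    using u that by (auto simp: eigenspace_def)
  ultimately have "u x = usol n \<nu> (u 0) x" for x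
    by (cases "x \<in> closed_disc") (simp_all only: usol_def if_True if_False right_minus_eq)
  then show ?thesis by (rule ext)
qed

lemma eigenspace_neg:
  assumes n: "n > 0" and \<gamma>: "\<gamma> < 0" and u: "u \<in> eigenspace bc (cigar n) \<gamma>"
  shows "u = (\<lambda>_. 0)"
proof -
  have n0: "n \<ge> 0" using n by simp
  have cu: "continuous_on closed_disc u" by (rule eigenspace_polar(2)[OF n0 u])
  have ball: "u x = 0" if "x \<in> disc - {0}" for x
  proof -
    obtain t where "0 \<le> t" "t < 2 * pi" "x = pt (norm x) t" by (rule pt_surj)
    then show ?thesis using eigenfunction_neg_zero[OF n \<gamma> u, of "norm x" t] that by auto
  qed
  have "closure (disc \<inter> - {0}) = closure disc"
    by (rule closure_open_Int_superset) (auto simp: closure_complement interior_singleton)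
  then have cl: "closure (disc - {0}) = closed_disc" by (simp add: Diff_eq)
  have "u x = 0" if "x \<in> closed_disc" for x
    by (rule continuous_constant_on_closure[of "disc - {0}" u 0 x]) (use ball cu cl that in auto)
  moreover have "u x = 0" if "x \<notin> closed_disc" for x
    using u that by (auto simp: eigenspace_def)
  ultimately show ?thesis by auto
qed

section \<open>Nodal sets and the spectrum\<close>

text \<open>Finiteness makes the union of the other members closed, so a connected subset of
  \<open>S\<close> containing one member cannot meet any other.\<close>

lemma components_closed_unique:
  assumes fin: "finite F" and disj: "pairwise disjnt F" and un: "\<Union>F = S"
    and F: "\<And>X. X \<in> F \<Longrightarrow> closed X \<and> connected X \<and> X \<noteq> {}"
  shows "components S = F"
proof -
  have sub: "X \<in> components S" if X: "X \<in> F" for X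
    unfolding in_components_maximal
  proof (intro conjI allI impI)
    show "X \<noteq> {}" "X \<subseteq> S" "connected X" using X F un by auto
    define U where "U = \<Union>(F - {X})"
    fix d assume d: "d \<noteq> {} \<and> X \<subseteq> d \<and> d \<subseteq> S \<and> connected d"
    have cl: "closed X" "closed U" using F X fin by (auto intro!: closed_Union simp: U_def)
    have disjU: "X \<inter> U = {}" using disj X by (auto simp: pairwise_def disjnt_def U_def)
    have dsub: "d \<subseteq> X \<union> U" using d un by (auto simp: U_def)
    then have "X \<inter> d = {} \<or> U \<inter> d = {}"
      using connected_closedD[of d X U] d cl disjU by auto
    moreover have "X \<inter> d \<noteq> {}" using d F[OF X] by auto
    ultimately have "U \<inter> d = {}" by simp
    then show "d = X" using d dsub by blast
  qed
  moreover have "C \<in> F" if C: "C \<in> components S" for C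
  proof -
    obtain x where "x \<in> C" "x \<in> S" using C in_components_nonempty in_components_subset by blast
    then obtain X where X: "X \<in> F" "x \<in> X" using un by auto
    then have "C = X" using components_eq[OF C sub[OF X(1)]] \<open>x \<in> C\<close> by auto
    then show ?thesis using X by simp
  qed
  ultimately show ?thesis by auto
qed

lemma card_image_disjoint:
  assumes "\<And>i. i < k \<Longrightarrow> f i \<noteq> {}" "\<And>i l. i < l \<Longrightarrow> l < k \<Longrightarrow> f i \<inter> f l = {}"
  shows "card (f ` {..<k::nat}) = k" "pairwise disjnt (f ` {..<k})"
proof -
  have ne: "f i \<noteq> f l" if "i < k" "l < k" "i \<noteq> l" for i l
    using assms(1)[of i] assms(2)[of i l] assms(2)[of l i] that by (cases "i < l") auto
  then have "inj_on f {..<k}" by (auto simp: inj_on_def)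
  then show "card (f ` {..<k}) = k" by (simp add: card_image)
  have "f i \<inter> f l = {}" if "i < k" "l < k" "i \<noteq> l" for i l
    using assms(2)[of i l] assms(2)[of l i] that by (cases "i < l") auto
  then show "pairwise disjnt (f ` {..<k})"
    by (auto simp: pairwise_def disjnt_def)
qed

lemma nodal_circles:
  fixes \<rho> :: "nat \<Rightarrow> real"
  assumes mono: "\<And>i l. i < l \<Longrightarrow> l < k \<Longrightarrow> \<rho> i < \<rho> l"
    and range: "\<And>i. i < k \<Longrightarrow> 0 < \<rho> i \<and> \<rho> i < 1"
    and zeros: "\<And>x. x \<in> disc \<Longrightarrow> u x = 0 \<longleftrightarrow> (\<exists>i<k. norm x = \<rho> i)"
  shows "card (nodal_lines u) = k" "\<forall>C\<in>nodal_lines u. is_circle C \<and> C \<subseteq> disc"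
    "pairwise disjnt (nodal_lines u)" "card (nodal_domains u) = k + 1"
proof -
  let ?S = "\<lambda>i. sphere (0::real^2) (\<rho> i)"
  have dim: "2 \<le> DIM(real^2)" by simp
  have ns: "nodal_set u = \<Union>(?S ` {..<k})"
  proof -
    have "{x \<in> disc. u x = 0} = \<Union>(?S ` {..<k})"
      using zeros range by fastforce
    moreover have "closed (\<Union>(?S ` {..<k}))" by (intro closed_Union) auto
    ultimately show ?thesis by (simp add: nodal_set_def)
  qed
  have neS: "?S i \<noteq> {}" if "i < k" for i
  proof -
    have "pt (\<rho> i) 0 \<in> ?S i" using range[OF that] by simp
    then show ?thesis by blast
  qed
  have disjS: "?S i \<inter> ?S l = {}" if "i < l" "l < k" for i l
    using mono[OF that] by auto
  note cS = card_image_disjoint[of k ?S, OF neS disjS]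
  have nl: "nodal_lines u = ?S ` {..<k}"
    unfolding nodal_lines_def ns
    by (rule components_closed_unique) (use cS(2) neS connected_sphere[OF dim] in auto)
  show "card (nodal_lines u) = k" "pairwise disjnt (nodal_lines u)"
    unfolding nl using cS by auto
  show "\<forall>C\<in>nodal_lines u. is_circle C \<and> C \<subseteq> disc"
    unfolding nl is_circle_def using range by fastforce
  \<comment> \<open>The negative inner bound at index 0 makes the innermost region a full disc,
    origin included; the outermost region ends at radius 1. Hence one region more than
    circles.\<close>
  define lo where "lo = (\<lambda>i. if i = 0 then -1 else \<rho> (i - 1))"
  define hi where "hi = (\<lambda>i. if i < k then \<rho> i else 1)"
  let ?A = "\<lambda>i. {x::real^2. lo i < norm x \<and> norm x < hi i}"
  have lohi: "lo i < hi i" "0 < hi i" "hi i \<le> 1" if "i \<le> k" for i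
    using mono[of "i - 1" i] range[of i] range[of "i - 1"] that
    by (auto simp: lo_def hi_def split: if_splits)
  have neA: "?A i \<noteq> {}" if "i < k + 1" for i
  proof -
    define r where "r = (max 0 (lo i) + hi i) / 2"
    have "lo i < r" "r < hi i" "0 \<le> r" using lohi[of i] that by (auto simp: r_def max_def)
    then have "pt r 0 \<in> ?A i" by simp
    then show ?thesis by blast
  qed
  have hilo: "hi i \<le> lo l" if "i < l" "l < k + 1" for i l
  proof (cases "i = l - 1")
    case False
    then have "\<rho> i < \<rho> (l - 1)" using that by (intro mono) auto
    then show ?thesis using that by (auto simp: lo_def hi_def)
  qed (use that in \<open>auto simp: lo_def hi_def\<close>)
  then have disjA: "?A i \<inter> ?A l = {}" if "i < l" "l < k + 1" for i l
    using that by force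
  note cA = card_image_disjoint[of "k + 1" ?A, OF neA disjA]
  have un: "\<Union>(?A ` {..<k + 1}) = disc - nodal_set u"
  proof (intro equalityI subsetI)
    fix x assume "x \<in> \<Union>(?A ` {..<k + 1})"
    then obtain i where i: "i \<le> k" "lo i < norm x" "norm x < hi i" by (auto simp: less_Suc_eq_le)
    have "norm x \<noteq> \<rho> l" if "l < k" for l
    proof (cases "l < i")
      case True
      then have "\<rho> l \<le> lo i" using hilo[of l i] i that by (simp add: hi_def)
      then show ?thesis using i by simp
    next
      case False
      then have "hi i \<le> \<rho> l" using mono[of i l] that by (cases "i = l") (auto simp: hi_def)
      then show ?thesis using i by simp
    qed
    then show "x \<in> disc - nodal_set u" using i lohi[of i] by (auto simp: ns)
  next
    fix x assume x: "x \<in> disc - nodal_set u"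
    then have nx: "norm x < 1" "\<And>i. i < k \<Longrightarrow> norm x \<noteq> \<rho> i" by (auto simp: ns)
    define i where "i = (LEAST i. norm x < hi i)"
    have h: "norm x < hi k" using nx by (simp add: hi_def)
    have i: "norm x < hi i" "i \<le> k"
      unfolding i_def using LeastI[of "\<lambda>i. norm x < hi i", OF h] Least_le[of "\<lambda>i. norm x < hi i", OF h] by auto
    have "lo i < norm x"
    proof (cases "i = 0")
      case True then show ?thesis by (simp add: lo_def) (smt (verit) norm_ge_zero)
    next
      case False
      then have "\<not> norm x < hi (i - 1)" unfolding i_def using not_less_Least[of "i - 1"] 
        by (metis One_nat_def Suc_pred i_def lessI not_gr_zero not_less_Least)
      moreover have "i - 1 < k" using False i by linarith
      ultimately show ?thesis using nx(2)[of "i - 1"] False by (simp add: lo_def hi_def)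
    qed
    then show "x \<in> \<Union>(?A ` {..<k + 1})" using i by auto
  qed
  have "nodal_domains u = ?A ` {..<k + 1}"
    unfolding nodal_domains_def
  proof (rule components_open_unique[OF cA(2) un])
    fix X assume "X \<in> ?A ` {..<k + 1}"
    then obtain i where i: "i < k + 1" "X = ?A i" by blast
    have "open X" unfolding i(2) by (intro open_Collect_conj open_Collect_less continuous_intros)
    moreover have "connected X"
      unfolding i(2) using connected_annulus(1)[OF dim, of "lo i" 0 "hi i"] by simp
    ultimately show "open X \<and> connected X \<and> X \<noteq> {}" using neA[OF i(1)] i(2) by blast
  qed
  then show "card (nodal_domains u) = k + 1" using cA(1) by simp
qed

text \<open>Up to \<open>e (K - 1)\<close> the list is complete and all multiplicities are 1, so the
  two counts at \<open>e i\<close> are \<open>i\<close> and \<open>Suc i\<close>. Any larger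
  \<gamma> has at least \<open>K\<close> eigenvalues below it, too many for
  \<open>j \<le> K\<close>.\<close>

lemma nth_eigenvalue_enum:
  fixes e :: "nat \<Rightarrow> real"
  assumes strict: "\<And>k l. k < l \<Longrightarrow> l < K \<Longrightarrow> e k < e l"
    and eig: "\<And>\<mu>. \<mu> \<le> e (K - 1) \<Longrightarrow> eigenvalue bc g \<mu> \<longleftrightarrow> (\<exists>k<K. \<mu> = e k)"
    and mult: "\<And>k. k < K \<Longrightarrow> multiplicity bc g (e k) = 1"
    and fin: "\<And>\<mu>. \<mu> \<le> e (K - 1) \<Longrightarrow> finite_multiplicity bc g \<mu>"
    and j: "1 \<le> j" "j \<le> K"
  shows "nth_eigenvalue bc g j \<gamma> \<longleftrightarrow> \<gamma> = e (j - 1)"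
proof -
  have mono: "e k \<le> e l" if "k \<le> l" "l < K" for k l
    using strict[of k l] that by (cases "k = l") auto
  have less_iff: "e k < e l \<longleftrightarrow> k < l" if "k < K" "l < K" for k l
    using strict[of k l] mono[of l k] that by (cases "k < l") auto
  have inj: "inj_on e {..<K}"
    using less_iff by (metis inj_onI lessThan_iff less_irrefl nat_neq_iff)
  have set1: "{\<mu>. eigenvalue bc g \<mu> \<and> \<mu> < e i} = e ` {..<i}" if i: "i < K" for i
  proof -
    have "eigenvalue bc g \<mu> \<and> \<mu> < e i \<longleftrightarrow> (\<exists>k<i. \<mu> = e k)" for \<mu>
    proof
      assume a: "eigenvalue bc g \<mu> \<and> \<mu> < e i"
      then have "\<mu> \<le> e (K - 1)" using mono[of i "K - 1"] i by linarith
      then obtain k where "k < K" "\<mu> = e k" using eig a by auto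
      then show "\<exists>k<i. \<mu> = e k" using a less_iff[of k i] i by auto
    next
      assume "\<exists>k<i. \<mu> = e k"
      then obtain k where k: "k < i" "\<mu> = e k" by auto
      then have "\<mu> \<le> e (K - 1)" using mono[of k "K - 1"] i by auto
      then have "eigenvalue bc g \<mu>" using eig[of \<mu>] k i less_trans by blast
      then show "eigenvalue bc g \<mu> \<and> \<mu> < e i" using strict[of k i] k i by simp
    qed
    then show ?thesis by auto
  qed
  have set2: "{\<mu>. eigenvalue bc g \<mu> \<and> \<mu> \<le> e i} = e ` {..<Suc i}" if i: "i < K" for i
  proof -
    have "eigenvalue bc g (e i)" using eig[of "e i"] mono[of i "K - 1"] i by auto
    then have "{\<mu>. eigenvalue bc g \<mu> \<and> \<mu> \<le> e i} = insert (e i) {\<mu>. eigenvalue bc g \<mu> \<and> \<mu> < e i}" by auto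
    then show ?thesis using set1[OF i] by (auto simp: lessThan_Suc)
  qed
  have msum: "(\<Sum>\<mu>\<in>e ` {..<i}. multiplicity bc g \<mu>) = i" if "i \<le> K" for i
  proof -
    have "(\<Sum>\<mu>\<in>e ` {..<i}. multiplicity bc g \<mu>) = (\<Sum>k<i. multiplicity bc g (e k))"
      by (subst sum.reindex) (use inj that in \<open>auto intro: inj_on_subset\<close>)
    also have "\<dots> = (\<Sum>k<i. 1)" by (rule sum.cong) (use mult that in auto)
    finally show ?thesis by simp
  qed
  have nth: "nth_eigenvalue bc g j (e i) \<longleftrightarrow> j = Suc i" if i: "i < K" for i
  proof -
    have "eigenvalue bc g (e i)" using eig[of "e i"] mono[of i "K - 1"] i by auto
    moreover have "finite_multiplicity bc g \<mu>" if "\<mu> \<le> e i" for \<mu>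
    proof -
      have "e i \<le> e (K - 1)" by (rule mono) (use i in auto)
      then show ?thesis using fin[of \<mu>] that by simp
    qed
    ultimately show ?thesis
      unfolding nth_eigenvalue_def set1[OF i] set2[OF i] using i by (auto simp: msum)
  qed
  show ?thesis
  proof
    assume "\<gamma> = e (j - 1)"
    then show "nth_eigenvalue bc g j \<gamma>" using nth[of "j - 1"] j by auto
  next
    assume a: "nth_eigenvalue bc g j \<gamma>"
    show "\<gamma> = e (j - 1)"
    proof (cases "\<gamma> \<le> e (K - 1)")
      case True
      then obtain i where i: "i < K" "\<gamma> = e i" using eig a by (auto simp: nth_eigenvalue_def)
      then show ?thesis using nth[OF i(1)] a by auto
    next
      case False
      have "e ` {..<K} \<subseteq> {\<mu>. eigenvalue bc g \<mu> \<and> \<mu> < \<gamma>}"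
      proof
        fix \<mu> assume "\<mu> \<in> e ` {..<K}"
        then obtain k where k: "k < K" "\<mu> = e k" by auto
        then have "\<mu> \<le> e (K - 1)" using mono[of k "K - 1"] by auto
        then show "\<mu> \<in> {\<mu>. eigenvalue bc g \<mu> \<and> \<mu> < \<gamma>}" using eig k False by auto
      qed
      moreover have "finite {\<mu>. eigenvalue bc g \<mu> \<and> \<mu> < \<gamma>}"
        by (rule finite_subset[of _ "{\<mu>. eigenvalue bc g \<mu> \<and> \<mu> \<le> \<gamma>}"])
          (use a in \<open>auto simp: nth_eigenvalue_def\<close>)
      ultimately have "(\<Sum>\<mu>\<in>e ` {..<K}. multiplicity bc g \<mu>)
          \<le> (\<Sum>\<mu> | eigenvalue bc g \<mu> \<and> \<mu> < \<gamma>. multiplicity bc g \<mu>)"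
        by (intro sum_mono2) auto
      then show ?thesis using msum[of K] a j by (simp add: nth_eigenvalue_def)
    qed
  qed
qed

section \<open>Enumeration of the low spectrum by the angle at the boundary\<close>

definition tau :: "boundary_condition \<Rightarrow> real" where
  "tau bc = (case bc of Dirichlet \<Rightarrow> pi / 2 | Neumann \<Rightarrow> 0)"

lemma cos_zero_nonneg:
  assumes "x \<ge> 0"
  shows "cos x = 0 \<longleftrightarrow> (\<exists>k::nat. x = pi / 2 + real k * pi)"
proof
  assume "cos x = 0"
  then obtain i :: int where i: "x = of_int i * pi + pi / 2" by (auto simp: cos_zero_iff_int2)
  have "i \<ge> 0"
  proof (rule ccontr)
    assume "\<not> i \<ge> 0"
    then have "of_int i * pi \<le> (-1) * pi" by (intro mult_right_mono) auto
    then show False using i assms pi_gt_zero by linarith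
  qed
  then show "\<exists>k::nat. x = pi / 2 + real k * pi"
    using i by (intro exI[of _ "nat i"]) (simp add: of_nat_nat)
next
  assume "\<exists>k::nat. x = pi / 2 + real k * pi"
  then obtain k :: nat where "x = of_int (int k) * pi + pi / 2" by auto
  then show "cos x = 0" unfolding cos_zero_iff_int2 by blast
qed

lemma sin_zero_nonneg:
  assumes "x \<ge> 0"
  shows "sin x = 0 \<longleftrightarrow> (\<exists>k::nat. x = real k * pi)"
proof
  assume "sin x = 0"
  then obtain i :: int where i: "x = of_int i * pi" by (auto simp: sin_zero_iff_int2)
  then have "i \<ge> 0" using assms pi_gt_zero by (auto simp: zero_le_mult_iff simp del: pi_gt_zero)
  then show "\<exists>k::nat. x = real k * pi"
    using i by (intro exI[of _ "nat i"]) (simp add: of_nat_nat)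
qed auto

lemma phi_nonneg: "n > 0 \<Longrightarrow> \<nu> \<ge> 0 \<Longrightarrow> s \<in> {0..1} \<Longrightarrow> phi n \<nu> s \<ge> 0"
  using phi_increment[of n \<nu> 0 s] mult_nonneg_nonneg[of \<nu> s] by (simp, linarith)

text \<open>The polar form of the solution turns the Dirichlet condition into a zero of the cosine
  and the Neumann condition into a zero of the sine. Index 0 in the Neumann case is
  \<open>\<nu> = 0\<close>, the constant eigenfunction.\<close>

lemma radial_bc_phi:
  assumes n: "n > 0" and \<nu>: "\<nu> \<ge> 0"
  shows "radial_bc bc n \<nu> \<longleftrightarrow> (\<exists>k::nat. phi n \<nu> 1 = tau bc + real k * pi)"
proof -
  obtain C where "C > 0" "vsol n \<nu> 1 = C * cos (phi n \<nu> 1)" "\<nu> * ysol n \<nu> 1 = C * sin (phi n \<nu> 1)"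
    using sol_polar[OF n \<nu>, of 1] by auto
  then show ?thesis
    using cos_zero_nonneg[of "phi n \<nu> 1"] sin_zero_nonneg[of "phi n \<nu> 1"] phi_nonneg[OF n \<nu>, of 1]
    by (cases bc) (auto simp: radial_bc_def tau_def)
qed

lemma phi_nu_0 [simp]: "phi n 0 s = 0"
  by (simp add: phi_def phi_rate_def[abs_def])

lemma usol_scale: "usol n \<nu> c = (\<lambda>x. c * usol n \<nu> 1 x)"
  by (auto simp: usol_def)

lemma usol_0: "usol n \<nu> 0 = (\<lambda>x. 0)"
  by (rule ext) (simp add: usol_def)

lemma usol_nonzero: "usol n \<nu> 1 \<noteq> (\<lambda>x. 0)"
proof
  assume "usol n \<nu> 1 = (\<lambda>x. 0)"
  then have "usol n \<nu> 1 0 = 0" by simp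
  then show False by (simp add: usol_def)
qed

text \<open>All that the theorem uses about the first \<open>K\<close> eigenvalues of one boundary
  condition. Indices start at 0, so \<open>nu k\<close> belongs to the eigenvalue number
  \<open>k + 1\<close>.\<close>

definition radial_spectrum :: "real \<Rightarrow> nat \<Rightarrow> boundary_condition \<Rightarrow> (nat \<Rightarrow> real) \<Rightarrow> bool" where
  "radial_spectrum n K bc nu \<longleftrightarrow>
    (\<forall>k<K. nu k \<ge> 0 \<and> phi n (nu k) 1 = tau bc + real k * pi \<and>
      multiplicity bc (cigar n) (4 * (nu k)\<^sup>2 / n) = 1 \<and>
      usol n (nu k) 1 \<in> eigenspace bc (cigar n) (4 * (nu k)\<^sup>2 / n) \<and>
      (\<forall>u\<in>eigenspace bc (cigar n) (4 * (nu k)\<^sup>2 / n). u = usol n (nu k) (u 0))) \<and>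
    (\<forall>j \<gamma>. 1 \<le> j \<longrightarrow> j \<le> K \<longrightarrow>
      (nth_eigenvalue bc (cigar n) j \<gamma> \<longleftrightarrow> \<gamma> = 4 * (nu (j - 1))\<^sup>2 / n))"

lemma spectrum_cigar:
  fixes K :: nat
  assumes K: "K \<ge> 1" and n_def: "n = 16 * pi\<^sup>2 * real K"
  shows "\<exists>nu. radial_spectrum n K bc nu"
proof -
  have n: "n > 0" using K by (simp add: n_def)
  \<comment> \<open>The final angle at parameter \<open>B\<close> is at least \<open>B\<close>, and
    all prescribed angles are at most \<open>pi / 2 + real (K - 1) * pi\<close>, so the intermediate
    value theorem applies on \<open>{0..B}\<close>.\<close>
  define B where "B = real K * pi"
  have B: "B > 0" using K by (simp add: B_def)
  \<comment> \<open>Up to \<open>B\<close> the values \<open>4 * \<nu>\<^sup>2 / n\<close> are at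
    most \<open>K / 4\<close>, while the threshold \<open>n / (16 * pi\<^sup>2)\<close> equals
    \<open>K\<close>.\<close>
  have small: "4 * \<nu>\<^sup>2 / n < n / (16 * pi\<^sup>2)" if "0 \<le> \<nu>" "\<nu> \<le> B" for \<nu>
  proof -
    have "\<nu>\<^sup>2 \<le> B\<^sup>2" using that by (simp add: power_mono)
    moreover have "B\<^sup>2 > 0" using B by simp
    moreover have "real K * n = 16 * B\<^sup>2" by (simp add: n_def B_def power2_eq_square)
    ultimately have "4 * \<nu>\<^sup>2 < real K * n" by linarith
    then have "4 * \<nu>\<^sup>2 / n < real K" using n by (simp add: pos_divide_less_eq)
    then show ?thesis by (simp add: n_def)
  qed
  have tau: "0 \<le> tau bc" "tau bc \<le> pi / 2" by (cases bc; simp add: tau_def)+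
  have "\<exists>\<nu>. 0 \<le> \<nu> \<and> \<nu> \<le> B \<and> phi n \<nu> 1 = tau bc + real k * pi" if k: "k < K" for k
  proof (rule IVT'[of "\<lambda>\<nu>. phi n \<nu> 1" 0 "tau bc + real k * pi" B, OF _ _ _ phi_continuous_param[OF n]])
    show "phi n 0 1 \<le> tau bc + real k * pi" using tau by simp
    have "(real k + 1) * pi \<le> B" unfolding B_def using k by (intro mult_right_mono) auto
    then have "tau bc + real k * pi \<le> B" using tau by (simp add: distrib_right)
    then show "tau bc + real k * pi \<le> phi n B 1"
      using phi_increment[OF n, of B 0 1] B by simp
  qed (use B in auto)
  then obtain nu where nu: "\<And>k. k < K \<Longrightarrow> 0 \<le> nu k \<and> nu k \<le> B \<and> phi n (nu k) 1 = tau bc + real k * pi"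
    by metis
  define e where "e = (\<lambda>k. 4 * (nu k)\<^sup>2 / n)"
  have phi_mono: "phi n a 1 < phi n b 1 \<longleftrightarrow> a < b" if "0 \<le> a" "0 \<le> b" for a b
    using phi_strict_mono_param[OF n, of a b] phi_strict_mono_param[OF n, of b a] that
    by (cases a b rule: linorder_cases) auto
  have strict: "e k < e l" if kl: "k < l" "l < K" for k l
  proof -
    have "nu k < nu l"
      using phi_mono[of "nu k" "nu l"] nu[of k] nu[of l] kl by simp
    then have "(nu k)\<^sup>2 < (nu l)\<^sup>2" using nu[of k] kl by (intro power_strict_mono) auto
    then show ?thesis using n by (simp add: e_def divide_strict_right_mono)
  qed
  \<comment> \<open>Every nonnegative number up to the last listed eigenvalue has the form covered
    by the radial description; with the exclusion of negative numbers this shows that the list has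
    no gaps.\<close>
  have root: "\<exists>\<nu>\<ge>0. \<nu> \<le> nu (K - 1) \<and> \<mu> = 4 * \<nu>\<^sup>2 / n" if \<mu>: "0 \<le> \<mu>" "\<mu> \<le> e (K - 1)" for \<mu>
  proof -
    define \<nu> where "\<nu> = sqrt (n * \<mu>) / 2"
    have sq: "4 * \<nu>\<^sup>2 = n * \<mu>" using n \<mu> by (simp add: \<nu>_def power_divide)
    then have eq: "\<mu> = 4 * \<nu>\<^sup>2 / n" using n by simp
    have "\<nu>\<^sup>2 \<le> (nu (K - 1))\<^sup>2"
      using \<mu>(2) n unfolding eq e_def by (simp add: divide_le_cancel)
    then have "\<nu> \<le> nu (K - 1)" using nu[of "K - 1"] K power2_le_imp_le by auto
    moreover have "\<nu> \<ge> 0" using n \<mu> by (simp add: \<nu>_def)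
    ultimately show ?thesis using eq by blast
  qed
  have top: "nu (K - 1) \<le> B" "0 \<le> nu (K - 1)" using nu[of "K - 1"] K by auto
  have neg: "eigenspace bc (cigar n) \<mu> \<subseteq> {\<lambda>_. 0}" if "\<mu> < 0" for \<mu>
    using eigenspace_neg[OF n that] by blast
  have char: "u = usol n \<nu> (u 0)" if "0 \<le> \<nu>" "\<nu> \<le> B" "u \<in> eigenspace bc (cigar n) (4 * \<nu>\<^sup>2 / n)" for u \<nu>
    using eigenspace_subset_usol[OF n small] that by blast
  have bnd: "radial_bc bc n (nu k)" if "k < K" for k
    using radial_bc_phi[OF n] nu[OF that] by auto
  have mem: "usol n (nu k) 1 \<in> eigenspace bc (cigar n) (e k)" if "k < K" for k
    unfolding e_def using usol_eigenspace[OF n] bnd[OF that] by simp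
  have zero_span: "(\<lambda>_. 0) \<in> real_fun.span X" for X
    using real_fun.span_zero[of X] by (simp add: zero_fun_def)
  have in_span: "usol n \<nu> c \<in> real_fun.span {usol n \<nu> 1}" for \<nu> c
    by (subst usol_scale) (intro real_fun.span_scale real_fun.span_base, simp)
  have "multiplicity bc (cigar n) (e k) = 1" if k: "k < K" for k
    unfolding multiplicity_def
  proof (rule real_fun.dim_unique[of "{usol n (nu k) 1}"])
    show "{usol n (nu k) 1} \<subseteq> eigenspace bc (cigar n) (e k)" using mem[OF k] by simp
    show "eigenspace bc (cigar n) (e k) \<subseteq> real_fun.span {usol n (nu k) 1}"
      using char[of "nu k"] nu[OF k] in_span unfolding e_def by (metis subsetI)
    show "real_fun.independent {usol n (nu k) 1}"
      using usol_nonzero by (simp add: real_fun.dependent_single zero_fun_def)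
  qed simp
  note mult = this
  have fin: "finite_multiplicity bc (cigar n) \<mu>" if \<mu>: "\<mu> \<le> e (K - 1)" for \<mu>
  proof (cases "\<mu> < 0")
    case True
    have "eigenspace bc (cigar n) \<mu> \<subseteq> real_fun.span {}" using neg[OF True] zero_span by blast
    then show ?thesis unfolding finite_multiplicity_def by blast
  next
    case False
    then obtain \<nu> where \<nu>: "\<nu> \<ge> 0" "\<nu> \<le> nu (K - 1)" "\<mu> = 4 * \<nu>\<^sup>2 / n"
      using root[OF _ \<mu>] not_less by blast
    then have "\<nu> \<le> B" using top by simp
    then have "eigenspace bc (cigar n) \<mu> \<subseteq> real_fun.span {usol n \<nu> 1}"
      using char[of \<nu>] \<nu> in_span by (metis subsetI)
    then show ?thesis unfolding finite_multiplicity_def by blast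
  qed
  have eig: "eigenvalue bc (cigar n) \<mu> \<longleftrightarrow> (\<exists>k<K. \<mu> = e k)" if \<mu>: "\<mu> \<le> e (K - 1)" for \<mu>
  proof
    assume "eigenvalue bc (cigar n) \<mu>"
    then obtain u where u: "u \<in> eigenspace bc (cigar n) \<mu>" "u \<noteq> (\<lambda>x. 0)"
      by (auto simp: eigenvalue_def eigenfunction_def)
    then have "\<not> \<mu> < 0" using neg by blast
    then obtain \<nu> where \<nu>: "\<nu> \<ge> 0" "\<nu> \<le> nu (K - 1)" "\<mu> = 4 * \<nu>\<^sup>2 / n"
      using root[OF _ \<mu>] not_less by blast
    then have "\<nu> \<le> B" using top by simp
    then have eq: "u = usol n \<nu> (u 0)" using char[of \<nu> u] \<nu> u by simp
    have "u 0 \<noteq> 0"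
    proof
      assume "u 0 = 0"
      then have "u = usol n \<nu> 0" using eq by metis
      then show False using u by (simp add: usol_0)
    qed
    then have "radial_bc bc n \<nu>" using usol_eigenspace[OF n, of \<nu> "u 0" bc] eq u \<nu>(3) by simp
    then obtain k :: nat where k: "phi n \<nu> 1 = tau bc + real k * pi" using radial_bc_phi[OF n \<nu>(1)] by blast
    have "phi n \<nu> 1 \<le> phi n (nu (K - 1)) 1"
      using phi_mono[of "nu (K - 1)" \<nu>] \<nu> top by simp
    then have "real k * pi \<le> real (K - 1) * pi" using k nu[of "K - 1"] K by simp
    then have kK: "k < K" using K by simp
    then have "nu k = \<nu>" using phi_mono[of "nu k" \<nu>] phi_mono[of \<nu> "nu k"] nu[of k] k \<nu>(1) by force
    then show "\<exists>k<K. \<mu> = e k" using kK \<nu>(3) by (auto simp: e_def)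
  next
    assume "\<exists>k<K. \<mu> = e k"
    then show "eigenvalue bc (cigar n) \<mu>"
      using mem usol_nonzero by (auto simp: eigenvalue_def eigenfunction_def)
  qed
  have "radial_spectrum n K bc nu"
    unfolding radial_spectrum_def
  proof (intro conjI allI impI ballI)
    fix k assume k: "k < K"
    show "nu k \<ge> 0" "phi n (nu k) 1 = tau bc + real k * pi" using nu[OF k] by auto
    show "multiplicity bc (cigar n) (4 * (nu k)\<^sup>2 / n) = 1" using mult[OF k] by (simp add: e_def)
    show "usol n (nu k) 1 \<in> eigenspace bc (cigar n) (4 * (nu k)\<^sup>2 / n)" using mem[OF k] by (simp add: e_def)
    show "u = usol n (nu k) (u 0)" if "u \<in> eigenspace bc (cigar n) (4 * (nu k)\<^sup>2 / n)" for u
      using char nu[OF k] that by blast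
  next
    fix j \<gamma> assume "1 \<le> j" "j \<le> K"
    then show "nth_eigenvalue bc (cigar n) j \<gamma> \<longleftrightarrow> \<gamma> = 4 * (nu (j - 1))\<^sup>2 / n"
      using nth_eigenvalue_enum[of K e bc "cigar n" j \<gamma>, OF strict eig mult fin] by (simp add: e_def)
  qed
  then show ?thesis by blast
qed

lemma radial_spectrumD:
  assumes "radial_spectrum n K bc nu"
  shows "k < K \<Longrightarrow> nu k \<ge> 0 \<and> phi n (nu k) 1 = tau bc + real k * pi"
    "k < K \<Longrightarrow> multiplicity bc (cigar n) (4 * (nu k)\<^sup>2 / n) = 1"
    "k < K \<Longrightarrow> usol n (nu k) 1 \<in> eigenspace bc (cigar n) (4 * (nu k)\<^sup>2 / n)"
    "k < K \<Longrightarrow> u \<in> eigenspace bc (cigar n) (4 * (nu k)\<^sup>2 / n) \<Longrightarrow> u = usol n (nu k) (u 0)"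
    "1 \<le> j \<Longrightarrow> j \<le> K \<Longrightarrow> nth_eigenvalue bc (cigar n) j \<gamma> \<longleftrightarrow> \<gamma> = 4 * (nu (j - 1))\<^sup>2 / n"
  using assms unfolding radial_spectrum_def by blast+

lemma S1_invariant_usol: "S1_invariant_fun (usol n \<nu> c)"
  unfolding S1_invariant_fun_def
proof (intro allI impI ballI)
  fix A :: "real^2^2" and x :: "real^2" assume "rotation_matrix A" and x: "x \<in> closed_disc"
  then have o: "transpose A ** A = mat 1"
    by (auto simp: rotation_matrix_def orthogonal_matrix_def)
  have "(A *v x) \<bullet> (A *v x) = (transpose A *v (A *v x)) \<bullet> x"
    by (simp only: transpose_matrix_vector dot_lmul_matrix)
  then have ip: "(A *v x) \<bullet> (A *v x) = x \<bullet> x" by (simp add: matrix_vector_mul_assoc o)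
  then have "norm (A *v x) = norm x" by (simp add: norm_eq_sqrt_inner)
  then show "usol n \<nu> c (A *v x) = usol n \<nu> c x" using ip by (simp add: usol_def)
qed

text \<open>The angle increases strictly from 0 to \<open>tau bc + real k * pi\<close> and meets
  \<open>pi / 2 + real i * pi\<close> strictly inside exactly for \<open>i < k\<close>. For
  Dirichlet \<open>i = k\<close> falls on the boundary circle, outside the open disc; for Neumann it
  lies beyond the final angle. The radii are square roots because the variable is
  \<open>x \<bullet> x\<close>, and they are the same for all multiples \<open>c\<close>.\<close>

lemma usol_zeros:
  assumes n: "n > 0" and \<nu>: "\<nu> > 0" and phi1: "phi n \<nu> 1 = tau bc + real k * pi"
  shows "\<exists>\<rho> :: nat \<Rightarrow> real. (\<forall>i l. i < l \<longrightarrow> l < k \<longrightarrow> \<rho> i < \<rho> l) \<and>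
    (\<forall>i<k. 0 < \<rho> i \<and> \<rho> i < 1) \<and>
    (\<forall>c x. c \<noteq> 0 \<longrightarrow> x \<in> disc \<longrightarrow> (usol n \<nu> c x = 0 \<longleftrightarrow> (\<exists>i<k. norm x = \<rho> i)))"
proof -
  have \<nu>0: "\<nu> \<ge> 0" using \<nu> by simp
  have mono: "phi n \<nu> s < phi n \<nu> t" if "0 \<le> s" "s < t" "t \<le> 1" for s t
    using phi_increment[OF n \<nu>0, of s t] that mult_pos_pos[OF \<nu>, of "t - s"] by simp
  have tau: "0 \<le> tau bc" "tau bc \<le> pi / 2" by (cases bc; simp add: tau_def)+
  have below: "pi / 2 + real i * pi < phi n \<nu> 1" if "i < k" for i
  proof -
    have "(real i + 1) * pi \<le> real k * pi" using that by (intro mult_right_mono) auto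
    then show ?thesis using tau pi_gt_zero unfolding phi1 distrib_right by linarith
  qed
  have "\<exists>s. 0 < s \<and> s < 1 \<and> phi n \<nu> s = pi / 2 + real i * pi" if ik: "i < k" for i
  proof -
    have "phi n \<nu> 0 \<le> pi / 2 + real i * pi" by simp
    then obtain s where s: "0 \<le> s" "s \<le> 1" "phi n \<nu> s = pi / 2 + real i * pi"
      using IVT'[of "phi n \<nu>" 0 "pi / 2 + real i * pi" 1] below[OF ik] phi_continuous[OF n \<nu>0] by auto
    have "phi n \<nu> s > 0" using s(3) by (simp add: add_pos_nonneg)
    then have "s \<noteq> 0" by auto
    moreover have "s \<noteq> 1" using s(3) below[OF that] by auto
    ultimately show ?thesis using s by (intro exI[of _ s]) auto
  qed
  then obtain z where z: "\<And>i. i < k \<Longrightarrow> 0 < z i \<and> z i < 1 \<and> phi n \<nu> (z i) = pi / 2 + real i * pi"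
    by metis
  have v0: "vsol n \<nu> s = 0 \<longleftrightarrow> (\<exists>i<k. s = z i)" if s: "0 \<le> s" "s < 1" for s
  proof -
    obtain C where C: "C > 0" "vsol n \<nu> s = C * cos (phi n \<nu> s)"
      using sol_polar[OF n \<nu>0, of s] s by auto
    have "phi n \<nu> s \<ge> 0" using phi_nonneg[OF n \<nu>0, of s] s by simp
    then have "vsol n \<nu> s = 0 \<longleftrightarrow> (\<exists>i::nat. phi n \<nu> s = pi / 2 + real i * pi)"
      using C cos_zero_nonneg by simp
    also have "\<dots> \<longleftrightarrow> (\<exists>i<k. s = z i)"
    proof
      assume "\<exists>i::nat. phi n \<nu> s = pi / 2 + real i * pi"
      then obtain i :: nat where i: "phi n \<nu> s = pi / 2 + real i * pi" by blast
      have "phi n \<nu> s < phi n \<nu> 1" using mono[of s 1] s by simp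
      then have "real i * pi < real k * pi" using i phi1 tau by linarith
      then have ik: "i < k" by simp
      then have "phi n \<nu> s = phi n \<nu> (z i)" using i z by simp
      then have "s = z i" using mono[of s "z i"] mono[of "z i" s] z[OF ik] s
        by (cases s "z i" rule: linorder_cases) auto
      then show "\<exists>i<k. s = z i" using ik by blast
    qed (use z in blast)
    finally show ?thesis .
  qed
  have zmono: "z i < z l" if "i < l" "l < k" for i l
  proof (rule ccontr)
    assume "\<not> z i < z l"
    then have "phi n \<nu> (z l) \<le> phi n \<nu> (z i)"
      using mono[of "z l" "z i"] z[of i] z[of l] that by (cases "z l = z i") auto
    then have "real l * pi \<le> real i * pi" using z[of i] z[of l] that by simp
    then show False using that by simp
  qed
  show ?thesis
  proof (intro exI[of _ "\<lambda>i. sqrt (z i)"] conjI allI impI)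
    show "sqrt (z i) < sqrt (z l)" if "i < l" "l < k" for i l using zmono[OF that] by simp
    show "0 < sqrt (z i)" "sqrt (z i) < 1" if "i < k" for i using z[OF that] by auto
    fix x :: "real^2" and c :: real assume c: "c \<noteq> 0" and x: "x \<in> disc"
    have "x \<bullet> x < 1" using x by (simp add: norm_lt_square[of x 1])
    then have "usol n \<nu> c x = 0 \<longleftrightarrow> (\<exists>i<k. x \<bullet> x = z i)"
      using v0[of "x \<bullet> x"] c x by (simp add: usol_def)
    also have "\<dots> \<longleftrightarrow> (\<exists>i<k. norm x = sqrt (z i))"
      by (simp add: norm_eq_sqrt_inner)
    finally show "usol n \<nu> c x = 0 \<longleftrightarrow> (\<exists>i<k. norm x = sqrt (z i))" .
  qed
qed

text \<open>The final angle \<pi> belongs to the second Neumann eigenvalue. The angle stays between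
  0 and \<pi>, so \<open>ysol\<close> is positive, and the derivative of \<open>vsol\<close> is a
  negative multiple of it.\<close>

lemma vsol_decreasing:
  assumes n: "n > 0" and \<nu>: "\<nu> > 0" and phi1: "phi n \<nu> 1 = pi" and s: "0 < s" "s \<le> 1"
  shows "vsol n \<nu> s < vsol n \<nu> 0"
proof (rule DERIV_neg_imp_decreasing_open[OF s(1)])
  have \<nu>0: "\<nu> \<ge> 0" using \<nu> by simp
  fix t assume t: "0 < t" "t < s"
  have "\<nu> * (t - 0) > 0" "\<nu> * (1 - t) > 0" using t s \<nu> by auto
  moreover have "phi n \<nu> t - phi n \<nu> 0 \<ge> \<nu> * (t - 0)" "phi n \<nu> 1 - phi n \<nu> t \<ge> \<nu> * (1 - t)"
    by (rule phi_increment[OF n \<nu>0]; use t s in simp)+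
  ultimately have "0 < phi n \<nu> t" "phi n \<nu> t < pi" using phi1 by auto
  then have sin: "sin (phi n \<nu> t) > 0" by (rule sin_gt_zero)
  obtain C where C: "C > 0" "\<nu> * ysol n \<nu> t = C * sin (phi n \<nu> t)"
    using sol_polar[OF n \<nu>0, of t] t s by auto
  have "\<nu> * ysol n \<nu> t > 0" using C sin by simp
  then have "ysol n \<nu> t > 0" using \<nu> by (simp add: zero_less_mult_iff)
  then have "\<nu>\<^sup>2 * (1 + 1 / (n * t)) * ysol n \<nu> t > 0"
    using \<nu> n t by (intro mult_pos_pos) (auto intro: add_pos_pos)
  then show "\<exists>y. (vsol n \<nu> has_real_derivative y) (at t) \<and> y < 0"
    using vsol_deriv_pos[OF n t(1), of \<nu>] by (intro exI conjI) auto
next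
  show "continuous_on {0..s} (vsol n \<nu>)"
    by (auto intro!: continuous_at_imp_continuous_on DERIV_continuous[OF vsol_deriv[OF n]])
qed

theorem corollary2:
  fixes m :: nat
  assumes "m > 0"
  shows "\<exists>M :: (real^2 \<Rightarrow> real^2^2) set. M \<noteq> {} \<and>
    (\<forall>g\<in>M.
       riemannian_metric g \<and> S1_invariant_metric g \<and>
       (\<forall>x\<in>closed_disc. gauss_curvature g x > 0) \<and> total_area g = pi \<and>
       (\<forall>bc\<in>{Dirichlet, Neumann}.
          (\<forall>j\<in>{1..m}. \<exists>\<gamma>. nth_eigenvalue bc g j \<gamma> \<and> simple_eigenvalue bc g \<gamma>) \<and>
          (\<forall>j\<in>{2..m}. \<forall>\<gamma> u. nth_eigenvalue bc g j \<gamma> \<and> eigenfunction bc g \<gamma> u \<longrightarrow>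
             S1_invariant_fun u \<and>
             card (nodal_lines u) = j - 1 \<and>
             (\<forall>C\<in>nodal_lines u. is_circle C \<and> C \<subseteq> disc) \<and>
             pairwise disjnt (nodal_lines u) \<and>
             card (nodal_domains u) = j)) \<and>
       (\<exists>\<gamma> u. nth_eigenvalue Neumann g 2 \<gamma> \<and> eigenfunction Neumann g \<gamma> u \<and>
          (\<forall>x\<in>closed_disc - {0}. u x < u 0)))"
proof -
  \<comment> \<open>One more than \<open>m\<close>, so that the second Neumann eigenvalue is covered
    also for \<open>m = 1\<close>.\<close>
  define K where "K = Suc m"
  define n where "n = 16 * pi\<^sup>2 * real K"
  have K: "K \<ge> 1" by (simp add: K_def)
  have n: "n > 0" by (simp add: n_def K_def)
  have n0: "n \<ge> 0" using n by simp
  let ?g = "cigar n"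
  have pos_nu: "\<nu> > 0" if "\<nu> \<ge> 0" "phi n \<nu> 1 = tau bc + real k * pi" "k \<ge> 1" for \<nu> bc k
  proof -
    have "tau bc \<ge> 0" by (cases bc) (auto simp: tau_def)
    then have "phi n \<nu> 1 > 0" using that by (simp add: add_nonneg_pos)
    then have "\<nu> \<noteq> 0" by auto
    then show ?thesis using that by simp
  qed
  have curv: "gauss_curvature ?g x > 0" if "x \<in> closed_disc" for x
    using gauss_curvature_cigar[OF n0 that] one_plus_pos[OF n0, of x] n by simp
  have part1: "(\<forall>j\<in>{1..m}. \<exists>\<gamma>. nth_eigenvalue bc ?g j \<gamma> \<and> simple_eigenvalue bc ?g \<gamma>) \<and>
      (\<forall>j\<in>{2..m}. \<forall>\<gamma> u. nth_eigenvalue bc ?g j \<gamma> \<and> eigenfunction bc ?g \<gamma> u \<longrightarrow>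
         S1_invariant_fun u \<and> card (nodal_lines u) = j - 1 \<and>
         (\<forall>C\<in>nodal_lines u. is_circle C \<and> C \<subseteq> disc) \<and>
         pairwise disjnt (nodal_lines u) \<and> card (nodal_domains u) = j)" for bc
  proof -
    obtain nu where "radial_spectrum n K bc nu" using spectrum_cigar[OF K n_def] by blast
    note nu = radial_spectrumD[OF this]
    show ?thesis
    proof (intro conjI ballI allI impI)
      fix j assume "j \<in> {1..m}"
      then have j: "1 \<le> j" "j \<le> K" "j - 1 < K" by (auto simp: K_def)
      show "\<exists>\<gamma>. nth_eigenvalue bc ?g j \<gamma> \<and> simple_eigenvalue bc ?g \<gamma>"
        using nu(2)[OF j(3)] nu(5)[OF j(1,2)] unfolding simple_eigenvalue_def by blast
    next
      fix j \<gamma> u assume "j \<in> {2..m}" and u: "nth_eigenvalue bc ?g j \<gamma> \<and> eigenfunction bc ?g \<gamma> u"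
      then have j: "1 \<le> j" "j \<le> K" "j - 1 < K" "1 \<le> j - 1" by (auto simp: K_def)
      define \<nu> where "\<nu> = nu (j - 1)"
      have \<gamma>: "\<gamma> = 4 * \<nu>\<^sup>2 / n" using nu(5)[OF j(1,2)] u by (simp add: \<nu>_def)
      have eq: "u = usol n \<nu> (u 0)" and nz: "u \<noteq> (\<lambda>x. 0)"
        using nu(4)[OF j(3), of u] u \<gamma> by (auto simp: eigenfunction_def \<nu>_def)
      have c: "u 0 \<noteq> 0"
      proof
        assume "u 0 = 0"
        then have "u = usol n \<nu> 0" using eq by metis
        then show False using nz by (simp add: usol_0)
      qed
      have phi: "\<nu> \<ge> 0" "phi n \<nu> 1 = tau bc + real (j - 1) * pi" using nu(1)[OF j(3)] by (auto simp: \<nu>_def)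
      obtain \<rho> :: "nat \<Rightarrow> real" where \<rho>: "\<forall>i l. i < l \<longrightarrow> l < j - 1 \<longrightarrow> \<rho> i < \<rho> l"
        "\<forall>i<j - 1. 0 < \<rho> i \<and> \<rho> i < 1"
        "\<forall>c x. c \<noteq> 0 \<longrightarrow> x \<in> disc \<longrightarrow> (usol n \<nu> c x = 0 \<longleftrightarrow> (\<exists>i<j - 1. norm x = \<rho> i))"
        using usol_zeros[OF n pos_nu[OF phi j(4)] phi(2)] by blast
      have "u x = 0 \<longleftrightarrow> (\<exists>i<j - 1. norm x = \<rho> i)" if "x \<in> disc" for x
        using \<rho>(3) c that eq by metis
      note nodal = nodal_circles[of "j - 1" \<rho> u, OF \<rho>(1,2)[rule_format] this]
      show "S1_invariant_fun u" using S1_invariant_usol eq by metis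
      show "card (nodal_lines u) = j - 1" "pairwise disjnt (nodal_lines u)" using nodal by auto
      show "is_circle C" "C \<subseteq> disc" if "C \<in> nodal_lines u" for C using nodal(2) that by auto
      show "card (nodal_domains u) = j" using nodal(4) j by simp
    qed
  qed
  have part2: "\<exists>\<gamma> u. nth_eigenvalue Neumann ?g 2 \<gamma> \<and> eigenfunction Neumann ?g \<gamma> u \<and>
      (\<forall>x\<in>closed_disc - {0}. u x < u 0)"
  proof -
    have K2: "1 \<le> (2::nat)" "2 \<le> K" "1 < K" using assms by (auto simp: K_def)
    obtain nu where "radial_spectrum n K Neumann nu" using spectrum_cigar[OF K n_def] by blast
    note nu = radial_spectrumD[OF this]
    define \<nu> where "\<nu> = nu 1"
    have phi: "\<nu> \<ge> 0" "phi n \<nu> 1 = tau Neumann + real 1 * pi" using nu(1)[OF K2(3)] by (auto simp: \<nu>_def)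
    have \<nu>: "\<nu> > 0" by (rule pos_nu[OF phi]) simp
    have "usol n \<nu> 1 x < usol n \<nu> 1 0" if x: "x \<in> closed_disc - {0}" for x
    proof -
      have "0 < x \<bullet> x" "x \<bullet> x \<le> 1" using x by (auto simp: norm_le_square[of x 1])
      then show ?thesis
        using vsol_decreasing[OF n \<nu>, of "x \<bullet> x"] phi(2) x by (simp add: usol_def tau_def)
    qed
    moreover have "nth_eigenvalue Neumann ?g 2 (4 * \<nu>\<^sup>2 / n)"
      using nu(5)[OF K2(1,2)] by (simp add: \<nu>_def)
    moreover have "eigenfunction Neumann ?g (4 * \<nu>\<^sup>2 / n) (usol n \<nu> 1)"
      using nu(3)[OF K2(3)] usol_nonzero by (simp add: eigenfunction_def \<nu>_def)
    ultimately show ?thesis by blast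
  qed
  show ?thesis
    by (intro exI[of _ "{?g}"] conjI ballI)
      (use riemannian_metric_cigar[OF n0] S1_invariant_metric_cigar curv total_area_cigar[OF n0] part1 part2 in \<open>simp_all\<close>)
qed

end
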